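(* Let $m\ge 2$, $k\ge 1$, and let $L$ be a homogeneous Lagrangian on the bundle $\mathcal{F}^k_{(m)}E$ of $k$-th order $m$-frames of a smooth manifold $E$. Let $\Theta_0$ be the class of $L\,d^mt$, $\Theta_1=Pd\Theta_0$ and $\Theta_2=Pd\Theta_1=(Pd)^2\Theta_0$. Then $$\Theta_1=\frac{1}{m-1}\,i_{\mathrm T}\Theta_2 .$$
   Context: $E$ is a smooth manifold of dimension $n$. For $k\ge1$, $\mathcal{F}^k_{(m)}E$ is the manifold of $k$-jets at $0$ of maps $\gamma$ from a neighbourhood of $0\in\mathbb{R}^m$ to $E$ which are immersions at $0$ (the bundle of $k$-th order $m$-frames, or regular $k$-th order $m$-velocities); $\tau_{k+1,k}:\mathcal{F}^{k+1}_{(m)}E\to\mathcal{F}^k_{(m)}E$ is the projection. Local coordinates $(u^\alpha)$ on $E$ give coordinates $u^\alpha_I$, $0\le|I|\le k$, on $\mathcal{F}^k_{(m)}E$, where $u^\alpha_I$ is the partial derivative $\partial^{|I|}\gamma^\alpha/\partial t^I$ at $0$. Here $I\in\mathbb{N}^m$ is a multi-index with entries $I(i)$, $|I|=\sum_i I(i)$, $I!=\prod_i I(i)!$, and $1_j$ is the multi-index with $1$ in position $j$ and $0$ elsewhere. Repeated indices are summed. Pull-backs by the projections between frame bundles are omitted: forms are identified with their pull-backs. Total derivatives: $\mathrm{T}_j=\sum_{|I|=0}^k u^\alpha_{I+1_j}\,\partial/\partial u^\alpha_I$, a vector field along $\tau_{k+1,k}$. For a form $\phi$ on $\mathcal{F}^k_{(m)}E$,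 $i_j\phi$ is its contraction with $\mathrm{T}_j$ and $d_j\phi=i_jd\phi+d\,i_j\phi$ its Lie derivative; both are forms on $\mathcal{F}^{k+1}_{(m)}E$. The $d_j$ commute, and $d_I$ denotes the iterated operator. Vertical endomorphisms: $S^i=\sum_{|I|=0}^{k-1}(I(i)+1)\,\frac{\partial}{\partial u^\alpha_{I+1_i}}\otimes du^\alpha_I$ is a type $(1,1)$ tensor field on $\mathcal{F}^k_{(m)}E$. $S^i$ also denotes the contraction with forms, i.e. the degree-$0$ derivation which is zero on functions and satisfies $(S^i\phi)(X_1,\ldots,X_r)=\sum_a\phi(X_1,\ldots,S^iX_a,\ldots,X_r)$. The $S^i$ commute, and $S^I$ acting on forms is the iterated contraction. Fundamental vector fields: for $|K|\ge1$, $\Delta^K_j=S^K(\mathrm{T}_j)$ (with $S^K$ the composite tensor field), in coordinates $\Delta^K_j=\sum_{|I|=0}^{k-|K|}\frac{(I+K)!}{I!}u^\alpha_{I+1_j}\,\partial/\partial u^\alpha_{I+K}$ on $\mathcal{F}^k_{(m)}E$; $d^K_j$ is the Lie derivative along $\Delta^K_j$, with $d^i_j=d^{1_i}_j$. A Lagrangian is a smooth function $L$ on $\mathcal{F}^k_{(m)}E$. It is homogeneous if $d^i_jL=\delta^i_jL$ for all $i,j$ and $d^I_jL=0$ for all $j$ and all $|I|\ge2$. Vector-valued forms: $\Omega^{r,s}_k=\Omega^r(\mathcal{F}^k_{(m)}E)\otimes\bigwedge^s\mathbb{R}^{m*}$. With $(dt^i)$ the standard basis of $\mathbb{R}^{m*}$,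 an element is written $\Phi=\phi_{i_1\cdots i_s}\otimes dt^{i_1}\wedge\cdots\wedge dt^{i_s}$ with scalar $r$-forms $\phi_{i_1\cdots i_s}$ completely skew in their indices. $\overline{\Omega}^{0,s}_k$ is the quotient of $\Omega^{0,s}_k$ by the constant functions. Put $d^mt=dt^1\wedge\cdots\wedge dt^m$. The operator $d$ acts componentwise (and is well defined on $\overline{\Omega}^{0,s}_k$), and $i_{\mathrm T}\Phi=(i_j\phi_{i_1\cdots i_s})\otimes dt^j\wedge dt^{i_1}\wedge\cdots\wedge dt^{i_s}$. The operator $P$ on $\Omega^{r,s}_k$ ($r\ge1$), with values in $\Omega^{r,s-1}_{(r+1)k-1}$, is $$P\Phi=P^j_{(s)}(\phi_{i_1\cdots i_s})\otimes\Big\{\tfrac{\partial}{\partial t^j}\lrcorner\,(dt^{i_1}\wedge\cdots\wedge dt^{i_s})\Big\},\qquad P^j_{(s)}=\sum_{|J|=0}^{rk-1}\frac{(-1)^{|J|}(m-s)!\,|J|!}{r^{|J|+1}(m-s+|J|+1)!\,J!}\,d_JS^{J+1_j},$$ where $\lrcorner$ denotes contraction. $\Theta_0\in\overline{\Omega}^{0,m}_k$ is the class of $L\,d^mt$. Then $\Theta_1$ is a vector-valued $1$-form with values in $\bigwedge^{m-1}\mathbb{R}^{m*}$ and $\Theta_2$ a vector-valued $2$-form with values in $\bigwedge^{m-2}\mathbb{R}^{m*}$. *)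

theory Defs
  imports "HOL-Analysis.Analysis"
begin

section \<open>Multi-indices and smooth functions\<close>

text \<open>The index type \<open>'m\<close> of \<open>\<real>\<^sup>m\<close> is linearly ordered, so that the
  standard basis is an ordered one; multi-indices are elements of \<^typ>\<open>nat ^ 'm\<close>, and
  \<open>1\<^sub>j\<close> is \<open>axis j 1\<close>.\<close>

type_synonym 'm mindex = "nat ^ 'm"

definition mi_size :: "('m::finite) mindex \<Rightarrow> nat" where
  "mi_size I = (\<Sum>i\<in>UNIV. I $ i)"

definition mi_fact :: "('m::finite) mindex \<Rightarrow> nat" where
  "mi_fact I = (\<Prod>i\<in>UNIV. fact (I $ i))"

text \<open>\<open>mi_iter f I\<close> is the composite of the \<open>f i\<close>, each taken \<open>I $ i\<close> times. It is only used for
  operators which commute, so the order of the factors is immaterial.\<close>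

definition mi_iter :: "('m::{finite,linorder} \<Rightarrow> 'a \<Rightarrow> 'a) \<Rightarrow> 'm mindex \<Rightarrow> 'a \<Rightarrow> 'a" where
  "mi_iter f I = foldr (\<lambda>i. f i ^^ (I $ i)) (sorted_list_of_set UNIV)"

text \<open>A coordinate system is described by its coordinate translations: \<open>\<sigma> i h x\<close> is the point \<open>x\<close> with
  its \<open>i\<close>-th coordinate increased by \<open>h\<close>. A function is smooth on the open set \<open>W\<close> if all its iterated
  partial derivatives exist and are continuous there.\<close>

definition pderiv_along :: "(real \<Rightarrow> 'x \<Rightarrow> 'x) \<Rightarrow> ('x \<Rightarrow> real) \<Rightarrow> 'x \<Rightarrow> real" where
  "pderiv_along \<tau> f x = deriv (\<lambda>h. f (\<tau> h x)) 0"

definition smooth_along ::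
  "('i \<Rightarrow> real \<Rightarrow> 'x \<Rightarrow> 'x) \<Rightarrow> 'x::topological_space set \<Rightarrow> ('x \<Rightarrow> real) \<Rightarrow> bool" where
  "smooth_along \<sigma> W f \<longleftrightarrow>
    (\<forall>is. let g = foldr (\<lambda>i. pderiv_along (\<sigma> i)) is f in
       continuous_on W g \<and> (\<forall>i. \<forall>x\<in>W. (\<lambda>h. g (\<sigma> i h x)) differentiable (at 0)))"

definition vec_shift :: "'a::finite \<Rightarrow> real \<Rightarrow> real ^ 'a \<Rightarrow> real ^ 'a" where
  "vec_shift i h v = v + h *\<^sub>R axis i 1"


section \<open>The manifold \<open>E\<close> and its frame bundles\<close>

type_synonym ('e, 'n) chart = "'e set \<times> ('e \<Rightarrow> real ^ 'n)"
type_synonym ('e, 'm) param = "real ^ 'm \<Rightarrow> 'e"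

definition smooth_manifold :: "'e topology \<Rightarrow> ('e, 'n::finite) chart set \<Rightarrow> bool" where
  "smooth_manifold E \<A> \<longleftrightarrow>
     Hausdorff_space E \<and> second_countable E \<and>
     (\<Union>(U, \<phi>)\<in>\<A>. U) = topspace E \<and>
     (\<forall>(U, \<phi>)\<in>\<A>. openin E U \<and> open (\<phi> ` U) \<and>
        homeomorphic_map (subtopology E U) (top_of_set (\<phi> ` U)) \<phi>) \<and>
     (\<forall>(U, \<phi>)\<in>\<A>. \<forall>(V, \<psi>)\<in>\<A>. \<forall>\<alpha>.
        smooth_along vec_shift (\<phi> ` (U \<inter> V)) (\<lambda>y. \<psi> (inv_into U \<phi> y) $ \<alpha>))"

text \<open>Jet coordinates: \<open>x I $ \<alpha>\<close> is \<open>u\<^sup>\<alpha>\<^sub>I\<close>. Coordinates of all orders are carried along, and an object on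
  the \<open>k\<close>-th order bundle is one which depends only on the coordinates with \<open>|I| \<le> k\<close>; this is how forms
  are identified with their pull-backs. The function type carries the product topology.\<close>

type_synonym ('m, 'n) jet = "nat ^ 'm \<Rightarrow> real ^ 'n"

definition jet_shift :: "'n::finite \<times> ('m::finite) mindex \<Rightarrow> real \<Rightarrow> ('m, 'n) jet \<Rightarrow> ('m, 'n) jet" where
  "jet_shift a h x = x(snd a := x (snd a) + h *\<^sub>R axis (fst a) 1)"

definition immersive :: "('m::finite, 'n::finite) jet \<Rightarrow> bool" where
  "immersive x \<longleftrightarrow> inj (\<lambda>v :: real ^ 'm. \<Sum>j\<in>UNIV. v $ j *\<^sub>R x (axis j 1))"

definition jet_of ::
  "('e, 'n::finite) chart \<Rightarrow> ('e, 'm) param \<Rightarrow> ('m::{finite,linorder}, 'n) jet" where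
  "jet_of c \<gamma> I =
     (\<chi> \<alpha>. mi_iter (\<lambda>j. pderiv_along (vec_shift j)) I (\<lambda>t. snd c (\<gamma> t) $ \<alpha>) 0)"

text \<open>Maps into \<open>E\<close> which are defined and smooth near \<open>0\<close> and immersive at \<open>0\<close>; only their values near
  \<open>0\<close> matter.\<close>

definition frame_maps ::
  "('e, 'n::finite) chart set \<Rightarrow> ('e, 'm::{finite,linorder}) param set" where
  "frame_maps \<A> = {\<gamma>. \<exists>c\<in>\<A>. \<exists>N. open N \<and> 0 \<in> N \<and> \<gamma> ` N \<subseteq> fst c \<and>
      (\<forall>\<alpha>. smooth_along vec_shift N (\<lambda>t. snd c (\<gamma> t) $ \<alpha>)) \<and> immersive (jet_of c \<gamma>)}"

definition jet_rel ::
  "('e, 'n::finite) chart set \<Rightarrow> nat \<Rightarrow> ('e, 'm::{finite,linorder}) param rel" where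
  "jet_rel \<A> k = {(\<gamma>, \<delta>). \<gamma> \<in> frame_maps \<A> \<and> \<delta> \<in> frame_maps \<A> \<and> \<gamma> 0 = \<delta> 0 \<and>
      (\<forall>c\<in>\<A>. \<gamma> 0 \<in> fst c \<longrightarrow> (\<forall>I. mi_size I \<le> k \<longrightarrow> jet_of c \<gamma> I = jet_of c \<delta> I))}"

definition frame_bundle ::
  "('e, 'n::finite) chart set \<Rightarrow> nat \<Rightarrow> ('e, 'm::{finite,linorder}) param set set" where
  "frame_bundle \<A> k = frame_maps \<A> // jet_rel \<A> k"

text \<open>The range of the jet coordinates induced by a chart, and the expression in these coordinates of a
  function on the \<open>k\<close>-th order frame bundle.\<close>

definition jet_domain :: "('e, 'n::finite) chart \<Rightarrow> ('m::finite, 'n) jet set" where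
  "jet_domain c = {x. x 0 \<in> snd c ` fst c \<and> immersive x}"

definition coord_rep ::
  "('e, 'n::finite) chart set \<Rightarrow> nat \<Rightarrow> ('e, 'n) chart \<Rightarrow>
   (('e, 'm::{finite,linorder}) param set \<Rightarrow> real) \<Rightarrow> ('m, 'n) jet \<Rightarrow> real" where
  "coord_rep \<A> k c f x = f (SOME p. p \<in> frame_bundle \<A> k \<and>
      (\<forall>\<gamma>\<in>p. \<gamma> 0 \<in> fst c \<and> (\<forall>I. mi_size I \<le> k \<longrightarrow> jet_of c \<gamma> I = x I)))"

definition smooth_on_frames ::
  "('e, 'n::finite) chart set \<Rightarrow> nat \<Rightarrow>
   (('e, 'm::{finite,linorder}) param set \<Rightarrow> real) \<Rightarrow> bool" where
  "smooth_on_frames \<A> k f \<longleftrightarrow>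
     (\<forall>c\<in>\<A>. smooth_along jet_shift (jet_domain c) (coord_rep \<A> k c f))"


section \<open>Differential forms in jet coordinates\<close>

text \<open>Tangent vectors are given by their components, \<open>X I $ \<alpha>\<close> being the coefficient of
  \<open>\<partial>/\<partial>u\<^sup>\<alpha>\<^sub>I\<close>. An \<open>r\<close>-form is evaluated at a point on the list of its \<open>r\<close> arguments, and is \<open>0\<close>
  on lists of any other length.\<close>

type_synonym ('m, 'n) form = "('m, 'n) jet \<Rightarrow> ('m, 'n) jet list \<Rightarrow> real"

definition fun_form :: "(('m, 'n) jet \<Rightarrow> real) \<Rightarrow> ('m, 'n) form" where
  "fun_form f x Xs = (if Xs = [] then f x else 0)"

definition dir_deriv :: "('m, 'n::finite) jet \<Rightarrow> (('m, 'n) jet \<Rightarrow> real) \<Rightarrow> ('m, 'n) jet \<Rightarrow> real" where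
  "dir_deriv X f x = pderiv_along (\<lambda>h y I. y I + h *\<^sub>R X I) f x"

text \<open>The usual formula for \<open>d\<phi>(X\<^sub>0,\<dots>,X\<^sub>r)\<close>, the \<open>X\<^sub>a\<close> being extended with constant components
  (so that their brackets vanish).\<close>

definition ext_d :: "('m, 'n::finite) form \<Rightarrow> ('m, 'n) form" where
  "ext_d \<phi> x Xs = (\<Sum>a<length Xs.
      (-1) ^ a * dir_deriv (Xs ! a) (\<lambda>y. \<phi> y (take a Xs @ drop (Suc a) Xs)) x)"

definition contract :: "(('m, 'n) jet \<Rightarrow> ('m, 'n) jet) \<Rightarrow> ('m, 'n) form \<Rightarrow> ('m, 'n) form" where
  "contract V \<phi> x Xs = \<phi> x (V x # Xs)"

definition lie :: "(('m, 'n::finite) jet \<Rightarrow> ('m, 'n) jet) \<Rightarrow> ('m, 'n) form \<Rightarrow> ('m, 'n) form" where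
  "lie V \<phi> x Xs = contract V (ext_d \<phi>) x Xs + ext_d (contract V \<phi>) x Xs"

definition total_deriv :: "'m::finite \<Rightarrow> ('m, 'n) jet \<Rightarrow> ('m, 'n) jet" where
  "total_deriv j x I = x (I + axis j 1)"

text \<open>\<open>S\<^sup>i\<close> sends \<open>\<partial>/\<partial>u\<^sup>\<alpha>\<^sub>I\<close> to \<open>(I(i)+1) \<partial>/\<partial>u\<^sup>\<alpha>\<close> with lower index \<open>J = I + 1\<^sub>i\<close>; the factor is
  \<open>J(i)\<close>, which vanishes exactly when the truncated subtraction \<open>J - 1\<^sub>i\<close> is not proper.\<close>

definition vert_endo :: "'m::finite \<Rightarrow> ('m, 'n) jet \<Rightarrow> ('m, 'n::finite) jet" where
  "vert_endo i X J = real (J $ i) *\<^sub>R X (J - axis i 1)"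

definition vert_form :: "'m::finite \<Rightarrow> ('m, 'n::finite) form \<Rightarrow> ('m, 'n) form" where
  "vert_form i \<phi> x Xs = (\<Sum>a<length Xs. \<phi> x (Xs[a := vert_endo i (Xs ! a)]))"

definition fund_field ::
  "('m::{finite,linorder}) mindex \<Rightarrow> 'm \<Rightarrow> ('m, 'n::finite) jet \<Rightarrow> ('m, 'n) jet" where
  "fund_field K j x = mi_iter vert_endo K (total_deriv j x)"

definition homogeneous ::
  "('e, 'n::finite) chart set \<Rightarrow> nat \<Rightarrow>
   (('e, 'm::{finite,linorder}) param set \<Rightarrow> real) \<Rightarrow> bool" where
  "homogeneous \<A> k L \<longleftrightarrow> (\<forall>c\<in>\<A>. \<forall>x\<in>jet_domain c.
     (\<forall>i j. lie (fund_field (axis i 1) j) (fun_form (coord_rep \<A> k c L)) x []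
              = (if i = j then coord_rep \<A> k c L x else 0)) \<and>
     (\<forall>I j. 2 \<le> mi_size I \<longrightarrow>
        lie (fund_field I j) (fun_form (coord_rep \<A> k c L)) x [] = 0))"


section \<open>Vector-valued forms\<close>

text \<open>An element of \<open>\<Omega> \<otimes> \<Lambda>\<real>\<^sup>m\<^sup>*\<close> is given by its coefficients with respect to the basis
  \<open>dt\<^sup>A = dt\<^bsup>a1\<^esup> \<and> \<dots> \<and> dt\<^bsup>as\<^esup>\<close>, where \<open>A = {a1 < \<dots> < as}\<close>. (The coefficient at \<open>A\<close> is \<open>s!\<close> times the
  skew component with indices \<open>a1, \<dots>, as\<close>; the operators below are linear, so summing over increasing
  indices with these coefficients is the same as summing the skew components over all indices.)
  \<open>wedge_coeff j A B\<close> and \<open>hook_coeff j A B\<close> are the coefficients of \<open>dt\<^sup>B\<close> in \<open>dt\<^sup>j \<and> dt\<^sup>A\<close> and in the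
  contraction of \<open>dt\<^sup>A\<close> with \<open>\<partial>/\<partial>t\<^sup>j\<close>.\<close>

type_synonym ('m, 'n) vform = "'m set \<Rightarrow> ('m, 'n) form"

definition wedge_coeff :: "'m::{finite,linorder} \<Rightarrow> 'm set \<Rightarrow> 'm set \<Rightarrow> real" where
  "wedge_coeff j A B = (if j \<notin> A \<and> B = insert j A then (-1) ^ card {a\<in>A. a < j} else 0)"

definition hook_coeff :: "'m::{finite,linorder} \<Rightarrow> 'm set \<Rightarrow> 'm set \<Rightarrow> real" where
  "hook_coeff j A B = (if j \<in> A \<and> B = A - {j} then (-1) ^ card {a\<in>A. a < j} else 0)"

definition v_ext_d :: "('m, 'n::finite) vform \<Rightarrow> ('m, 'n) vform" where
  "v_ext_d \<Phi> A = ext_d (\<Phi> A)"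

definition v_total :: "('m::{finite,linorder}, 'n) vform \<Rightarrow> ('m, 'n) vform" where
  "v_total \<Phi> B x Xs =
     (\<Sum>A\<in>UNIV. \<Sum>j\<in>UNIV. wedge_coeff j A B * contract (total_deriv j) (\<Phi> A) x Xs)"

text \<open>\<open>P_scalar k r s j\<close> is \<open>P\<^sup>j\<^sub>(\<^sub>s\<^sub>)\<close> acting on scalar \<open>r\<close>-forms of order \<open>k\<close>.\<close>

definition P_scalar ::
  "nat \<Rightarrow> nat \<Rightarrow> nat \<Rightarrow> 'm \<Rightarrow> ('m::{finite,linorder}, 'n::finite) form \<Rightarrow> ('m, 'n) form" where
  "P_scalar k r s j \<phi> x Xs =
     (\<Sum>J | mi_size J \<le> r * k - 1.
        (-1) ^ mi_size J * fact (CARD('m) - s) * fact (mi_size J)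
          / (real r ^ (mi_size J + 1) * fact (CARD('m) - s + mi_size J + 1) * real (mi_fact J))
        * mi_iter (\<lambda>i. lie (total_deriv i)) J (mi_iter vert_form (J + axis j 1) \<phi>) x Xs)"

definition P_op ::
  "nat \<Rightarrow> nat \<Rightarrow> nat \<Rightarrow> ('m::{finite,linorder}, 'n::finite) vform \<Rightarrow> ('m, 'n) vform" where
  "P_op k r s \<Phi> B x Xs =
     (\<Sum>A\<in>UNIV. \<Sum>j\<in>UNIV. hook_coeff j A B * P_scalar k r s j (\<Phi> A) x Xs)"


section \<open>The forms \<open>\<Theta>\<^sub>0\<close>, \<open>\<Theta>\<^sub>1\<close>, \<open>\<Theta>\<^sub>2\<close>\<close>

text \<open>Cosets of vector-valued functions modulo constants, and the operator \<open>d\<close> induced on them (expressed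
  in the chart \<open>c\<close>).\<close>

definition const_coset :: "nat \<Rightarrow> ('m set \<Rightarrow> 'p \<Rightarrow> real) \<Rightarrow> ('m set \<Rightarrow> 'p \<Rightarrow> real) set" where
  "const_coset s F = {G. \<exists>b. (\<forall>A. card A \<noteq> s \<longrightarrow> b A = 0) \<and> G = (\<lambda>A p. F A p + b A)}"

definition coset_d ::
  "('e, 'n::finite) chart set \<Rightarrow> nat \<Rightarrow> ('e, 'n) chart \<Rightarrow>
   ('m set \<Rightarrow> ('e, 'm::{finite,linorder}) param set \<Rightarrow> real) set \<Rightarrow> ('m, 'n) vform" where
  "coset_d \<A> k c \<Theta> = v_ext_d (\<lambda>A. fun_form (coord_rep \<A> k c ((SOME F. F \<in> \<Theta>) A)))"

definition Theta0 ::
  "(('e, 'm::{finite,linorder}) param set \<Rightarrow> real) \<Rightarrow>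
   ('m set \<Rightarrow> ('e, 'm) param set \<Rightarrow> real) set" where
  "Theta0 L = const_coset CARD('m) (\<lambda>A p. if A = UNIV then L p else 0)"

text \<open>\<open>\<Theta>\<^sub>1\<close> and \<open>\<Theta>\<^sub>2\<close>, which are of orders \<open>2k-1\<close> and \<open>3(2k-1)-1\<close>, are families of coordinate expressions,
  one for each chart \<open>c\<close>.\<close>

definition Theta1 ::
  "('e, 'n::finite) chart set \<Rightarrow> nat \<Rightarrow>
   (('e, 'm::{finite,linorder}) param set \<Rightarrow> real) \<Rightarrow> ('e, 'n) chart \<Rightarrow> ('m, 'n) vform" where
  "Theta1 \<A> k L c = P_op k 1 CARD('m) (coset_d \<A> k c (Theta0 L))"

definition Theta2 ::
  "('e, 'n::finite) chart set \<Rightarrow> nat \<Rightarrow>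
   (('e, 'm::{finite,linorder}) param set \<Rightarrow> real) \<Rightarrow> ('e, 'n) chart \<Rightarrow> ('m, 'n) vform" where
  "Theta2 \<A> k L c = P_op (2 * k - 1) 2 (CARD('m) - 1) (v_ext_d (Theta1 \<A> k L c))"

end

theory Submission
  imports Defs "HOL-Library.Function_Algebras"
begin

text \<open>Fix a chart. All forms involved have coefficients which are smooth functions of finitely many of
the jet coordinates. Write \<open>d\<^sub>j\<close> for the Lie derivative along the total derivative \<open>T\<^sub>j\<close>, \<open>i\<^sub>j\<close> for the
contraction with it, and \<open>S\<^sup>i\<close> for the contraction with the vertical endomorphism. A tangent vector at
a jet is the Taylor series at \<open>0\<close> of a variation; in this picture \<open>S\<^sup>i\<close> is multiplication by \<open>t\<^sup>i\<close> and
\<open>T\<^sub>j\<close> is \<open>\<partial>/\<partial>t\<^sup>j\<close>, which is why \<open>S\<^sup>i d\<^sub>l - d\<^sub>l S\<^sup>i = r \<delta>\<^sup>i\<^sub>l\<close> on \<open>r\<close>-forms, while the \<open>d\<^sub>i\<close> commute and the \<open>S\<^sup>i\<close>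
commute. So \<open>r\<close>-forms carry an action of the Weyl algebra with number operator \<open>N = \<Sum> d\<^sub>i S\<^sup>i\<close>.

Since \<open>n!/J!\<close> counts the words in which each letter \<open>i\<close> occurs \<open>J(i)\<close> times, the part of order \<open>n\<close> of
the operator \<open>P\<^sup>j\<close> is a multiple of \<open>U\<^sub>n S\<^sup>j\<close>, where \<open>U\<^sub>n\<close> is the sum of \<open>d\<^sub>w S\<^sup>w\<close> over all words \<open>w\<close> of
length \<open>n\<close> (\<open>sum_multinomial_words\<close>, \<open>P_scalar_words\<close>). Let \<open>\<theta>\<^sup>j = P\<^sup>j dL\<close>. As
\<open>dt\<^sup>i \<and> (\<partial>\<^sub>l \<lrcorner> \<partial>\<^sub>j \<lrcorner> d\<^sup>mt) = \<delta>\<^sup>i\<^sub>l \<partial>\<^sub>j \<lrcorner> d\<^sup>mt - \<delta>\<^sup>i\<^sub>j \<partial>\<^sub>l \<lrcorner> d\<^sup>mt\<close>, the theorem follows if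
\<open>i\<^sub>l (P\<^sup>l d\<theta>\<^sup>j - P\<^sup>j d\<theta>\<^sup>l) = \<theta>\<^sup>j\<close> for each of the \<open>m - 1\<close> indices \<open>l \<noteq> j\<close> (\<open>contraction_P2\<close>; here \<open>P\<^sup>l\<close> is the
operator on two-forms). The two-form in this formula can be computed in closed form:

\<^item> From \<open>U\<^sub>n N = U\<^bsub>n+1\<^esub> + r n U\<^sub>n\<close> the series \<open>\<Sum> (-1)\<^sup>n/(2\<^bsup>n+1\<^esup>(n+2)!) U\<^sub>n\<close>, which defines \<open>P\<^sup>l\<close> on two-forms,
  telescopes to a left inverse of \<open>N + 4\<close> (\<open>Pcoeff_inverse\<close>). So it suffices to find \<open>Y\<close> such that
  \<open>(N + 4) Y = S\<^sup>l d\<theta>\<^sup>j - S\<^sup>j d\<theta>\<^sup>l\<close>.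

\<^item> Moving \<open>S\<^sup>l\<close> to the right past the \<open>d\<^sub>w\<close> in \<open>d\<theta>\<^sup>j = \<Sum> c\<^sub>w d\<^sub>w d(S\<^sup>w S\<^sup>j dL)\<close> produces terms which are
  symmetric in \<open>l\<close> and \<open>j\<close> and therefore cancel. What remains leads to the normally ordered sums
  \<open>V\<^bsub>n,q\<^esub> = \<Sum> d\<^sub>u d\<^sub>w S\<^sup>u S\<^sup>l d(S\<^sup>w S\<^sup>j dL)\<close> over words \<open>u\<close> and \<open>w\<close> of lengths \<open>n\<close> and \<open>q\<close>, on which
  \<open>N\<close> acts by \<open>V\<^bsub>n,q\<^esub> \<mapsto> V\<^bsub>n+1,q\<^esub> + 2(n+q) V\<^bsub>n,q\<^esub>\<close>. Solving a two-term recurrence gives \<open>Y\<close>: the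
  coefficient of \<open>V\<^bsub>n,q\<^esub>\<close>, skew-symmetrised in \<open>l\<close> and \<open>j\<close>, is \<open>(-1)\<^bsup>n+q\<^esup>/(2\<^bsup>n+1\<^esup>(n+q+2)!)\<close>
  (\<open>number_Y\<close>, \<open>skew_P2\<close>).

Homogeneity enters only now. Differentiating \<open>\<Delta>\<^sup>K\<^sub>l L = \<delta> L\<close> evaluates the Hessian of \<open>L\<close> on the
fundamental vectors, and this determines the contraction of \<open>S\<^sup>u S\<^sup>l d(S\<^sup>w S\<^sup>j dL)\<close> with \<open>T\<^sub>l\<close>. After
skew-symmetrisation it is the multiple \<open>1 + 2\<^bsup>n+1\<^esup> + [q = 0]\<close> of \<open>S\<^sup>u S\<^sup>w S\<^sup>j dL\<close>
(\<open>homogeneity_relation\<close>). Summing over \<open>n + q\<close> fixed turns the coefficients of \<open>Y\<close> into those of \<open>\<theta>\<^sup>j\<close>.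

The finite sums in the definition of \<open>P\<close> are long enough for all this because \<open>S\<^sup>w\<close> annihilates an
\<open>r\<close>-form of order \<open>K\<close> as soon as \<open>w\<close> is longer than \<open>r K\<close>. The analytic input consists of the chain rule
and the symmetry of second derivatives for smooth functions of jets.\<close>

section \<open>Function spaces as real vector spaces\<close>

instantiation "fun" :: (type, real_vector) real_vector
begin
definition scaleR_fun_def: "c *\<^sub>R f = (\<lambda>x. c *\<^sub>R f x)"
instance
  by standard (simp_all add: scaleR_fun_def fun_eq_iff scaleR_add_right scaleR_add_left)
end

lemma scaleR_apply [simp]: "(c *\<^sub>R f) x = c *\<^sub>R f x"
  by (simp add: scaleR_fun_def)

lemma sum_apply: "(\<Sum>i\<in>A. f i) x = (\<Sum>i\<in>A. f i x)"
  by (induction A rule: infinite_finite_induct) auto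

section \<open>Multi-indices and jet coordinates\<close>

lemma finite_mi_size_le: "finite {I :: ('m::finite) mindex. mi_size I \<le> K}"
proof (rule finite_subset)
  show "{I :: 'm mindex. mi_size I \<le> K} \<subseteq> (\<lambda>f. \<chi> i. f i) ` (\<Pi>\<^sub>E i\<in>UNIV. {..K})"
  proof
    fix I :: "'m mindex" assume "I \<in> {I. mi_size I \<le> K}"
    moreover have "I $ i \<le> mi_size I" for i
      unfolding mi_size_def by (rule member_le_sum) auto
    ultimately have "(\<lambda>i. I $ i) \<in> (\<Pi>\<^sub>E i\<in>UNIV. {..K})"
      using order_trans by fastforce
    then show "I \<in> (\<lambda>f. \<chi> i. f i) ` (\<Pi>\<^sub>E i\<in>UNIV. {..K})"
      by (rule rev_image_eqI) (simp add: vec_eq_iff)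
  qed
  show "finite ((\<lambda>f. \<chi> i. (f i :: nat)) ` (\<Pi>\<^sub>E i\<in>(UNIV :: 'm set). {..K}))"
    by (intro finite_imageI finite_PiE) auto
qed

lemma mi_size_add: "mi_size (I + J) = mi_size I + mi_size J"
  by (simp add: mi_size_def sum.distrib)

lemma mi_size_axis [simp]: "mi_size (axis i (Suc 0)) = Suc 0"
  by (simp add: mi_size_def axis_def)

definition agree :: "nat \<Rightarrow> ('m::finite, 'n) jet \<Rightarrow> ('m, 'n) jet \<Rightarrow> bool" where
  "agree K x y \<longleftrightarrow> (\<forall>I. mi_size I \<le> K \<longrightarrow> x I = y I)"

definition jet_basis :: "'n::finite \<times> ('m::finite) mindex \<Rightarrow> ('m, 'n) jet" where
  "jet_basis a I = (if I = snd a then axis (fst a) 1 else 0)"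

text \<open>The indices of the jet coordinates of order at most \<open>K\<close>: a finite set, which is what makes the chain
rule below a finite sum.\<close>

definition coords :: "nat \<Rightarrow> ('n::finite \<times> ('m::finite) mindex) set" where
  "coords K = UNIV \<times> {I. mi_size I \<le> K}"

lemma finite_coords [simp]: "finite (coords K)"
  unfolding coords_def by (intro finite_cartesian_product finite_mi_size_le) simp

lemma agree_truncation:
  fixes X :: "('m::finite, 'n::finite) jet"
  shows "agree K (\<Sum>a\<in>coords K. (X (snd a) $ fst a) *\<^sub>R jet_basis a) X"
  unfolding agree_def
proof (intro allI impI)
  fix I :: "'m mindex" assume I: "mi_size I \<le> K"
  have "(\<Sum>a\<in>coords K. (X (snd a) $ fst a) *\<^sub>R (jet_basis a :: ('m,'n) jet)) I =
        (\<Sum>a\<in>coords K. (X (snd a) $ fst a) *\<^sub>R jet_basis a I)"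
    by (simp add: sum_apply)
  also have "\<dots> = (\<Sum>\<alpha>\<in>UNIV. \<Sum>J\<in>{I. mi_size I \<le> K}. (X J $ \<alpha>) *\<^sub>R jet_basis (\<alpha>, J) I)"
    unfolding coords_def by (subst sum.cartesian_product) (simp add: case_prod_beta)
  also have "\<dots> = (\<Sum>\<alpha>\<in>UNIV. \<Sum>J\<in>{I. mi_size I \<le> K}. if J = I then (X J $ \<alpha>) *\<^sub>R axis \<alpha> 1 else 0)"
    by (intro sum.cong refl) (auto simp: jet_basis_def)
  also have "\<dots> = (\<Sum>\<alpha>\<in>UNIV. (X I $ \<alpha>) *\<^sub>R axis \<alpha> 1)"
    using I by (intro sum.cong refl) (simp add: finite_mi_size_le)
  also have "\<dots> = X I"
    by (simp add: vec_eq_iff axis_def if_distrib cong: if_cong)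
  finally show "(\<Sum>a\<in>coords K. (X (snd a) $ fst a) *\<^sub>R jet_basis a) I = X I" .
qed

lemma agree_mono: "agree K x y \<Longrightarrow> K' \<le> K \<Longrightarrow> agree K' x y"
  by (simp add: agree_def)

lemma jet_shift_eq: "jet_shift a h x = x + h *\<^sub>R jet_basis a"
  by (auto simp: jet_shift_def jet_basis_def fun_eq_iff)

lemma dir_deriv_eq: "dir_deriv X f x = deriv (\<lambda>h. f (x + h *\<^sub>R X)) 0"
  by (simp add: dir_deriv_def pderiv_along_def plus_fun_def scaleR_fun_def)

lemma pderiv_along_jet_shift: "pderiv_along (jet_shift a) = dir_deriv (jet_basis a)"
  by (simp add: fun_eq_iff dir_deriv_eq pderiv_along_def jet_shift_eq)

section \<open>Smooth functions of jets\<close>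

definition differentiable_along ::
  "('m::finite, 'n::finite) jet \<Rightarrow> (('m, 'n) jet \<Rightarrow> real) \<Rightarrow> ('m, 'n) jet \<Rightarrow> bool" where
  "differentiable_along X f x \<longleftrightarrow> (\<lambda>h. f (x + h *\<^sub>R X)) differentiable (at (0::real))"

lemma differentiable_alongI:
  "((\<lambda>h. f (x + h *\<^sub>R X)) has_real_derivative D) (at 0) \<Longrightarrow> differentiable_along X f x"
  unfolding differentiable_along_def
  using real_differentiable_def by blast

lemma differentiable_alongD:
  "differentiable_along X f x \<Longrightarrow>
     ((\<lambda>h. f (x + h *\<^sub>R X)) has_real_derivative dir_deriv X f x) (at 0)"
  unfolding differentiable_along_def dir_deriv_eq
  by (simp add: DERIV_deriv_iff_real_differentiable)

lemma dir_derivI: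
  "((\<lambda>h. f (x + h *\<^sub>R X)) has_real_derivative D) (at 0) \<Longrightarrow> dir_deriv X f x = D"
  unfolding dir_deriv_eq by (rule DERIV_imp_deriv)

lemma dir_deriv_const [simp]: "dir_deriv X (\<lambda>y. c) x = 0"
  by (rule dir_derivI) simp

lemma has_derivative_along_line:
  assumes "differentiable_along X f (x + h *\<^sub>R X)"
  shows "((\<lambda>s. f (x + s *\<^sub>R X)) has_real_derivative dir_deriv X f (x + h *\<^sub>R X)) (at h)"
proof -
  have "((\<lambda>s. f (x + (s + h) *\<^sub>R X)) has_real_derivative dir_deriv X f (x + h *\<^sub>R X)) (at 0)"
    using differentiable_alongD[OF assms] by (simp add: algebra_simps)
  then show ?thesis
    using DERIV_shift[of "\<lambda>s. f (x + s *\<^sub>R X)" _ 0 h] by simp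
qed

lemma continuous_jet_plane:
  fixes x v w :: "('m::finite, 'n::finite) jet"
  shows "continuous_on UNIV (\<lambda>p :: real \<times> real. x + fst p *\<^sub>R v + snd p *\<^sub>R w)"
proof (rule continuous_on_coordinatewise_then_product)
  fix I
  show "continuous_on UNIV (\<lambda>p :: real \<times> real. (x + fst p *\<^sub>R v + snd p *\<^sub>R w) I)"
    by (simp, intro continuous_intros)
qed

text \<open>The jet space carries the product topology and no norm; small steps in two given directions are the
only neighbourhoods that the derivative arguments below use.\<close>

lemma open_jet_plane:
  fixes x v w :: "('m::finite, 'n::finite) jet"
  assumes "open S" "x \<in> S"
  obtains \<delta> where "\<delta> > 0" "\<And>a b. \<bar>a\<bar> < \<delta> \<Longrightarrow> \<bar>b\<bar> < \<delta> \<Longrightarrow> x + a *\<^sub>R v + b *\<^sub>R w \<in> S"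
proof -
  let ?F = "\<lambda>p :: real \<times> real. x + fst p *\<^sub>R v + snd p *\<^sub>R w"
  have "open (?F -` S)"
    using continuous_jet_plane assms(1) by (rule continuous_on_open_vimage[THEN iffD1, rule_format, OF open_UNIV, simplified])
  moreover have "0 \<in> ?F -` S" using assms(2) by (simp add: zero_prod_def)
  ultimately obtain e where e: "e > 0" "ball 0 e \<subseteq> ?F -` S"
    using open_contains_ball by blast
  show thesis
  proof (rule that[of "e / 2"])
    fix a b :: real assume ab: "\<bar>a\<bar> < e / 2" "\<bar>b\<bar> < e / 2"
    have "norm (a, b) \<le> \<bar>a\<bar> + \<bar>b\<bar>" using norm_Pair_le[of a b] by simp
    also have "\<dots> < e" using ab by simp
    finally have "(a, b) \<in> ball 0 e" by simp
    then show "x + a *\<^sub>R v + b *\<^sub>R w \<in> S" using e(2) by auto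
  qed (use e in simp)
qed

lemma smooth_alongD:
  assumes "smooth_along \<sigma> W f"
  shows smooth_along_continuous: "continuous_on W f"
    and smooth_along_differentiable: "\<And>i x. x \<in> W \<Longrightarrow> (\<lambda>h. f (\<sigma> i h x)) differentiable (at 0)"
    and smooth_along_pderiv: "\<And>i. smooth_along \<sigma> W (pderiv_along (\<sigma> i) f)"
proof -
  have A: "let g = foldr (\<lambda>i. pderiv_along (\<sigma> i)) is f in
       continuous_on W g \<and> (\<forall>i. \<forall>x\<in>W. (\<lambda>h. g (\<sigma> i h x)) differentiable (at 0))" for "is"
    using assms unfolding smooth_along_def by blast
  show "continuous_on W f" "\<And>i x. x \<in> W \<Longrightarrow> (\<lambda>h. f (\<sigma> i h x)) differentiable (at 0)"
    using A[of "[]"] by (auto simp: Let_def)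
  show "smooth_along \<sigma> W (pderiv_along (\<sigma> i) f)" for i
    unfolding smooth_along_def
  proof
    fix "is"
    show "let g = foldr (\<lambda>i. pderiv_along (\<sigma> i)) is (pderiv_along (\<sigma> i) f) in
       continuous_on W g \<and> (\<forall>i. \<forall>x\<in>W. (\<lambda>h. g (\<sigma> i h x)) differentiable (at 0))"
      using A[of "is @ [i]"] by simp
  qed
qed

text \<open>The range of the jet coordinates over a chart is of this kind: membership is an open condition on the
coordinates of orders \<open>0\<close> and \<open>1\<close>. Openness makes derivatives local; saturation lets all coordinates of
higher order be varied freely.\<close>

locale jet_region =
  fixes W :: "('m::{finite,linorder}, 'n::finite) jet set"
  assumes open_W: "open W"
    and saturated: "x \<in> W \<Longrightarrow> agree 1 x y \<Longrightarrow> y \<in> W"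
begin

lemma line_in_W:
  assumes "x \<in> W"
  shows "\<forall>\<^sub>F h in nhds (0::real). x + h *\<^sub>R X \<in> W"
proof -
  obtain \<delta> where \<delta>: "\<delta> > 0" "\<And>a b. \<bar>a\<bar> < \<delta> \<Longrightarrow> \<bar>b\<bar> < \<delta> \<Longrightarrow> x + a *\<^sub>R X + b *\<^sub>R (0 :: ('m,'n) jet) \<in> W"
    using open_jet_plane[OF open_W assms, of X 0] by metis
  show ?thesis
    unfolding eventually_nhds_metric
    using \<delta>(1) \<delta>(2)[of _ 0] by (intro exI[of _ \<delta>]) (auto simp: dist_real_def)
qed

lemma has_derivative_cong_W:
  assumes "x \<in> W" "\<forall>y\<in>W. f y = g y"
  shows "((\<lambda>h. f (x + h *\<^sub>R X)) has_real_derivative D) (at 0) \<longleftrightarrow>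
         ((\<lambda>h. g (x + h *\<^sub>R X)) has_real_derivative D) (at 0)"
proof (rule DERIV_cong_ev)
  show "\<forall>\<^sub>F h in nhds 0. f (x + h *\<^sub>R X) = g (x + h *\<^sub>R X)"
    using line_in_W[OF assms(1)] by eventually_elim (use assms(2) in blast)
qed simp_all

lemma dir_deriv_cong_W:
  assumes "x \<in> W" "\<forall>y\<in>W. f y = g y"
  shows "dir_deriv X f x = dir_deriv X g x"
  unfolding dir_deriv_eq deriv_def using has_derivative_cong_W[OF assms] by simp

lemma differentiable_along_cong_W:
  assumes "x \<in> W" "\<forall>y\<in>W. f y = g y"
  shows "differentiable_along X f x \<longleftrightarrow> differentiable_along X g x"
  using has_derivative_cong_W[OF assms] differentiable_alongD differentiable_alongI by metis

abbreviation smooth :: "(('m, 'n) jet \<Rightarrow> real) \<Rightarrow> bool" where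
  "smooth \<equiv> smooth_along jet_shift W"

text \<open>The iterated partial derivatives in the definition of smoothness agree on \<open>W\<close>, step by step, with
members of \<open>P\<close>. Comparing values on \<open>W\<close> only is essential, since a product or sum rule for
derivatives fails at points where differentiability is unknown.\<close>

lemma smooth_coinduct:
  assumes "P f"
    and cont: "\<And>f. P f \<Longrightarrow> continuous_on W f"
    and diff: "\<And>f a x. P f \<Longrightarrow> x \<in> W \<Longrightarrow> differentiable_along (jet_basis a) f x"
    and step: "\<And>f a. P f \<Longrightarrow> \<exists>g. P g \<and> (\<forall>x\<in>W. dir_deriv (jet_basis a) f x = g x)"
  shows "smooth f"
proof -
  have *: "\<exists>g. P g \<and> (\<forall>x\<in>W. foldr (\<lambda>i. pderiv_along (jet_shift i)) is f x = g x)" for "is"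
  proof (induction "is")
    case Nil
    then show ?case using \<open>P f\<close> by auto
  next
    case (Cons a "is")
    then obtain g where g: "P g" "\<forall>x\<in>W. foldr (\<lambda>i. pderiv_along (jet_shift i)) is f x = g x"
      by auto
    obtain g' where g': "P g'" "\<And>x. x \<in> W \<Longrightarrow> dir_deriv (jet_basis a) g x = g' x"
      using step[OF g(1)] by blast
    have "foldr (\<lambda>i. pderiv_along (jet_shift i)) (a # is) f x = g' x" if "x \<in> W" for x
      using dir_deriv_cong_W[OF that g(2)] g'(2)[OF that] by (simp add: pderiv_along_jet_shift)
    then show ?case using g'(1) by blast
  qed
  show ?thesis
    unfolding smooth_along_def Let_def
  proof (intro allI conjI ballI)
    fix "is" :: "('n \<times> 'm mindex) list"
    let ?F = "foldr (\<lambda>i. pderiv_along (jet_shift i)) is f"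
    obtain g where g: "P g" "\<forall>x\<in>W. ?F x = g x"
      using * by blast
    show "continuous_on W ?F"
      using cont[OF g(1)] g(2) by (simp cong: continuous_on_cong)
    fix a x assume "x \<in> W"
    then have "differentiable_along (jet_basis a) ?F x"
      using diff[OF g(1)] differentiable_along_cong_W[OF _ g(2)] by blast
    then show "(\<lambda>h. ?F (jet_shift a h x)) differentiable at 0"
      by (simp add: differentiable_along_def jet_shift_eq)
  qed
qed

lemma smooth_continuous: "smooth f \<Longrightarrow> continuous_on W f"
  by (rule smooth_along_continuous)

lemma smooth_diff_basis: "smooth f \<Longrightarrow> x \<in> W \<Longrightarrow> differentiable_along (jet_basis a) f x"
  using smooth_along_differentiable[of jet_shift W f x a]
  by (simp add: differentiable_along_def jet_shift_eq)

lemma smooth_partial: "smooth f \<Longrightarrow> smooth (dir_deriv (jet_basis a) f)"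
  using smooth_along_pderiv[of jet_shift W f a] by (simp add: pderiv_along_jet_shift)

text \<open>Closure of smoothness under sums and products: the algebra generated by smooth functions is closed
under partial derivatives, hence it consists of smooth functions by coinduction.\<close>

inductive smooth_alg :: "(('m, 'n) jet \<Rightarrow> real) \<Rightarrow> bool" where
  base: "smooth f \<Longrightarrow> smooth_alg f"
| const: "smooth_alg (\<lambda>x. c)"
| coord: "smooth_alg (\<lambda>x. x I $ \<alpha>)"
| add: "smooth_alg f \<Longrightarrow> smooth_alg g \<Longrightarrow> smooth_alg (\<lambda>x. f x + g x)"
| mult: "smooth_alg f \<Longrightarrow> smooth_alg g \<Longrightarrow> smooth_alg (\<lambda>x. f x * g x)"

lemma continuous_coord: "continuous_on S (\<lambda>x :: ('m, 'n) jet. x I $ \<alpha>)"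
  by (intro continuous_on_component continuous_on_product_coordinates[THEN continuous_on_subset]) simp

lemma smooth_alg_step:
  assumes "smooth_alg f"
  shows "continuous_on W f \<and> (\<forall>a. \<forall>x\<in>W. differentiable_along (jet_basis a) f x) \<and>
         (\<forall>a. \<exists>g. smooth_alg g \<and> (\<forall>x\<in>W. dir_deriv (jet_basis a) f x = g x))"
  using assms
proof induction
  case (base f)
  then show ?case
    using smooth_continuous[OF base] smooth_diff_basis[OF base] smooth_alg.base[OF smooth_partial[OF base]]
    by blast
next
  case (const c)
  have D: "((\<lambda>h. c) has_real_derivative 0) (at 0)" by simp
  show ?case
    using differentiable_alongI[of "\<lambda>_. c", OF D] dir_derivI[of "\<lambda>_. c", OF D]
      smooth_alg.const[of 0] by (intro conjI allI ballI continuous_on_const) blast+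
next
  case (coord I \<alpha>)
  have D: "((\<lambda>h. (x + h *\<^sub>R jet_basis a) I $ \<alpha>) has_real_derivative jet_basis a I $ \<alpha>) (at 0)"
    for x :: "('m, 'n) jet" and a
    by (auto intro!: derivative_eq_intros)
  show ?case
    using differentiable_alongI[of "\<lambda>x. x I $ \<alpha>", OF D] dir_derivI[of "\<lambda>x. x I $ \<alpha>", OF D]
      smooth_alg.const by (intro conjI allI ballI continuous_coord) blast+
next
  case (add f g)
  have D: "((\<lambda>h. f (x + h *\<^sub>R jet_basis a) + g (x + h *\<^sub>R jet_basis a)) has_real_derivative
      dir_deriv (jet_basis a) f x + dir_deriv (jet_basis a) g x) (at 0)" if "x \<in> W" for x a
    using DERIV_add[OF differentiable_alongD differentiable_alongD, of "jet_basis a" f x "jet_basis a" g x]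
      add.IH that by simp
  have "\<exists>h. smooth_alg h \<and> (\<forall>x\<in>W. dir_deriv (jet_basis a) (\<lambda>x. f x + g x) x = h x)" for a
  proof -
    obtain f' g' where f': "smooth_alg f'" "\<forall>x\<in>W. dir_deriv (jet_basis a) f x = f' x"
      and g': "smooth_alg g'" "\<forall>x\<in>W. dir_deriv (jet_basis a) g x = g' x"
      using add.IH by meson
    have "\<forall>x\<in>W. dir_deriv (jet_basis a) (\<lambda>x. f x + g x) x = f' x + g' x"
      using dir_derivI[of "\<lambda>x. f x + g x", OF D] f'(2) g'(2) by simp
    then show ?thesis using smooth_alg.add[OF f'(1) g'(1)] by blast
  qed
  then show ?case
    using add.IH differentiable_alongI[of "\<lambda>x. f x + g x", OF D]
    by (intro conjI allI ballI continuous_intros) blast+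
next
  case (mult f g)
  have D: "((\<lambda>h. f (x + h *\<^sub>R jet_basis a) * g (x + h *\<^sub>R jet_basis a)) has_real_derivative
      dir_deriv (jet_basis a) f x * g x + dir_deriv (jet_basis a) g x * f x) (at 0)" if "x \<in> W" for x a
    using DERIV_mult[OF differentiable_alongD differentiable_alongD, of "jet_basis a" f x "jet_basis a" g x]
      mult.IH that by simp
  have "\<exists>h. smooth_alg h \<and> (\<forall>x\<in>W. dir_deriv (jet_basis a) (\<lambda>x. f x * g x) x = h x)" for a
  proof -
    obtain f' g' where f': "smooth_alg f'" "\<forall>x\<in>W. dir_deriv (jet_basis a) f x = f' x"
      and g': "smooth_alg g'" "\<forall>x\<in>W. dir_deriv (jet_basis a) g x = g' x"
      using mult.IH by meson
    have "\<forall>x\<in>W. dir_deriv (jet_basis a) (\<lambda>x. f x * g x) x = f' x * g x + g' x * f x"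
      using dir_derivI[of "\<lambda>x. f x * g x", OF D] f'(2) g'(2) by simp
    moreover have "smooth_alg (\<lambda>x. f' x * g x + g' x * f x)"
      using mult.hyps f'(1) g'(1) by (intro smooth_alg.add smooth_alg.mult)
    ultimately show ?thesis by blast
  qed
  then show ?case
    using mult.IH differentiable_alongI[of "\<lambda>x. f x * g x", OF D]
    by (intro conjI allI ballI continuous_intros) blast+
qed

lemma smooth_alg_iff: "smooth_alg f \<longleftrightarrow> smooth f"
proof
  assume "smooth_alg f"
  then show "smooth f"
    by (rule smooth_coinduct[where P = smooth_alg]) (simp_all add: smooth_alg_step)
qed (rule smooth_alg.base)

lemmas smooth_const = smooth_alg.const[unfolded smooth_alg_iff]
  and smooth_coord = smooth_alg.coord[unfolded smooth_alg_iff]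
  and smooth_add = smooth_alg.add[unfolded smooth_alg_iff]
  and smooth_mult = smooth_alg.mult[unfolded smooth_alg_iff]

lemma smooth_cong:
  assumes "smooth f" "\<And>x. x \<in> W \<Longrightarrow> f x = g x"
  shows "smooth g"
proof (rule smooth_coinduct[where P = "\<lambda>g. \<exists>f. smooth f \<and> (\<forall>x\<in>W. g x = f x)"])
  show "\<exists>f. smooth f \<and> (\<forall>x\<in>W. g x = f x)" using assms by auto
next
  fix g assume "\<exists>f. smooth f \<and> (\<forall>x\<in>W. g x = f x)"
  then obtain f where f: "smooth f" "\<forall>x\<in>W. g x = f x" by blast
  show "continuous_on W g" using smooth_continuous[OF f(1)] f(2) by (simp cong: continuous_on_cong)
  show "differentiable_along (jet_basis a) g x" if "x \<in> W" for a x
    using smooth_diff_basis[OF f(1)] differentiable_along_cong_W[OF that f(2)] that by blast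
  show "\<exists>h. (\<exists>f. smooth f \<and> (\<forall>x\<in>W. h x = f x)) \<and> (\<forall>x\<in>W. dir_deriv (jet_basis a) g x = h x)" for a
    using smooth_partial[OF f(1)] dir_deriv_cong_W[OF _ f(2)] by blast
qed

end

section \<open>The chain rule and the symmetry of second derivatives\<close>

context jet_region
begin

lemma smooth_near:
  assumes "smooth f" "x \<in> W" "\<epsilon> > 0"
  obtains \<delta> where "\<delta> > 0"
    "\<And>a b. \<bar>a\<bar> < \<delta> \<Longrightarrow> \<bar>b\<bar> < \<delta> \<Longrightarrow> x + a *\<^sub>R v + b *\<^sub>R w \<in> W \<and> \<bar>f (x + a *\<^sub>R v + b *\<^sub>R w) - f x\<bar> < \<epsilon>"
proof -
  have "open (W \<inter> f -` ball (f x) \<epsilon>)"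
    by (rule continuous_open_preimage[OF smooth_continuous[OF assms(1)] open_W open_ball])
  moreover have "x \<in> W \<inter> f -` ball (f x) \<epsilon>" using assms by simp
  ultimately obtain \<delta> where "\<delta> > 0"
    "\<And>a b. \<bar>a\<bar> < \<delta> \<Longrightarrow> \<bar>b\<bar> < \<delta> \<Longrightarrow> x + a *\<^sub>R v + b *\<^sub>R w \<in> W \<inter> f -` ball (f x) \<epsilon>"
    using open_jet_plane[of _ x v w] by metis
  then show thesis
    by (intro that[of \<delta>]) (auto simp: dist_real_def abs_minus_commute)
qed

text \<open>One step of the usual proof that continuous partial derivatives imply differentiability: the
increment in one coordinate direction, taken at the displaced point \<open>x + h v\<close>, is given by the mean
value theorem and the partial derivative is continuous at \<open>x\<close>.\<close>

lemma has_derivative_basis_increment: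
  assumes f: "smooth f" and x: "x \<in> W"
  shows "((\<lambda>h. f (x + h *\<^sub>R v + (h * c) *\<^sub>R jet_basis a) - f (x + h *\<^sub>R v))
           has_real_derivative c * dir_deriv (jet_basis a) f x) (at 0)"
  unfolding DERIV_def
proof (rule LIM_I)
  fix \<epsilon> :: real assume "\<epsilon> > 0"
  let ?g = "dir_deriv (jet_basis a) f"
  let ?q = "\<lambda>h. f (x + h *\<^sub>R v + (h * c) *\<^sub>R jet_basis a) - f (x + h *\<^sub>R v)"
  have c1: "\<bar>c\<bar> + 1 > 0" by linarith
  have "\<epsilon> / (\<bar>c\<bar> + 1) > 0" using \<open>\<epsilon> > 0\<close> c1 by (rule divide_pos_pos)
  then obtain \<delta> where \<delta>: "\<delta> > 0" and
    near: "\<And>s t. \<bar>s\<bar> < \<delta> \<Longrightarrow> \<bar>t\<bar> < \<delta> \<Longrightarrow> x + s *\<^sub>R v + t *\<^sub>R jet_basis a \<in> W \<and>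
             \<bar>?g (x + s *\<^sub>R v + t *\<^sub>R jet_basis a) - ?g x\<bar> < \<epsilon> / (\<bar>c\<bar> + 1)"
    using smooth_near[OF smooth_partial[OF f] x, of _ v "jet_basis a"] by metis
  have main: "norm ((?q (0 + h) - ?q 0) / h - c * ?g x) < \<epsilon>"
    if h: "h \<noteq> 0" "norm (h - 0) < \<delta> / (\<bar>c\<bar> + 1)" for h
  proof -
    have hc: "\<bar>h\<bar> * (\<bar>c\<bar> + 1) < \<delta>"
      using h(2) by (simp add: pos_less_divide_eq[OF c1])
    have hs: "\<bar>h\<bar> < \<delta>" "\<bar>s * (h * c)\<bar> < \<delta>" if "0 \<le> s" "s \<le> 1" for s
    proof -
      have pos: "\<bar>h\<bar> * \<bar>c\<bar> \<ge> 0" by simp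
      have hc': "\<bar>h\<bar> * \<bar>c\<bar> + \<bar>h\<bar> < \<delta>" using hc by (simp add: distrib_left)
      show "\<bar>h\<bar> < \<delta>" using hc' pos by linarith
      have "s * (\<bar>h\<bar> * \<bar>c\<bar>) \<le> \<bar>h\<bar> * \<bar>c\<bar>" using that by (simp add: mult_left_le_one_le)
      then show "\<bar>s * (h * c)\<bar> < \<delta>" using hc' that by (simp add: abs_mult)
    qed
    have "((\<lambda>s. f ((x + h *\<^sub>R v) + (s * (h * c)) *\<^sub>R jet_basis a)) has_real_derivative
            ?g (x + h *\<^sub>R v + (s * (h * c)) *\<^sub>R jet_basis a) * (h * c)) (at s)"
      if "0 \<le> s" "s \<le> 1" for s
    proof -
      have "x + h *\<^sub>R v + (s * (h * c)) *\<^sub>R jet_basis a \<in> W" using near hs[OF that] by blast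
      then have 1: "differentiable_along (jet_basis a) f (x + h *\<^sub>R v + (s * (h * c)) *\<^sub>R jet_basis a)"
        by (rule smooth_diff_basis[OF f])
      have 2: "((\<lambda>s. s * (h * c)) has_real_derivative h * c) (at s)"
        by (auto intro!: derivative_eq_intros)
      show ?thesis
        by (rule DERIV_chain2[OF has_derivative_along_line[OF 1] 2])
    qed
    then obtain s where s: "0 < s" "s < 1"
      and "f (x + h *\<^sub>R v + (1 * (h * c)) *\<^sub>R jet_basis a) - f (x + h *\<^sub>R v + (0 * (h * c)) *\<^sub>R jet_basis a)
        = (1 - 0) * (?g (x + h *\<^sub>R v + (s * (h * c)) *\<^sub>R jet_basis a) * (h * c))"
      using MVT2[of 0 1 "\<lambda>s. f (x + h *\<^sub>R v + (s * (h * c)) *\<^sub>R jet_basis a)"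
          "\<lambda>s. ?g (x + h *\<^sub>R v + (s * (h * c)) *\<^sub>R jet_basis a) * (h * c)"] by auto
    then have "?q h = ?g (x + h *\<^sub>R v + (s * (h * c)) *\<^sub>R jet_basis a) * (h * c)"
      by simp
    then have "(?q (0 + h) - ?q 0) / h - c * ?g x =
        c * (?g (x + h *\<^sub>R v + (s * (h * c)) *\<^sub>R jet_basis a) - ?g x)"
      using h(1) by (simp add: field_simps)
    also have "norm \<dots> \<le> \<bar>c\<bar> * (\<epsilon> / (\<bar>c\<bar> + 1))"
    proof -
      have "\<bar>?g (x + h *\<^sub>R v + (s * (h * c)) *\<^sub>R jet_basis a) - ?g x\<bar> \<le> \<epsilon> / (\<bar>c\<bar> + 1)"
        using near[of h "s * (h * c)"] hs[of s] s by linarith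
      then show ?thesis unfolding real_norm_def abs_mult by (rule mult_left_mono) simp
    qed
    also have "\<dots> < \<epsilon>"
      using \<open>\<epsilon> > 0\<close> c1 by (simp add: field_simps)
    finally show ?thesis .
  qed
  have "\<delta> / (\<bar>c\<bar> + 1) > 0" using \<delta> c1 by (rule divide_pos_pos)
  then show "\<exists>s>0. \<forall>h. h \<noteq> 0 \<and> norm (h - 0) < s \<longrightarrow>
      norm ((?q (0 + h) - ?q 0) / h - c * ?g x) < \<epsilon>"
    by (intro exI[of _ "\<delta> / (\<bar>c\<bar> + 1)"] conjI allI impI main) auto
qed

lemma has_derivative_finite_combination:
  assumes f: "smooth f" and x: "x \<in> W" and "finite F"
  shows "((\<lambda>h. f (x + h *\<^sub>R (\<Sum>a\<in>F. X a *\<^sub>R jet_basis a))) has_real_derivative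
           (\<Sum>a\<in>F. X a * dir_deriv (jet_basis a) f x)) (at 0)"
  using \<open>finite F\<close>
proof induction
  case (insert a F)
  let ?v = "\<Sum>a\<in>F. X a *\<^sub>R jet_basis a"
  have "((\<lambda>h. (f (x + h *\<^sub>R ?v + (h * X a) *\<^sub>R jet_basis a) - f (x + h *\<^sub>R ?v)) + f (x + h *\<^sub>R ?v))
     has_real_derivative X a * dir_deriv (jet_basis a) f x + (\<Sum>a\<in>F. X a * dir_deriv (jet_basis a) f x)) (at 0)"
    by (rule DERIV_add[OF has_derivative_basis_increment[OF f x] insert.IH])
  moreover have "x + h *\<^sub>R (\<Sum>a\<in>insert a F. X a *\<^sub>R jet_basis a) = x + h *\<^sub>R ?v + (h * X a) *\<^sub>R jet_basis a" for h
    by (subst sum.insert[OF insert.hyps]) (simp only: scaleR_add_right scaleR_scaleR ac_simps)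
  ultimately show ?case
    using insert.hyps by (simp only: sum.insert[OF insert.hyps] diff_add_cancel)
qed simp

text \<open>Functions on the bundle of order \<open>K\<close>. The bound \<open>1 \<le> K\<close> ensures that a jet agreeing up to order \<open>K\<close> with
a point of \<open>W\<close> is itself in \<open>W\<close>.\<close>

definition smooth_order :: "nat \<Rightarrow> (('m, 'n) jet \<Rightarrow> real) \<Rightarrow> bool" where
  "smooth_order K f \<longleftrightarrow> 1 \<le> K \<and> smooth f \<and> (\<forall>x\<in>W. \<forall>y. agree K x y \<longrightarrow> f x = f y)"

lemma smooth_order_smooth: "smooth_order K f \<Longrightarrow> smooth f"
  and smooth_order_pos: "smooth_order K f \<Longrightarrow> 1 \<le> K"
  by (simp_all add: smooth_order_def)

lemma smooth_order_agree: "smooth_order K f \<Longrightarrow> x \<in> W \<Longrightarrow> agree K x y \<Longrightarrow> f x = f y"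
  by (simp add: smooth_order_def)

lemma smooth_order_mono: "smooth_order K f \<Longrightarrow> K \<le> K' \<Longrightarrow> smooth_order K' f"
  unfolding smooth_order_def by (auto dest: agree_mono)

lemma agree_W: "1 \<le> K \<Longrightarrow> x \<in> W \<Longrightarrow> agree K x y \<Longrightarrow> y \<in> W"
  by (rule saturated[OF _ agree_mono])

lemma smooth_order_cong:
  assumes "smooth_order K f" "\<forall>x\<in>W. f x = g x"
  shows "smooth_order K g"
proof -
  have "g x = g y" if "x \<in> W" "agree K x y" for x y
    using agree_W[OF smooth_order_pos[OF assms(1)] that] smooth_order_agree[OF assms(1) that] assms(2) that(1)
    by simp
  moreover have "smooth g"
    by (rule smooth_cong[OF smooth_order_smooth[OF assms(1)]]) (use assms(2) in simp)
  ultimately show ?thesis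
    using smooth_order_pos[OF assms(1)] unfolding smooth_order_def by simp
qed

lemma smooth_order_add: "smooth_order K f \<Longrightarrow> smooth_order K g \<Longrightarrow> smooth_order K (\<lambda>x. f x + g x)"
  unfolding smooth_order_def using smooth_add by simp

lemma smooth_order_mult: "smooth_order K f \<Longrightarrow> smooth_order K g \<Longrightarrow> smooth_order K (\<lambda>x. f x * g x)"
  unfolding smooth_order_def using smooth_mult by simp

lemma smooth_order_const: "1 \<le> K \<Longrightarrow> smooth_order K (\<lambda>x. c)"
  unfolding smooth_order_def using smooth_const by simp

lemma smooth_order_coord: "1 \<le> K \<Longrightarrow> mi_size I \<le> K \<Longrightarrow> smooth_order K (\<lambda>x. x I $ \<alpha>)"
  unfolding smooth_order_def using smooth_coord by (auto simp: agree_def)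

lemma smooth_order_sum:
  "1 \<le> K \<Longrightarrow> (\<And>a. a \<in> F \<Longrightarrow> smooth_order K (f a)) \<Longrightarrow> smooth_order K (\<lambda>x. \<Sum>a\<in>F. f a x)"
  by (induction F rule: infinite_finite_induct) (auto intro: smooth_order_add smooth_order_const)

lemma smooth_order_has_derivative:
  assumes f: "smooth_order K f" and x: "x \<in> W"
  shows "((\<lambda>h. f (x + h *\<^sub>R X)) has_real_derivative
           (\<Sum>a\<in>coords K. X (snd a) $ fst a * dir_deriv (jet_basis a) f x)) (at 0)"
proof -
  let ?v = "\<Sum>a\<in>coords K. (X (snd a) $ fst a) *\<^sub>R jet_basis a"
  have "((\<lambda>h. f (x + h *\<^sub>R ?v)) has_real_derivative
           (\<Sum>a\<in>coords K. X (snd a) $ fst a * dir_deriv (jet_basis a) f x)) (at 0)"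
    by (rule has_derivative_finite_combination[OF smooth_order_smooth[OF f] x finite_coords])
  then have "((\<lambda>h. f (x + h *\<^sub>R X)) has_real_derivative
           (\<Sum>a\<in>coords K. X (snd a) $ fst a * dir_deriv (jet_basis a) f x)) (at 0)"
    if "\<forall>\<^sub>F h in nhds 0. f (x + h *\<^sub>R ?v) = f (x + h *\<^sub>R X)"
    by (rule DERIV_cong_ev[OF refl that refl, THEN iffD1])
  moreover have "\<forall>\<^sub>F h in nhds 0. f (x + h *\<^sub>R ?v) = f (x + h *\<^sub>R X)"
    using line_in_W[OF x, of ?v]
  proof eventually_elim
    case (elim h)
    have "agree K (x + h *\<^sub>R ?v) (x + h *\<^sub>R X)"
      using agree_truncation[of K X] by (simp add: agree_def)
    then show ?case using smooth_order_agree[OF f elim] by simp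
  qed
  ultimately show ?thesis
    by this
qed

lemma smooth_order_differentiable:
  "smooth_order K f \<Longrightarrow> x \<in> W \<Longrightarrow> differentiable_along X f x"
  by (rule differentiable_alongI[of f x X, OF smooth_order_has_derivative[of K f x X]])

lemma dir_deriv_expand:
  "smooth_order K f \<Longrightarrow> x \<in> W \<Longrightarrow>
     dir_deriv X f x = (\<Sum>a\<in>coords K. X (snd a) $ fst a * dir_deriv (jet_basis a) f x)"
  by (rule dir_derivI[of f x X, OF smooth_order_has_derivative[of K f x X]])

lemma linear_dir_deriv:
  assumes "smooth_order K f" "x \<in> W"
  shows "linear (\<lambda>X. dir_deriv X f x)"
proof (rule linearI)
  note e = dir_deriv_expand[OF assms]
  show "dir_deriv (X + Y) f x = dir_deriv X f x + dir_deriv Y f x" for X Y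
    unfolding e[of "X + Y"] e[of X] e[of Y] by (simp add: distrib_right sum.distrib)
  show "dir_deriv (c *\<^sub>R X) f x = c *\<^sub>R dir_deriv X f x" for c X
    unfolding e[of "c *\<^sub>R X"] e[of X] by (simp add: sum_distrib_left mult.assoc)
qed

lemma dir_deriv_agree_direction:
  assumes "smooth_order K f" "x \<in> W" "agree K X Y"
  shows "dir_deriv X f x = dir_deriv Y f x"
  unfolding dir_deriv_expand[OF assms(1,2), of X] dir_deriv_expand[OF assms(1,2), of Y]
  using assms(3) by (intro sum.cong) (auto simp: agree_def coords_def)

lemma smooth_order_partial:
  assumes "smooth_order K f"
  shows "smooth_order K (dir_deriv (jet_basis a) f)"
  unfolding smooth_order_def
proof (intro conjI ballI allI impI)
  show "1 \<le> K" "smooth (dir_deriv (jet_basis a) f)"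
    using smooth_order_pos[OF assms] smooth_partial[OF smooth_order_smooth[OF assms]] by auto
  fix x y assume x: "x \<in> W" and xy: "agree K x y"
  have "\<forall>\<^sub>F h in nhds 0. f (x + h *\<^sub>R jet_basis a) = f (y + h *\<^sub>R jet_basis a)"
    using line_in_W[OF x, of "jet_basis a"]
  proof eventually_elim
    case (elim h)
    have "agree K (x + h *\<^sub>R jet_basis a) (y + h *\<^sub>R jet_basis a)"
      using xy by (simp add: agree_def)
    then show ?case using smooth_order_agree[OF assms elim] by simp
  qed
  then show "dir_deriv (jet_basis a) f x = dir_deriv (jet_basis a) f y"
    unfolding dir_deriv_eq by (intro deriv_cong_ev) simp_all
qed

lemma smooth_order_dir_deriv:
  assumes "smooth_order K f"
  shows "smooth_order K (dir_deriv X f)"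
proof (rule smooth_order_cong)
  show "smooth_order K (\<lambda>x. \<Sum>a\<in>coords K. X (snd a) $ fst a * dir_deriv (jet_basis a) f x)"
    using smooth_order_pos[OF assms] smooth_order_partial[OF assms]
    by (intro smooth_order_sum smooth_order_mult smooth_order_const)
  show "\<forall>x\<in>W. (\<Sum>a\<in>coords K. X (snd a) $ fst a * dir_deriv (jet_basis a) f x) = dir_deriv X f x"
    using dir_deriv_expand[OF assms, of _ X] by (intro ballI) (rule sym)
qed

text \<open>Two applications of the mean value theorem. The second difference on the left is symmetric in \<open>X\<close> and
\<open>Y\<close>, which yields the symmetry of second derivatives.\<close>

lemma second_difference_quotient:
  assumes f: "smooth_order K f" and "h > 0"
    and W: "\<And>a b. 0 \<le> a \<Longrightarrow> a \<le> h \<Longrightarrow> 0 \<le> b \<Longrightarrow> b \<le> h \<Longrightarrow> x + a *\<^sub>R X + b *\<^sub>R Y \<in> W"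
  obtains a b where "0 < a" "a < h" "0 < b" "b < h"
    "f (x + h *\<^sub>R X + h *\<^sub>R Y) - f (x + h *\<^sub>R X) - f (x + h *\<^sub>R Y) + f x =
       h * (h * dir_deriv Y (dir_deriv X f) (x + a *\<^sub>R X + b *\<^sub>R Y))"
proof -
  have 1: "((\<lambda>s. f (x + s *\<^sub>R X + b *\<^sub>R Y)) has_real_derivative dir_deriv X f (x + a *\<^sub>R X + b *\<^sub>R Y)) (at a)"
    if "0 \<le> a" "a \<le> h" "0 \<le> b" "b \<le> h" for a b
  proof -
    have eq: "x + s *\<^sub>R X + b *\<^sub>R Y = (x + b *\<^sub>R Y) + s *\<^sub>R X" for s by (simp add: algebra_simps)
    show ?thesis
      unfolding eq using W[OF that] unfolding eq
      by (intro has_derivative_along_line[of X f "x + b *\<^sub>R Y" a] smooth_order_differentiable[OF f])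
  qed
  have "((\<lambda>s. f (x + s *\<^sub>R X + h *\<^sub>R Y) - f (x + s *\<^sub>R X + 0 *\<^sub>R Y)) has_real_derivative
          dir_deriv X f (x + a *\<^sub>R X + h *\<^sub>R Y) - dir_deriv X f (x + a *\<^sub>R X + 0 *\<^sub>R Y)) (at a)"
    if "0 \<le> a" "a \<le> h" for a
    using that \<open>h > 0\<close> by (intro DERIV_diff 1) auto
  then have "\<exists>a>0. a < h \<and>
        (f (x + h *\<^sub>R X + h *\<^sub>R Y) - f (x + h *\<^sub>R X + 0 *\<^sub>R Y)) -
         (f (x + 0 *\<^sub>R X + h *\<^sub>R Y) - f (x + 0 *\<^sub>R X + 0 *\<^sub>R Y)) =
        (h - 0) * (dir_deriv X f (x + a *\<^sub>R X + h *\<^sub>R Y) - dir_deriv X f (x + a *\<^sub>R X + 0 *\<^sub>R Y))"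
    by (rule MVT2[OF \<open>h > 0\<close>])
  then obtain a where a: "0 < a" "a < h"
    and fa: "(f (x + h *\<^sub>R X + h *\<^sub>R Y) - f (x + h *\<^sub>R X + 0 *\<^sub>R Y)) -
         (f (x + 0 *\<^sub>R X + h *\<^sub>R Y) - f (x + 0 *\<^sub>R X + 0 *\<^sub>R Y)) =
        (h - 0) * (dir_deriv X f (x + a *\<^sub>R X + h *\<^sub>R Y) - dir_deriv X f (x + a *\<^sub>R X + 0 *\<^sub>R Y))"
    by (elim exE conjE) (rule that)
  have "((\<lambda>s. dir_deriv X f (x + a *\<^sub>R X + s *\<^sub>R Y)) has_real_derivative
          dir_deriv Y (dir_deriv X f) (x + a *\<^sub>R X + b *\<^sub>R Y)) (at b)" if "0 \<le> b" "b \<le> h" for b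
    using W[of a b] a that
    by (intro has_derivative_along_line[of Y "dir_deriv X f" "x + a *\<^sub>R X" b]
        smooth_order_differentiable[OF smooth_order_dir_deriv[OF f]]) simp
  then have "\<exists>b>0. b < h \<and>
      dir_deriv X f (x + a *\<^sub>R X + h *\<^sub>R Y) - dir_deriv X f (x + a *\<^sub>R X + 0 *\<^sub>R Y) =
        (h - 0) * dir_deriv Y (dir_deriv X f) (x + a *\<^sub>R X + b *\<^sub>R Y)"
    by (rule MVT2[OF \<open>h > 0\<close>])
  then obtain b where b: "0 < b" "b < h"
    and fb: "dir_deriv X f (x + a *\<^sub>R X + h *\<^sub>R Y) - dir_deriv X f (x + a *\<^sub>R X + 0 *\<^sub>R Y) =
        (h - 0) * dir_deriv Y (dir_deriv X f) (x + a *\<^sub>R X + b *\<^sub>R Y)"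
    by (elim exE conjE) (rule that)
  show thesis
    using that[OF a b] fa fb by (simp add: algebra_simps)
qed

lemma dir_deriv_commute:
  assumes f: "smooth_order K f" and x: "x \<in> W"
  shows "dir_deriv X (dir_deriv Y f) x = dir_deriv Y (dir_deriv X f) x"
proof (rule ccontr)
  let ?A = "dir_deriv Y (dir_deriv X f)" and ?B = "dir_deriv X (dir_deriv Y f)"
  assume neq: "dir_deriv X (dir_deriv Y f) x \<noteq> dir_deriv Y (dir_deriv X f) x"
  \<comment> \<open>continuity brings both mixed derivatives within \<open>\<epsilon>\<close> of their values at \<open>x\<close>\<close>
  define \<epsilon> where "\<epsilon> = \<bar>?A x - ?B x\<bar> / 2"
  have "\<epsilon> > 0" using neq by (simp add: \<epsilon>_def)
  have sA: "smooth ?A" "smooth ?B"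
    using smooth_order_smooth[OF smooth_order_dir_deriv[OF smooth_order_dir_deriv[OF f]]] by blast+
  obtain \<delta>1 where \<delta>1: "\<delta>1 > 0" and A:
    "\<And>a b. \<bar>a\<bar> < \<delta>1 \<Longrightarrow> \<bar>b\<bar> < \<delta>1 \<Longrightarrow> x + a *\<^sub>R X + b *\<^sub>R Y \<in> W \<and> \<bar>?A (x + a *\<^sub>R X + b *\<^sub>R Y) - ?A x\<bar> < \<epsilon>"
    using smooth_near[OF sA(1) x \<open>\<epsilon> > 0\<close>] by metis
  obtain \<delta>2 where \<delta>2: "\<delta>2 > 0" and B:
    "\<And>a b. \<bar>a\<bar> < \<delta>2 \<Longrightarrow> \<bar>b\<bar> < \<delta>2 \<Longrightarrow> x + a *\<^sub>R Y + b *\<^sub>R X \<in> W \<and> \<bar>?B (x + a *\<^sub>R Y + b *\<^sub>R X) - ?B x\<bar> < \<epsilon>"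
    using smooth_near[OF sA(2) x \<open>\<epsilon> > 0\<close>] by metis
  define h where "h = min \<delta>1 \<delta>2 / 2"
  have h: "h > 0" "h < \<delta>1" "h < \<delta>2" using \<delta>1 \<delta>2 by (auto simp: h_def)
  obtain a b where ab: "0 < a" "a < h" "0 < b" "b < h"
    "f (x + h *\<^sub>R X + h *\<^sub>R Y) - f (x + h *\<^sub>R X) - f (x + h *\<^sub>R Y) + f x =
       h * (h * ?A (x + a *\<^sub>R X + b *\<^sub>R Y))"
    using second_difference_quotient[OF f h(1), of x X Y] A h by (smt (verit))
  obtain c d where cd: "0 < c" "c < h" "0 < d" "d < h"
    "f (x + h *\<^sub>R Y + h *\<^sub>R X) - f (x + h *\<^sub>R Y) - f (x + h *\<^sub>R X) + f x =
       h * (h * ?B (x + c *\<^sub>R Y + d *\<^sub>R X))"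
    using second_difference_quotient[OF f h(1), of x Y X] B h by (smt (verit))
  have "h * (h * ?A (x + a *\<^sub>R X + b *\<^sub>R Y)) = h * (h * ?B (x + c *\<^sub>R Y + d *\<^sub>R X))"
    using ab(5) cd(5) by (simp add: algebra_simps)
  then have "?A (x + a *\<^sub>R X + b *\<^sub>R Y) = ?B (x + c *\<^sub>R Y + d *\<^sub>R X)"
    using h(1) by simp
  moreover have "\<bar>?A (x + a *\<^sub>R X + b *\<^sub>R Y) - ?A x\<bar> < \<epsilon>" "\<bar>?B (x + c *\<^sub>R Y + d *\<^sub>R X) - ?B x\<bar> < \<epsilon>"
    using A[of a b] B[of c d] ab cd h by auto
  ultimately have "\<bar>?A x - ?B x\<bar> < 2 * \<epsilon>" by linarith
  then show False by (simp add: \<epsilon>_def)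
qed

lemma dir_deriv_add:
  assumes "smooth_order K f" "smooth_order K' g" "x \<in> W"
  shows "dir_deriv X (\<lambda>y. f y + g y) x = dir_deriv X f x + dir_deriv X g x"
  by (rule dir_derivI, intro DERIV_add differentiable_alongD smooth_order_differentiable[OF _ assms(3)])
     (use assms in auto)

lemma dir_deriv_cmult:
  assumes "smooth_order K f" "x \<in> W"
  shows "dir_deriv X (\<lambda>y. c * f y) x = c * dir_deriv X f x"
  by (rule dir_derivI, rule DERIV_cmult, rule differentiable_alongD[OF smooth_order_differentiable[OF assms]])

lemma dir_deriv_sum:
  assumes "\<And>a. a \<in> F \<Longrightarrow> smooth_order K (f a)" "1 \<le> K" "x \<in> W"
  shows "dir_deriv X (\<lambda>y. \<Sum>a\<in>F. f a y) x = (\<Sum>a\<in>F. dir_deriv X (f a) x)"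
  using assms(1)
proof (induction F rule: infinite_finite_induct)
  case (insert a F)
  then show ?case
    using dir_deriv_add[OF insert.prems smooth_order_sum[OF assms(2)], of a F f x X] assms(3) by auto
qed auto

end

section \<open>Forms of finite order\<close>

text \<open>The derivation of the tensor algebra induced by a constant linear map \<open>M\<close> of tangent vectors. With
\<open>M\<close> the vertical endomorphism it is \<open>S\<^sup>i\<close>; with \<open>M = T\<^sub>i\<close> it is the part of \<open>d\<^sub>i\<close> which does not
differentiate coefficients.\<close>

definition slot :: "(('m, 'n) jet \<Rightarrow> ('m, 'n) jet) \<Rightarrow> ('m, 'n) form \<Rightarrow> ('m, 'n) form" where
  "slot M \<phi> x Xs = (\<Sum>a<length Xs. \<phi> x (Xs[a := M (Xs ! a)]))"

lemma vert_form_eq_slot: "vert_form i = slot (vert_endo i)"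
  by (simp add: fun_eq_iff vert_form_def slot_def)

lemma linear_total_deriv: "linear (total_deriv j :: ('m::finite, 'n::finite) jet \<Rightarrow> ('m, 'n) jet)"
  by (rule linearI) (simp_all add: total_deriv_def fun_eq_iff)

lemma linear_vert_endo: "linear (vert_endo i :: ('m::finite, 'n::finite) jet \<Rightarrow> ('m, 'n) jet)"
  by (rule linearI) (simp_all add: vert_endo_def fun_eq_iff scaleR_add_right)

lemma mi_size_diff_axis: "mi_size (J - axis i 1) \<le> mi_size J"
  unfolding mi_size_def by (rule sum_mono) simp

lemma agree_vert_endo:
  fixes X :: "('m::finite, 'n::finite) jet"
  shows "agree K X 0 \<Longrightarrow> agree K (vert_endo i X) 0"
  unfolding agree_def vert_endo_def
  by (metis mi_size_diff_axis order_trans scaleR_zero_right zero_fun_apply)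

lemma agree_total_deriv:
  fixes X :: "('m::finite, 'n::finite) jet"
  shows "agree (Suc K) X Y \<Longrightarrow> agree K (total_deriv i X) (total_deriv i Y)"
  by (simp add: agree_def total_deriv_def mi_size_add)

lemma total_deriv_zero [simp]: "total_deriv i (0 :: ('m::finite, 'n::finite) jet) = 0"
  by (rule linear_0[OF linear_total_deriv])

lemma total_deriv_commute: "total_deriv i (total_deriv j X) = total_deriv j (total_deriv i X)"
  by (simp add: total_deriv_def fun_eq_iff ac_simps)

lemma vert_endo_commute:
  "vert_endo i (vert_endo j X) = vert_endo j (vert_endo i (X :: ('m::finite, 'n::finite) jet))"
proof (cases "i = j")
  case False
  have "J - axis i 1 - axis j 1 = J - axis j 1 - axis i 1" for J :: "'m mindex"
    by (simp add: vec_eq_iff add.commute)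
  with False show ?thesis
    by (simp add: vert_endo_def fun_eq_iff axis_def)
qed simp

text \<open>In terms of Taylor series: \<open>\<partial>\<^sub>l(t\<^sup>i \<xi>) - t\<^sup>i \<partial>\<^sub>l\<xi> = \<delta>\<^sup>i\<^sub>l \<xi>\<close>.\<close>

lemma total_vert_commutator:
  "total_deriv l (vert_endo i X) - vert_endo i (total_deriv l X) =
     (if i = l then X else (0 :: ('m::finite, 'n::finite) jet))"
proof
  fix J :: "'m mindex"
  show "(total_deriv l (vert_endo i X) - vert_endo i (total_deriv l X)) J =
      (if i = l then X else 0) J"
  proof (cases "i = l")
    case True
    show ?thesis
    proof (cases "J $ i = 0")
      case True
      with \<open>i = l\<close> show ?thesis by (simp add: total_deriv_def vert_endo_def axis_def)
    next
      case False
      then have "J - axis i 1 + axis i 1 = J"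
        by (auto simp: vec_eq_iff axis_def)
      with \<open>i = l\<close> show ?thesis
        by (simp add: total_deriv_def vert_endo_def axis_def ac_simps scaleR_left_distrib)
    qed
  next
    case False
    show ?thesis
    proof (cases "J $ i = 0")
      case True
      with False show ?thesis by (simp add: total_deriv_def vert_endo_def axis_def)
    next
      case F: False
      then have "J + axis l 1 - axis i 1 = J - axis i 1 + axis l 1"
        using False by (auto simp: vec_eq_iff axis_def)
      with False show ?thesis
        by (simp add: total_deriv_def vert_endo_def axis_def)
    qed
  qed
qed

context jet_region
begin

text \<open>A form with all but one of its arguments fixed. The product rule for \<open>y \<mapsto> G y (M y)\<close>, on which
all computations with the (linear) fields \<open>T\<^sub>i\<close> rest, needs just this structure.\<close>

definition covector_field :: "nat \<Rightarrow> (('m, 'n) jet \<Rightarrow> ('m, 'n) jet \<Rightarrow> real) \<Rightarrow> bool" where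
  "covector_field K G \<longleftrightarrow> 1 \<le> K \<and> (\<forall>X. smooth_order K (\<lambda>y. G y X)) \<and>
     (\<forall>y\<in>W. linear (G y) \<and> (\<forall>X. agree K X 0 \<longrightarrow> G y X = 0))"

lemma covector_fieldD:
  assumes "covector_field K G"
  shows covector_field_pos: "1 \<le> K"
    and covector_field_smooth: "smooth_order K (\<lambda>y. G y X)"
    and covector_field_linear: "y \<in> W \<Longrightarrow> linear (G y)"
    and covector_field_agree: "y \<in> W \<Longrightarrow> agree K X 0 \<Longrightarrow> G y X = 0"
  using assms unfolding covector_field_def by auto

lemma covector_field_expand:
  assumes "covector_field K G" "y \<in> W"
  shows "G y X = (\<Sum>a\<in>coords K. X (snd a) $ fst a * G y (jet_basis a))"
proof -
  let ?Y = "\<Sum>a\<in>coords K. (X (snd a) $ fst a) *\<^sub>R jet_basis a"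
  note lin = covector_field_linear[OF assms]
  have "agree K (X - ?Y) 0" using agree_truncation[of K X] by (simp add: agree_def)
  then have "G y (X - ?Y) = 0" by (rule covector_field_agree[OF assms])
  then have "G y X = G y ?Y" by (simp add: linear_diff[OF lin])
  also have "\<dots> = (\<Sum>a\<in>coords K. X (snd a) $ fst a * G y (jet_basis a))"
    by (simp add: linear_sum[OF lin] linear_cmul[OF lin])
  finally show ?thesis .
qed

lemma covector_field_deriv_pairing:
  assumes G: "covector_field K G" and "linear M" and x: "x \<in> W"
  shows "dir_deriv Z (\<lambda>y. G y (M y)) x = dir_deriv Z (\<lambda>y. G y (M x)) x + G x (M Z)"
proof -
  let ?c = "\<lambda>X a. X (snd a) $ fst a"
  have coeff: "((\<lambda>h. ?c (M (x + h *\<^sub>R Z)) a) has_real_derivative ?c (M Z) a) (at 0)" for a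
    unfolding linear_add[OF \<open>linear M\<close>] linear_cmul[OF \<open>linear M\<close>]
    by (auto intro!: derivative_eq_intros)
  have comp: "((\<lambda>h. G (x + h *\<^sub>R Z) X) has_real_derivative dir_deriv Z (\<lambda>y. G y X) x) (at 0)" for X
    by (rule differentiable_alongD[OF smooth_order_differentiable[OF covector_field_smooth[OF G] x]])
  have "((\<lambda>h. \<Sum>a\<in>coords K. ?c (M (x + h *\<^sub>R Z)) a * G (x + h *\<^sub>R Z) (jet_basis a)) has_real_derivative
      (\<Sum>a\<in>coords K. ?c (M Z) a * G (x + 0 *\<^sub>R Z) (jet_basis a) +
         dir_deriv Z (\<lambda>y. G y (jet_basis a)) x * ?c (M (x + 0 *\<^sub>R Z)) a)) (at 0)"
    by (intro DERIV_sum DERIV_mult coeff comp)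
  moreover have "(\<Sum>a\<in>coords K. ?c (M Z) a * G (x + 0 *\<^sub>R Z) (jet_basis a) +
         dir_deriv Z (\<lambda>y. G y (jet_basis a)) x * ?c (M (x + 0 *\<^sub>R Z)) a) =
      G x (M Z) + (\<Sum>a\<in>coords K. ?c (M x) a * dir_deriv Z (\<lambda>y. G y (jet_basis a)) x)"
    by (simp add: sum.distrib covector_field_expand[OF G x, of "M Z"] mult.commute)
  moreover have "(\<Sum>a\<in>coords K. ?c (M x) a * dir_deriv Z (\<lambda>y. G y (jet_basis a)) x) =
      dir_deriv Z (\<lambda>y. G y (M x)) x"
  proof -
    have "dir_deriv Z (\<lambda>y. G y (M x)) x = dir_deriv Z (\<lambda>y. \<Sum>a\<in>coords K. ?c (M x) a * G y (jet_basis a)) x"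
      by (rule dir_deriv_cong_W[OF x]) (intro ballI covector_field_expand[OF G])
    also have "\<dots> = (\<Sum>a\<in>coords K. dir_deriv Z (\<lambda>y. ?c (M x) a * G y (jet_basis a)) x)"
      by (rule dir_deriv_sum[OF _ covector_field_pos[OF G] x])
         (intro smooth_order_mult smooth_order_const covector_field_pos[OF G] covector_field_smooth[OF G])
    also have "\<dots> = (\<Sum>a\<in>coords K. ?c (M x) a * dir_deriv Z (\<lambda>y. G y (jet_basis a)) x)"
      by (intro sum.cong refl dir_deriv_cmult[OF covector_field_smooth[OF G] x])
    finally show ?thesis by simp
  qed
  moreover have "((\<lambda>h. \<Sum>a\<in>coords K. ?c (M (x + h *\<^sub>R Z)) a * G (x + h *\<^sub>R Z) (jet_basis a)) has_real_derivative D) (at 0)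
      \<longleftrightarrow> ((\<lambda>h. G (x + h *\<^sub>R Z) (M (x + h *\<^sub>R Z))) has_real_derivative D) (at 0)" for D
    by (rule has_derivative_cong_W[OF x, of "\<lambda>y. \<Sum>a\<in>coords K. ?c (M y) a * G y (jet_basis a)" "\<lambda>y. G y (M y)"])
       (intro ballI covector_field_expand[OF G, symmetric])
  ultimately have D: "((\<lambda>h. G (x + h *\<^sub>R Z) (M (x + h *\<^sub>R Z))) has_real_derivative
      G x (M Z) + dir_deriv Z (\<lambda>y. G y (M x)) x) (at 0)"
    by simp
  show "dir_deriv Z (\<lambda>y. G y (M y)) x = dir_deriv Z (\<lambda>y. G y (M x)) x + G x (M Z)"
    using dir_derivI[of "\<lambda>y. G y (M y)", OF D] by simp
qed

lemma smooth_order_total_coord: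
  assumes "1 \<le> K" "a \<in> coords K"
  shows "smooth_order (Suc K) (\<lambda>y. total_deriv i y (snd a) $ fst a)"
  using assms smooth_order_coord[of "Suc K" "snd a + axis i 1" "fst a"]
  by (auto simp: total_deriv_def coords_def mi_size_add)

lemma covector_field_total_pairing:
  assumes G: "covector_field K G"
  shows "smooth_order (Suc K) (\<lambda>y. G y (total_deriv i y))"
proof (rule smooth_order_cong)
  have pos: "1 \<le> K" by (rule covector_field_pos[OF G])
  show "smooth_order (Suc K) (\<lambda>y. \<Sum>a\<in>coords K. total_deriv i y (snd a) $ fst a * G y (jet_basis a))"
    using pos by (intro smooth_order_sum smooth_order_mult smooth_order_total_coord
        smooth_order_mono[OF covector_field_smooth[OF G]]) auto
  show "\<forall>y\<in>W. (\<Sum>a\<in>coords K. total_deriv i y (snd a) $ fst a * G y (jet_basis a)) = G y (total_deriv i y)"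
    by (intro ballI covector_field_expand[OF G, symmetric])
qed

lemma covector_field_differential:
  assumes "smooth_order K f"
  shows "covector_field K (\<lambda>y X. dir_deriv X f y)"
proof -
  have "dir_deriv X f y = 0" if "y \<in> W" "agree K X 0" for X y
    using dir_deriv_agree_direction[OF assms that] linear_0[OF linear_dir_deriv[OF assms that(1)]] by simp
  then show ?thesis
    unfolding covector_field_def
    using smooth_order_pos[OF assms] smooth_order_dir_deriv[OF assms] linear_dir_deriv[OF assms] by blast
qed

text \<open>Forms on the bundle of order \<open>K\<close>, restricted to \<open>W\<close> by the value \<open>0\<close> elsewhere, so that identities
between forms become equations. Skew-symmetry is demanded for two arguments only, as no forms of
higher degree occur.\<close>

definition form_order :: "nat \<Rightarrow> nat \<Rightarrow> ('m, 'n) form \<Rightarrow> bool" where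
  "form_order K r \<phi> \<longleftrightarrow> 1 \<le> K \<and>
     (\<forall>Xs. length Xs = r \<longrightarrow> smooth_order K (\<lambda>x. \<phi> x Xs)) \<and>
     (\<forall>x\<in>W. \<forall>Xs a. length Xs = r \<longrightarrow> a < r \<longrightarrow> linear (\<lambda>X. \<phi> x (Xs[a := X])) \<and>
        (\<forall>X. agree K X 0 \<longrightarrow> \<phi> x (Xs[a := X]) = 0)) \<and>
     (\<forall>x Xs. x \<notin> W \<or> length Xs \<noteq> r \<longrightarrow> \<phi> x Xs = 0) \<and>
     (\<forall>x X Y. \<phi> x [X, Y] = - \<phi> x [Y, X])"

lemma form_orderD:
  assumes "form_order K r \<phi>"
  shows form_order_pos: "1 \<le> K"
    and form_order_smooth: "length Xs = r \<Longrightarrow> smooth_order K (\<lambda>x. \<phi> x Xs)"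
    and form_order_linear: "x \<in> W \<Longrightarrow> length Xs = r \<Longrightarrow> a < r \<Longrightarrow> linear (\<lambda>X. \<phi> x (Xs[a := X]))"
    and form_order_agree: "x \<in> W \<Longrightarrow> length Xs = r \<Longrightarrow> a < r \<Longrightarrow> agree K X 0 \<Longrightarrow> \<phi> x (Xs[a := X]) = 0"
    and form_order_outside: "x \<notin> W \<or> length Xs \<noteq> r \<Longrightarrow> \<phi> x Xs = 0"
    and form_order_skew: "\<phi> x [X, Y] = - \<phi> x [Y, X]"
proof -
  have D: "1 \<le> K" "\<forall>Xs. length Xs = r \<longrightarrow> smooth_order K (\<lambda>x. \<phi> x Xs)"
     "\<forall>x\<in>W. \<forall>Xs a. length Xs = r \<longrightarrow> a < r \<longrightarrow> linear (\<lambda>X. \<phi> x (Xs[a := X])) \<and>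
        (\<forall>X. agree K X 0 \<longrightarrow> \<phi> x (Xs[a := X]) = 0)"
     "\<forall>x Xs. x \<notin> W \<or> length Xs \<noteq> r \<longrightarrow> \<phi> x Xs = 0" "\<forall>x X Y. \<phi> x [X, Y] = - \<phi> x [Y, X]"
    using assms unfolding form_order_def by - (elim conjE, assumption)+
  show "1 \<le> K" by (rule D(1))
  show "length Xs = r \<Longrightarrow> smooth_order K (\<lambda>x. \<phi> x Xs)" using D(2) by simp
  show "x \<in> W \<Longrightarrow> length Xs = r \<Longrightarrow> a < r \<Longrightarrow> linear (\<lambda>X. \<phi> x (Xs[a := X]))" using D(3) by simp
  show "x \<in> W \<Longrightarrow> length Xs = r \<Longrightarrow> a < r \<Longrightarrow> agree K X 0 \<Longrightarrow> \<phi> x (Xs[a := X]) = 0" using D(3) by simp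
  show "x \<notin> W \<or> length Xs \<noteq> r \<Longrightarrow> \<phi> x Xs = 0" using D(4) by blast
  show "\<phi> x [X, Y] = - \<phi> x [Y, X]" by (rule D(5)[rule_format])
qed

lemma form_orderI:
  assumes "1 \<le> K"
    and "\<And>Xs. length Xs = r \<Longrightarrow> smooth_order K (\<lambda>x. \<phi> x Xs)"
    and "\<And>x Xs a. x \<in> W \<Longrightarrow> length Xs = r \<Longrightarrow> a < r \<Longrightarrow> linear (\<lambda>X. \<phi> x (Xs[a := X]))"
    and "\<And>x Xs a X. x \<in> W \<Longrightarrow> length Xs = r \<Longrightarrow> a < r \<Longrightarrow> agree K X 0 \<Longrightarrow> \<phi> x (Xs[a := X]) = 0"
    and "\<And>x Xs. x \<notin> W \<or> length Xs \<noteq> r \<Longrightarrow> \<phi> x Xs = 0"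
    and "\<And>x X Y. \<phi> x [X, Y] = - \<phi> x [Y, X]"
  shows "form_order K r \<phi>"
  unfolding form_order_def by (intro conjI allI impI ballI) (rule assms; assumption)+

lemma form_order_covector_field:
  assumes "form_order K r \<phi>" "length Xs = r" "a < r"
  shows "covector_field K (\<lambda>y X. \<phi> y (Xs[a := X]))"
  unfolding covector_field_def
proof (intro conjI allI ballI impI)
  show "1 \<le> K" by (rule form_order_pos[OF assms(1)])
  show "smooth_order K (\<lambda>y. \<phi> y (Xs[a := X]))" for X
    by (rule form_order_smooth[OF assms(1)]) (simp add: assms(2))
  fix y assume "y \<in> W"
  then show "linear (\<lambda>X. \<phi> y (Xs[a := X]))" "\<And>X. agree K X 0 \<Longrightarrow> \<phi> y (Xs[a := X]) = 0"
    using form_order_linear[OF assms(1) _ assms(2,3)] form_order_agree[OF assms(1) _ assms(2,3)] by simp_all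
qed

lemma form_order_mono: "form_order K r \<phi> \<Longrightarrow> K \<le> K' \<Longrightarrow> form_order K' r \<phi>"
proof (rule form_orderI)
  assume A: "form_order K r \<phi>" "K \<le> K'"
  show "1 \<le> K'" using form_order_pos[OF A(1)] A(2) by simp
  show "smooth_order K' (\<lambda>x. \<phi> x Xs)" if "length Xs = r" for Xs
    by (rule smooth_order_mono[OF form_order_smooth[OF A(1) that] A(2)])
  show "linear (\<lambda>X. \<phi> x (Xs[a := X]))" if "x \<in> W" "length Xs = r" "a < r" for x Xs a
    by (rule form_order_linear[OF A(1) that])
  show "\<phi> x (Xs[a := X]) = 0" if "x \<in> W" "length Xs = r" "a < r" "agree K' X 0" for x Xs a X
    by (rule form_order_agree[OF A(1) that(1-3) agree_mono[OF that(4) A(2)]])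
  show "\<phi> x Xs = 0" if "x \<notin> W \<or> length Xs \<noteq> r" for x Xs
    by (rule form_order_outside[OF A(1) that])
  show "\<phi> x [X, Y] = - \<phi> x [Y, X]" for x X Y
    by (rule form_order_skew[OF A(1)])
qed

lemma form_order_add:
  assumes "form_order K r \<phi>" "form_order K r \<psi>"
  shows "form_order K r (\<phi> + \<psi>)"
proof (rule form_orderI, unfold plus_fun_apply)
  show "smooth_order K (\<lambda>x. \<phi> x Xs + \<psi> x Xs)" if "length Xs = r" for Xs
    by (rule smooth_order_add[OF form_order_smooth[OF assms(1) that] form_order_smooth[OF assms(2) that]])
  show "linear (\<lambda>X. \<phi> x (Xs[a := X]) + \<psi> x (Xs[a := X]))" if "x \<in> W" "length Xs = r" "a < r" for x Xs a
    by (rule linear_compose_add[OF form_order_linear[OF assms(1) that] form_order_linear[OF assms(2) that]])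
  show "1 \<le> K" by (rule form_order_pos[OF assms(1)])
  show "\<phi> x [X, Y] + \<psi> x [X, Y] = - (\<phi> x [Y, X] + \<psi> x [Y, X])" for x X Y
    using form_order_skew[OF assms(1), of x X Y] form_order_skew[OF assms(2), of x X Y] by linarith
  show "\<phi> x (Xs[a := X]) + \<psi> x (Xs[a := X]) = 0"
    if "x \<in> W" "length Xs = r" "a < r" "agree K X 0" for x Xs a X
    using form_order_agree[OF assms(1) that] form_order_agree[OF assms(2) that] by simp
  show "\<phi> x Xs + \<psi> x Xs = 0" if "x \<notin> W \<or> length Xs \<noteq> r" for x Xs
    using form_order_outside[OF assms(1) that] form_order_outside[OF assms(2) that] by simp
qed

lemma form_order_scaleR:
  assumes "form_order K r \<phi>"
  shows "form_order K r (c *\<^sub>R \<phi>)"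
proof (rule form_orderI, unfold scaleR_apply real_scaleR_def)
  show "smooth_order K (\<lambda>x. c * \<phi> x Xs)" if "length Xs = r" for Xs
    by (rule smooth_order_mult[OF smooth_order_const[OF form_order_pos[OF assms]] form_order_smooth[OF assms that]])
  show "linear (\<lambda>X. c * \<phi> x (Xs[a := X]))" if "x \<in> W" "length Xs = r" "a < r" for x Xs a
    using linear_compose_scale_right[OF form_order_linear[OF assms(1) that]] by simp
  show "1 \<le> K" by (rule form_order_pos[OF assms])
  show "c * \<phi> x [X, Y] = - (c * \<phi> x [Y, X])" for x X Y
    using form_order_skew[OF assms(1), of x X Y] by simp
  show "c * \<phi> x (Xs[a := X]) = 0"
    if "x \<in> W" "length Xs = r" "a < r" "agree K X 0" for x Xs a X
    using form_order_agree[OF assms(1) that] by simp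
  show "c * \<phi> x Xs = 0" if "x \<notin> W \<or> length Xs \<noteq> r" for x Xs
    using form_order_outside[OF assms(1) that] by simp
qed

lemma form_order_zero: "1 \<le> K \<Longrightarrow> form_order K r 0"
  by (rule form_orderI) (simp_all add: smooth_order_const module_hom_zero)

definition forms :: "nat \<Rightarrow> ('m, 'n) form set" where
  "forms r = {\<phi>. \<exists>K. form_order K r \<phi>}"

lemma formsI: "form_order K r \<phi> \<Longrightarrow> \<phi> \<in> forms r"
  unfolding forms_def by blast

lemma subspace_forms: "subspace (forms r)"
proof (rule subspaceI)
  show "0 \<in> forms r" by (rule formsI[OF form_order_zero[of 1]]) simp
  fix \<phi> \<psi> assume "\<phi> \<in> forms r" "\<psi> \<in> forms r"
  then obtain K K' where "form_order K r \<phi>" "form_order K' r \<psi>" unfolding forms_def by blast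
  then have "form_order (max K K') r (\<phi> + \<psi>)"
    by (intro form_order_add) (auto intro: form_order_mono)
  then show "\<phi> + \<psi> \<in> forms r" by (rule formsI)
next
  fix c \<phi> assume "\<phi> \<in> forms r"
  then obtain K where "form_order K r \<phi>" unfolding forms_def by blast
  then show "c *\<^sub>R \<phi> \<in> forms r" by (intro formsI[OF form_order_scaleR])
qed

end

section \<open>Total derivatives and vertical endomorphisms on forms\<close>

lemma slot_add: "slot M (\<phi> + \<psi>) = slot M \<phi> + slot M \<psi>"
  by (simp add: fun_eq_iff slot_def sum.distrib)

lemma slot_scaleR: "slot M (c *\<^sub>R \<phi>) = c *\<^sub>R slot M \<phi>"
  by (simp add: fun_eq_iff slot_def sum_distrib_left)

lemma slot_single: "slot M \<phi> x [X] = \<phi> x [M X]"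
  by (simp add: slot_def)

lemma slot_pair: "slot M \<phi> x [X, Y] = \<phi> x [M X, Y] + \<phi> x [X, M Y]"
  by (simp add: slot_def lessThan_Suc numeral_2_eq_2)

context jet_region
begin

lemma slot_outside:
  "form_order K r \<phi> \<Longrightarrow> x \<notin> W \<or> length Xs \<noteq> r \<Longrightarrow> slot M \<phi> x Xs = 0"
  unfolding slot_def by (rule sum.neutral) (auto intro: form_order_outside)

lemma form_order_slot:
  assumes \<phi>: "form_order K r \<phi>" and "linear M" "K \<le> K'"
    and agree: "\<And>X. agree K' X 0 \<Longrightarrow> agree K (M X) 0"
  shows "form_order K' r (slot M \<phi>)"
proof (rule form_orderI)
  show pos: "1 \<le> K'" using form_order_pos[OF \<phi>] \<open>K \<le> K'\<close> by simp
  show "smooth_order K' (\<lambda>x. slot M \<phi> x Xs)" if "length Xs = r" for Xs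
    unfolding slot_def using that
    by (intro smooth_order_sum[OF pos] smooth_order_mono[OF form_order_smooth[OF \<phi>] \<open>K \<le> K'\<close>]) simp
  have upd: "\<phi> x ((Xs[a := X])[b := M (Xs[a := X] ! b)]) =
      (if b = a then \<phi> x (Xs[a := M X]) else \<phi> x ((Xs[b := M (Xs ! b)])[a := X]))"
    if "length Xs = r" "a < r" for x Xs a b X
    using that by (simp add: list_update_swap)
  show "linear (\<lambda>X. slot M \<phi> x (Xs[a := X]))" if "x \<in> W" "length Xs = r" "a < r" for x Xs a
    unfolding slot_def length_list_update upd[OF that(2,3)]
  proof (rule linear_compose_sum, rule ballI)
    fix b assume "b \<in> {..<length Xs}"
    show "linear (\<lambda>X. if b = a then \<phi> x (Xs[a := M X]) else \<phi> x ((Xs[b := M (Xs ! b)])[a := X]))"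
    proof (cases "b = a")
      case True
      then show ?thesis
        using linear_compose[OF \<open>linear M\<close> form_order_linear[OF \<phi> that]] by (simp add: o_def)
    next
      case False
      then show ?thesis
        using form_order_linear[OF \<phi> that(1) _ that(3), of "Xs[b := M (Xs ! b)]"] that(2) by simp
    qed
  qed
  show "slot M \<phi> x (Xs[a := X]) = 0" if "x \<in> W" "length Xs = r" "a < r" "agree K' X 0" for x Xs a X
    unfolding slot_def length_list_update upd[OF that(2,3)]
  proof (rule sum.neutral, rule ballI)
    fix b assume "b \<in> {..<length Xs}"
    have "\<phi> x (Xs[a := M X]) = 0"
      by (rule form_order_agree[OF \<phi> that(1-3) agree[OF that(4)]])
    moreover have "\<phi> x ((Xs[b := M (Xs ! b)])[a := X]) = 0"
      using that(2) by (intro form_order_agree[OF \<phi> that(1) _ that(3) agree_mono[OF that(4) \<open>K \<le> K'\<close>]]) simp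
    ultimately show "(if b = a then \<phi> x (Xs[a := M X]) else \<phi> x ((Xs[b := M (Xs ! b)])[a := X])) = 0"
      by simp
  qed
  show "slot M \<phi> x Xs = 0" if "x \<notin> W \<or> length Xs \<noteq> r" for x Xs
    by (rule slot_outside[OF \<phi> that])
  show "slot M \<phi> x [X, Y] = - slot M \<phi> x [Y, X]" for x X Y
    unfolding slot_pair
    using form_order_skew[OF \<phi>, of x "M X" Y] form_order_skew[OF \<phi>, of x X "M Y"] by linarith
qed

lemma form_order_vert: "form_order K r \<phi> \<Longrightarrow> form_order K r (vert_form i \<phi>)"
  unfolding vert_form_eq_slot by (rule form_order_slot[OF _ linear_vert_endo order_refl agree_vert_endo])

lemma form_order_slot_total: "form_order K r \<phi> \<Longrightarrow> form_order (Suc K) r (slot (total_deriv i) \<phi>)"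
  by (rule form_order_slot[OF _ linear_total_deriv])
     (use agree_total_deriv[of _ _ 0] in \<open>auto simp only: total_deriv_zero le_SucI\<close>)

text \<open>In the double sum over slots, the terms in which \<open>M\<close> and \<open>M'\<close> act on different slots cancel; in the
others the order is reversed, because the maps act on arguments.\<close>

lemma slot_commutator:
  assumes \<phi>: "form_order K r \<phi>"
  shows "slot M (slot M' \<phi>) - slot M' (slot M \<phi>) = slot (\<lambda>X. M' (M X) - M (M' X)) \<phi>"
proof (intro ext)
  fix x Xs
  have "slot M (slot M' \<phi>) x Xs - slot M' (slot M \<phi>) x Xs = slot (\<lambda>X. M' (M X) - M (M' X)) \<phi> x Xs"
  proof (cases "x \<in> W \<and> length Xs = r")
    case False
    then have "\<phi> x Ys = 0" if "length Ys = length Xs" for Ys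
      using form_order_outside[OF \<phi>, of x Ys] that by auto
    then show ?thesis by (simp add: slot_def)
  next
    case True
    define c where "c = (\<lambda>N N' a b. if b = a then \<phi> x (Xs[a := N' (N (Xs ! a))])
        else \<phi> x ((Xs[a := N (Xs ! a)])[b := N' (Xs ! b)]))"
    have c: "slot N (slot N' \<phi>) x Xs = (\<Sum>a<r. \<Sum>b<r. c N N' a b)" for N N'
      unfolding slot_def c_def length_list_update using True by (intro sum.cong) auto
    have "slot M (slot M' \<phi>) x Xs - slot M' (slot M \<phi>) x Xs =
        (\<Sum>a<r. \<Sum>b<r. c M M' a b) - (\<Sum>a<r. \<Sum>b<r. c M' M b a)"
      unfolding c by (subst (2) sum.swap) (rule refl)
    also have "\<dots> = (\<Sum>a<r. \<Sum>b<r. c M M' a b - c M' M b a)"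
      by (simp add: sum_subtractf)
    also have "\<dots> = (\<Sum>a<r. \<Sum>b<r. if b = a then
        \<phi> x (Xs[a := M' (M (Xs ! a))]) - \<phi> x (Xs[a := M (M' (Xs ! a))]) else 0)"
      by (intro sum.cong refl) (simp add: c_def list_update_swap)
    also have "\<dots> = (\<Sum>a<r. \<phi> x (Xs[a := M' (M (Xs ! a))]) - \<phi> x (Xs[a := M (M' (Xs ! a))]))"
      by (intro sum.cong refl) simp
    also have "\<dots> = slot (\<lambda>X. M' (M X) - M (M' X)) \<phi> x Xs"
      unfolding slot_def using True linear_diff[OF form_order_linear[OF \<phi>]] by (intro sum.cong) auto
    finally show ?thesis .
  qed
  then show "(slot M (slot M' \<phi>) - slot M' (slot M \<phi>)) x Xs = slot (\<lambda>X. M' (M X) - M (M' X)) \<phi> x Xs"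
    by simp
qed

lemma slot_identity:
  assumes \<phi>: "form_order K r \<phi>"
  shows "slot (\<lambda>X. X) \<phi> = real r *\<^sub>R \<phi>"
proof (intro ext)
  fix x Xs
  show "slot (\<lambda>X. X) \<phi> x Xs = (real r *\<^sub>R \<phi>) x Xs"
    using form_order_outside[OF \<phi>, of x Xs] by (cases "length Xs = r") (simp_all add: slot_def)
qed

lemma slot_zero:
  assumes \<phi>: "form_order K r \<phi>"
  shows "slot (\<lambda>X. 0) \<phi> = 0"
proof (intro ext)
  fix x Xs
  have "slot (\<lambda>X. 0) \<phi> x Xs = 0"
  proof (cases "x \<in> W \<and> length Xs = r")
    case True
    then show ?thesis
      unfolding slot_def using linear_0[OF form_order_linear[OF \<phi>]] by (intro sum.neutral) auto
  qed (use slot_outside[OF \<phi>] in auto)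
  then show "slot (\<lambda>X. 0) \<phi> x Xs = 0 x Xs" by simp
qed

text \<open>The part of \<open>d\<^sub>i\<close> which differentiates the coefficients.\<close>

definition along :: "'m \<Rightarrow> ('m, 'n) form \<Rightarrow> ('m, 'n) form" where
  "along i \<phi> x Xs = (if x \<in> W then dir_deriv (total_deriv i x) (\<lambda>y. \<phi> y Xs) x else 0)"

lemma form_order_along:
  assumes \<phi>: "form_order K r \<phi>"
  shows "form_order (Suc K) r (along i \<phi>)"
proof (rule form_orderI)
  show "smooth_order (Suc K) (\<lambda>x. along i \<phi> x Xs)" if "length Xs = r" for Xs
    by (rule smooth_order_cong[OF covector_field_total_pairing[OF covector_field_differential[OF
            form_order_smooth[OF \<phi> that]], of i]]) (simp add: along_def)
  show "linear (\<lambda>X. along i \<phi> x (Xs[a := X]))" if x: "x \<in> W" and "length Xs = r" "a < r" for x Xs a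
  proof (rule linearI)
    note lin = form_order_linear[OF \<phi> _ that(2,3)]
    have sm: "smooth_order K (\<lambda>y. \<phi> y (Xs[a := X]))" for X
      by (rule form_order_smooth[OF \<phi>]) (simp add: that)
    let ?V = "total_deriv i x"
    show "along i \<phi> x (Xs[a := X + Y]) = along i \<phi> x (Xs[a := X]) + along i \<phi> x (Xs[a := Y])" for X Y
    proof -
      have "dir_deriv ?V (\<lambda>y. \<phi> y (Xs[a := X + Y])) x = dir_deriv ?V (\<lambda>y. \<phi> y (Xs[a := X]) + \<phi> y (Xs[a := Y])) x"
        by (rule dir_deriv_cong_W[OF x]) (intro ballI linear_add[OF lin])
      also have "\<dots> = dir_deriv ?V (\<lambda>y. \<phi> y (Xs[a := X])) x + dir_deriv ?V (\<lambda>y. \<phi> y (Xs[a := Y])) x"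
        by (rule dir_deriv_add[OF sm sm x])
      finally show ?thesis using x by (simp add: along_def)
    qed
    show "along i \<phi> x (Xs[a := c *\<^sub>R X]) = c *\<^sub>R along i \<phi> x (Xs[a := X])" for c X
    proof -
      have "dir_deriv ?V (\<lambda>y. \<phi> y (Xs[a := c *\<^sub>R X])) x = dir_deriv ?V (\<lambda>y. c * \<phi> y (Xs[a := X])) x"
        by (rule dir_deriv_cong_W[OF x]) (simp add: linear_cmul[OF lin])
      also have "\<dots> = c * dir_deriv ?V (\<lambda>y. \<phi> y (Xs[a := X])) x"
        by (rule dir_deriv_cmult[OF sm x])
      finally show ?thesis using x by (simp add: along_def)
    qed
  qed
  show "along i \<phi> x (Xs[a := X]) = 0"
    if x: "x \<in> W" and "length Xs = r" "a < r" "agree (Suc K) X 0" for x Xs a X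
  proof -
    have "dir_deriv (total_deriv i x) (\<lambda>y. \<phi> y (Xs[a := X])) x = dir_deriv (total_deriv i x) (\<lambda>y. 0) x"
      by (rule dir_deriv_cong_W[OF x])
         (intro ballI form_order_agree[OF \<phi> _ that(2,3) agree_mono[OF that(4)]], simp_all)
    then show ?thesis by (simp add: along_def)
  qed
  show "along i \<phi> x Xs = 0" if "x \<notin> W \<or> length Xs \<noteq> r" for x Xs
  proof (cases "x \<in> W")
    case True
    with that have "(\<lambda>y. \<phi> y Xs) = (\<lambda>y. 0)"
      by (intro ext form_order_outside[OF \<phi>]) simp
    then show ?thesis by (simp add: along_def)
  qed (simp add: along_def)
  show "along i \<phi> x [X, Y] = - along i \<phi> x [Y, X]" for x X Y
  proof (cases "r = 2 \<and> x \<in> W")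
    case True
    then have sm: "smooth_order K (\<lambda>y. \<phi> y [Y, X])" by (intro form_order_smooth[OF \<phi>]) simp
    have "(\<lambda>y. \<phi> y [X, Y]) = (\<lambda>y. (- 1) * \<phi> y [Y, X])"
    proof
      show "\<phi> y [X, Y] = (- 1) * \<phi> y [Y, X]" for y
        using form_order_skew[OF \<phi>, of y X Y] by simp
    qed
    then show ?thesis
      using dir_deriv_cmult[OF sm, of x _ "-1"] True by (simp add: along_def)
  next
    case False
    then have *: "x \<notin> W \<or> (\<lambda>y. \<phi> y [X, Y]) = (\<lambda>y. 0) \<and> (\<lambda>y. \<phi> y [Y, X]) = (\<lambda>y. 0)"
      by (auto intro!: form_order_outside[OF \<phi>])
    show ?thesis
    proof (cases "x \<in> W")
      case True
      with * have "(\<lambda>y. \<phi> y [X, Y]) = (\<lambda>y. 0)" "(\<lambda>y. \<phi> y [Y, X]) = (\<lambda>y. 0)" by blast+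
      then show ?thesis by (simp add: along_def)
    qed (simp add: along_def)
  qed
qed simp

lemma along_add:
  assumes "\<phi> \<in> forms r" "\<psi> \<in> forms r"
  shows "along i (\<phi> + \<psi>) = along i \<phi> + along i \<psi>"
proof (intro ext)
  obtain K K' where \<phi>: "form_order K r \<phi>" and \<psi>: "form_order K' r \<psi>"
    using assms unfolding forms_def by blast
  fix x Xs
  show "along i (\<phi> + \<psi>) x Xs = (along i \<phi> + along i \<psi>) x Xs"
  proof (cases "x \<in> W \<and> length Xs = r")
    case True
    then show ?thesis
      using dir_deriv_add[OF form_order_smooth[OF \<phi>] form_order_smooth[OF \<psi>]] by (simp add: along_def)
  next
    case False
    then show ?thesis
      using form_order_outside[OF \<phi>, of _ Xs] form_order_outside[OF \<psi>, of _ Xs] by (auto simp: along_def)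
  qed
qed

lemma along_scaleR:
  assumes "\<phi> \<in> forms r"
  shows "along i (c *\<^sub>R \<phi>) = c *\<^sub>R along i \<phi>"
proof (intro ext)
  obtain K where \<phi>: "form_order K r \<phi>" using assms unfolding forms_def by blast
  fix x Xs
  show "along i (c *\<^sub>R \<phi>) x Xs = (c *\<^sub>R along i \<phi>) x Xs"
  proof (cases "x \<in> W \<and> length Xs = r")
    case True
    then show ?thesis
      using dir_deriv_cmult[OF form_order_smooth[OF \<phi>]] by (simp add: along_def)
  next
    case False
    then show ?thesis
      using form_order_outside[OF \<phi>, of _ Xs] by (auto simp: along_def)
  qed
qed

lemma along_slot:
  assumes \<phi>: "form_order K r \<phi>"
  shows "along i (slot M \<phi>) = slot M (along i \<phi>)"
proof (intro ext)
  fix x Xs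
  show "along i (slot M \<phi>) x Xs = slot M (along i \<phi>) x Xs"
  proof (cases "x \<in> W \<and> length Xs = r")
    case True
    then have "dir_deriv V (\<lambda>y. slot M \<phi> y Xs) x =
        (\<Sum>a<length Xs. dir_deriv V (\<lambda>y. \<phi> y (Xs[a := M (Xs ! a)])) x)" for V
      unfolding slot_def
      by (intro dir_deriv_sum[OF _ form_order_pos[OF \<phi>]] form_order_smooth[OF \<phi>]) auto
    then show ?thesis using True by (simp add: along_def slot_def)
  next
    case False
    have "along i \<phi> x Ys = 0" if "length Ys = length Xs" for Ys
      using form_order_outside[OF form_order_along[OF \<phi>], of x Ys] False that by auto
    moreover have "along i (slot M \<phi>) x Xs = 0"
    proof (cases "x \<in> W")
      case True
      then have "(\<lambda>y. slot M \<phi> y Xs) = (\<lambda>y. 0)"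
        using False by (intro ext slot_outside[OF \<phi>]) simp
      then show ?thesis by (simp add: along_def)
    qed (simp add: along_def)
    ultimately show ?thesis by (simp add: slot_def)
  qed
qed

text \<open>Both sides contain the second derivative in the directions \<open>T\<^sub>i\<close> and \<open>T\<^sub>j\<close> and the first derivative along
the derivative of one field in the direction of the other, namely along \<open>T\<^sub>i T\<^sub>j x\<close>.\<close>

lemma along_commute:
  assumes \<phi>: "form_order K r \<phi>"
  shows "along i (along j \<phi>) = along j (along i \<phi>)"
proof (intro ext)
  fix x Xs
  show "along i (along j \<phi>) x Xs = along j (along i \<phi>) x Xs"
  proof (cases "x \<in> W \<and> length Xs = r")
    case True
    then have x: "x \<in> W" and r: "length Xs = r" by auto
    let ?f = "\<lambda>y. \<phi> y Xs"
    have f: "smooth_order K ?f" by (rule form_order_smooth[OF \<phi> r])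
    have "along i (along j \<phi>) x Xs = dir_deriv (total_deriv i x) (dir_deriv (total_deriv j x) ?f) x +
        dir_deriv (total_deriv j (total_deriv i x)) ?f x" for i j
    proof -
      have "along i (along j \<phi>) x Xs = dir_deriv (total_deriv i x) (\<lambda>y. dir_deriv (total_deriv j y) ?f y) x"
        using x dir_deriv_cong_W[OF x, of "\<lambda>y. along j \<phi> y Xs" "\<lambda>y. dir_deriv (total_deriv j y) ?f y"]
        by (simp add: along_def)
      also have "\<dots> = dir_deriv (total_deriv i x) (\<lambda>y. dir_deriv (total_deriv j x) ?f y) x +
        dir_deriv (total_deriv j (total_deriv i x)) ?f x"
        by (rule covector_field_deriv_pairing[OF covector_field_differential[OF f] linear_total_deriv x])
      finally show ?thesis .
    qed
    note * = this
    show ?thesis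
      unfolding *[of i j] *[of j i]
      using dir_deriv_commute[OF f x] total_deriv_commute[of i j x] by simp
  next
    case False
    then show ?thesis
      using form_order_outside[OF form_order_along[OF form_order_along[OF \<phi>]], of x Xs] by auto
  qed
qed

text \<open>The operator \<open>d\<^sub>i\<close>; \<open>lie_single\<close> and \<open>lie_pair\<close> identify it with the Lie derivative given by Cartan's
formula.\<close>

definition tot :: "'m \<Rightarrow> ('m, 'n) form \<Rightarrow> ('m, 'n) form" where
  "tot i \<phi> = along i \<phi> + slot (total_deriv i) \<phi>"

lemma form_order_tot: "form_order K r \<phi> \<Longrightarrow> form_order (Suc K) r (tot i \<phi>)"
  unfolding tot_def by (intro form_order_add form_order_along form_order_slot_total)

lemma forms_vert: "\<phi> \<in> forms r \<Longrightarrow> vert_form i \<phi> \<in> forms r"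
  unfolding forms_def using form_order_vert by blast

lemma forms_tot: "\<phi> \<in> forms r \<Longrightarrow> tot i \<phi> \<in> forms r"
  unfolding forms_def using form_order_tot by blast

lemma tot_add: "\<phi> \<in> forms r \<Longrightarrow> \<psi> \<in> forms r \<Longrightarrow> tot i (\<phi> + \<psi>) = tot i \<phi> + tot i \<psi>"
  by (simp add: tot_def along_add slot_add algebra_simps)

lemma tot_scaleR: "\<phi> \<in> forms r \<Longrightarrow> tot i (c *\<^sub>R \<phi>) = c *\<^sub>R tot i \<phi>"
  by (simp add: tot_def along_scaleR slot_scaleR scaleR_add_right)

lemma vert_tot:
  assumes "\<phi> \<in> forms r"
  shows "vert_form i (tot l \<phi>) = tot l (vert_form i \<phi>) + (if i = l then real r *\<^sub>R \<phi> else 0)"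
proof -
  obtain K where \<phi>: "form_order K r \<phi>" using assms unfolding forms_def by blast
  have "slot (vert_endo i) (slot (total_deriv l) \<phi>) - slot (total_deriv l) (slot (vert_endo i) \<phi>) =
      (if i = l then real r *\<^sub>R \<phi> else 0)"
    unfolding slot_commutator[OF \<phi>] total_vert_commutator
    using slot_identity[OF \<phi>] slot_zero[OF \<phi>] by simp
  then show ?thesis
    unfolding vert_form_eq_slot tot_def slot_add along_slot[OF \<phi>] by (simp add: algebra_simps)
qed

lemma tot_commute:
  assumes "\<phi> \<in> forms r"
  shows "tot i (tot j \<phi>) = tot j (tot i \<phi>)"
proof -
  obtain K where \<phi>: "form_order K r \<phi>" using assms unfolding forms_def by blast
  have f: "along i \<phi> \<in> forms r" "slot (total_deriv i) \<phi> \<in> forms r" for i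
    using formsI form_order_along[OF \<phi>] form_order_slot_total[OF \<phi>] by blast+
  have "slot (total_deriv i) (slot (total_deriv j) \<phi>) - slot (total_deriv j) (slot (total_deriv i) \<phi>) = 0"
    unfolding slot_commutator[OF \<phi>] total_deriv_commute[of j i] using slot_zero[OF \<phi>] by simp
  then show ?thesis
    unfolding tot_def slot_add along_add[OF f] along_slot[OF \<phi>] along_commute[OF \<phi>, of i j]
    by (simp add: algebra_simps)
qed

lemma vert_commute:
  assumes "\<phi> \<in> forms r"
  shows "vert_form i (vert_form j \<phi>) = vert_form j (vert_form i \<phi>)"
proof -
  obtain K where \<phi>: "form_order K r \<phi>" using assms unfolding forms_def by blast
  show ?thesis
    using slot_commutator[OF \<phi>, of "vert_endo i" "vert_endo j"] slot_zero[OF \<phi>]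
    unfolding vert_form_eq_slot vert_endo_commute[of j i] by simp
qed

lemma forms1_eqI:
  assumes "\<phi> \<in> forms 1" "\<psi> \<in> forms 1" "\<And>x Y. x \<in> W \<Longrightarrow> \<phi> x [Y] = \<psi> x [Y]"
  shows "\<phi> = \<psi>"
proof (intro ext)
  obtain K K' where "form_order K 1 \<phi>" "form_order K' 1 \<psi>" using assms unfolding forms_def by blast
  then have out: "\<phi> x Xs = 0 \<and> \<psi> x Xs = 0" if "x \<notin> W \<or> length Xs \<noteq> 1" for x Xs
    using that by (simp add: form_order_outside)
  show "\<phi> x Xs = \<psi> x Xs" for x Xs
  proof (cases "x \<in> W \<and> length Xs = 1")
    case True
    then obtain Y where "Xs = [Y]" by (auto simp: length_Suc_conv)
    then show ?thesis using assms(3) True by simp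
  qed (use out in auto)
qed

lemma forms2_eqI:
  assumes "\<phi> \<in> forms 2" "\<psi> \<in> forms 2" "\<And>x X Y. x \<in> W \<Longrightarrow> \<phi> x [X, Y] = \<psi> x [X, Y]"
  shows "\<phi> = \<psi>"
proof (intro ext)
  obtain K K' where "form_order K 2 \<phi>" "form_order K' 2 \<psi>" using assms unfolding forms_def by blast
  then have out: "\<phi> x Xs = 0 \<and> \<psi> x Xs = 0" if "x \<notin> W \<or> length Xs \<noteq> 2" for x Xs
    using that by (simp add: form_order_outside)
  show "\<phi> x Xs = \<psi> x Xs" for x Xs
  proof (cases "x \<in> W \<and> length Xs = 2")
    case True
    then obtain X Y where "Xs = [X, Y]" by (auto simp: length_Suc_conv numeral_2_eq_2)
    then show ?thesis using assms(3) True by simp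
  qed (use out in auto)
qed

lemma tot_single:
  "x \<in> W \<Longrightarrow> tot i \<phi> x [Y] = dir_deriv (total_deriv i x) (\<lambda>y. \<phi> y [Y]) x + \<phi> x [total_deriv i Y]"
  by (simp add: tot_def along_def slot_single)

lemma tot_pair:
  "x \<in> W \<Longrightarrow> tot i \<phi> x [X, Y] = dir_deriv (total_deriv i x) (\<lambda>y. \<phi> y [X, Y]) x +
     \<phi> x [total_deriv i X, Y] + \<phi> x [X, total_deriv i Y]"
  by (simp add: tot_def along_def slot_pair)

end

section \<open>Exterior derivative and contraction\<close>

lemma ext_d_single: "ext_d \<phi> x [X] = dir_deriv X (\<lambda>y. \<phi> y []) x"
  by (simp add: ext_d_def)

lemma ext_d_pair:
  "ext_d \<phi> x [X, Y] = dir_deriv X (\<lambda>y. \<phi> y [Y]) x - dir_deriv Y (\<lambda>y. \<phi> y [X]) x"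
  by (simp add: ext_d_def lessThan_Suc numeral_2_eq_2)

lemma ext_d_triple:
  "ext_d \<phi> x [X, Y, Z] = dir_deriv X (\<lambda>y. \<phi> y [Y, Z]) x - dir_deriv Y (\<lambda>y. \<phi> y [X, Z]) x
     + dir_deriv Z (\<lambda>y. \<phi> y [X, Y]) x"
  by (simp add: ext_d_def lessThan_Suc)

lemma ext_d_outside:
  assumes "\<And>y Ys. length Ys \<noteq> r \<Longrightarrow> \<phi> y Ys = 0" "length Xs \<noteq> Suc r"
  shows "ext_d \<phi> x Xs = 0"
  unfolding ext_d_def
proof (rule sum.neutral, rule ballI)
  fix a assume a: "a \<in> {..<length Xs}"
  have "(\<lambda>y. \<phi> y (take a Xs @ drop (Suc a) Xs)) = (\<lambda>y. 0)"
    using assms a by (intro ext assms(1)) auto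
  then show "(- 1) ^ a * dir_deriv (Xs ! a) (\<lambda>y. \<phi> y (take a Xs @ drop (Suc a) Xs)) x = 0"
    by simp
qed

context jet_region
begin

definition ed :: "('m, 'n) form \<Rightarrow> ('m, 'n) form" where
  "ed \<phi> x Xs = (if x \<in> W then ext_d \<phi> x Xs else 0)"

lemma form_order_differential:
  assumes f: "smooth_order K f"
  shows "form_order K 1 (ed (fun_form f))"
proof (rule form_orderI)
  have single: "ed (fun_form f) x [X] = (if x \<in> W then dir_deriv X f x else 0)" for x X
    by (simp add: ed_def ext_d_single fun_form_def)
  show "1 \<le> K" by (rule smooth_order_pos[OF f])
  show "ed (fun_form f) x Xs = 0" if "x \<notin> W \<or> length Xs \<noteq> 1" for x Xs
    using that ext_d_outside[of 0 "fun_form f" Xs x] by (auto simp: ed_def fun_form_def)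
  then show "ed (fun_form f) x [X, Y] = - ed (fun_form f) x [Y, X]" for x X Y by simp
  show "smooth_order K (\<lambda>x. ed (fun_form f) x Xs)" if "length Xs = 1" for Xs
  proof -
    from that obtain X where "Xs = [X]" by (auto simp: length_Suc_conv)
    then show ?thesis
      using smooth_order_cong[OF smooth_order_dir_deriv[OF f, of X]] single by simp
  qed
  fix x and Xs :: "('m, 'n) jet list" and a :: nat assume x: "x \<in> W" and "length Xs = 1" "a < 1"
  then have upd: "Xs[a := X] = [X]" for X by (auto simp: length_Suc_conv)
  show "linear (\<lambda>X. ed (fun_form f) x (Xs[a := X]))"
    unfolding upd single using linear_dir_deriv[OF f x] x by simp
  show "ed (fun_form f) x (Xs[a := X]) = 0" if "agree K X 0" for X
    unfolding upd single
    using covector_field_agree[OF covector_field_differential[OF f] x that] by simp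
qed

lemma ed_pair:
  "x \<in> W \<Longrightarrow> ed \<phi> x [X, Y] = dir_deriv X (\<lambda>y. \<phi> y [Y]) x - dir_deriv Y (\<lambda>y. \<phi> y [X]) x"
  by (simp add: ed_def ext_d_pair)

lemma form1_covector_field:
  "form_order K 1 \<phi> \<Longrightarrow> covector_field K (\<lambda>y X. \<phi> y [X])"
  using form_order_covector_field[of K 1 \<phi> "[0]" 0] by simp

lemma form2_covector_field:
  "form_order K 2 \<phi> \<Longrightarrow> covector_field K (\<lambda>y X. \<phi> y [X, Y])"
  "form_order K 2 \<phi> \<Longrightarrow> covector_field K (\<lambda>y X. \<phi> y [Y, X])"
  using form_order_covector_field[of K 2 \<phi> "[0, Y]" 0] form_order_covector_field[of K 2 \<phi> "[Y, 0]" 1]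
  by simp_all

lemma linear_deriv_of_covector:
  assumes G: "covector_field K G" and x: "x \<in> W"
  shows "linear (\<lambda>X. dir_deriv Z (\<lambda>y. G y X) x)"
    and "agree K X 0 \<Longrightarrow> dir_deriv Z (\<lambda>y. G y X) x = 0"
proof -
  note sm = covector_field_smooth[OF G] and lin = covector_field_linear[OF G]
  show "linear (\<lambda>X. dir_deriv Z (\<lambda>y. G y X) x)"
  proof (rule linearI)
    fix X Y
    have "dir_deriv Z (\<lambda>y. G y (X + Y)) x = dir_deriv Z (\<lambda>y. G y X + G y Y) x"
      by (rule dir_deriv_cong_W[OF x]) (intro ballI linear_add[OF lin])
    then show "dir_deriv Z (\<lambda>y. G y (X + Y)) x = dir_deriv Z (\<lambda>y. G y X) x + dir_deriv Z (\<lambda>y. G y Y) x"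
      using dir_deriv_add[OF sm sm x] by simp
  next
    fix c X
    have "dir_deriv Z (\<lambda>y. G y (c *\<^sub>R X)) x = dir_deriv Z (\<lambda>y. c * G y X) x"
      by (rule dir_deriv_cong_W[OF x]) (simp add: linear_cmul[OF lin])
    then show "dir_deriv Z (\<lambda>y. G y (c *\<^sub>R X)) x = c *\<^sub>R dir_deriv Z (\<lambda>y. G y X) x"
      using dir_deriv_cmult[OF sm x] by simp
  qed
  show "dir_deriv Z (\<lambda>y. G y X) x = 0" if "agree K X 0"
  proof -
    have "dir_deriv Z (\<lambda>y. G y X) x = dir_deriv Z (\<lambda>y. 0) x"
      by (rule dir_deriv_cong_W[OF x]) (intro ballI covector_field_agree[OF G _ that])
    then show ?thesis by simp
  qed
qed

lemma form_order_ed: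
  assumes \<phi>: "form_order K 1 \<phi>"
  shows "form_order K 2 (ed \<phi>)"
proof (rule form_orderI)
  note G = form1_covector_field[OF \<phi>]
  have sm: "smooth_order K (\<lambda>y. \<phi> y [X])" for X by (rule covector_field_smooth[OF G])
  have pair: "ed \<phi> x [X, Y] = (if x \<in> W then dir_deriv X (\<lambda>y. \<phi> y [Y]) x + (- 1) * dir_deriv Y (\<lambda>y. \<phi> y [X]) x else 0)"
    for x X Y
    by (simp add: ed_def ext_d_pair)
  show "1 \<le> K" by (rule form_order_pos[OF \<phi>])
  show "ed \<phi> x Xs = 0" if "x \<notin> W \<or> length Xs \<noteq> 2" for x Xs
    using that ext_d_outside[of 1 \<phi> Xs x] form_order_outside[OF \<phi>] by (auto simp: ed_def)
  show "ed \<phi> x [X, Y] = - ed \<phi> x [Y, X]" for x X Y by (simp add: pair)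
  show "smooth_order K (\<lambda>x. ed \<phi> x Xs)" if "length Xs = 2" for Xs
  proof -
    from that obtain X Y where "Xs = [X, Y]" by (auto simp: length_Suc_conv numeral_2_eq_2)
    moreover have "smooth_order K (\<lambda>x. dir_deriv X (\<lambda>y. \<phi> y [Y]) x + (- 1) * dir_deriv Y (\<lambda>y. \<phi> y [X]) x)"
      by (intro smooth_order_add smooth_order_mult smooth_order_const smooth_order_dir_deriv sm form_order_pos[OF \<phi>])
    ultimately show ?thesis
      using smooth_order_cong[of K "\<lambda>x. dir_deriv X (\<lambda>y. \<phi> y [Y]) x + (- 1) * dir_deriv Y (\<lambda>y. \<phi> y [X]) x"] pair
      by simp
  qed
  fix x and Xs :: "('m, 'n) jet list" and a :: nat assume x: "x \<in> W" and "length Xs = 2" "a < 2"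
  then obtain X Y where Xs: "Xs = [X, Y]" by (auto simp: length_Suc_conv numeral_2_eq_2)
  have lin: "linear (\<lambda>Z. dir_deriv Z (\<lambda>y. \<phi> y [U]) x)" "linear (\<lambda>Z. dir_deriv U (\<lambda>y. \<phi> y [Z]) x)" for U
    by (rule linear_dir_deriv[OF sm x], rule linear_deriv_of_covector(1)[OF G x])
  have zero: "dir_deriv Z (\<lambda>y. \<phi> y [U]) x = 0" "dir_deriv U (\<lambda>y. \<phi> y [Z]) x = 0" if "agree K Z 0" for U Z
    by (rule covector_field_agree[OF covector_field_differential[OF sm] x that],
        rule linear_deriv_of_covector(2)[OF G x that])
  have lin': "linear (\<lambda>Z. ed \<phi> x [Z, U])" "linear (\<lambda>Z. ed \<phi> x [U, Z])" for U
    unfolding pair using x linear_compose_add[OF lin(1) linear_compose_scale_right[OF lin(2), of "-1"], of U U]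
      linear_compose_add[OF lin(2) linear_compose_scale_right[OF lin(1), of "-1"], of U U] by simp_all
  consider "a = 0" | "a = 1" using \<open>a < 2\<close> by linarith
  note a = this
  show "linear (\<lambda>X. ed \<phi> x (Xs[a := X]))"
    using a by cases (simp_all add: Xs lin')
  show "ed \<phi> x (Xs[a := Z]) = 0" if "agree K Z 0" for Z
    using a by cases (simp_all add: Xs pair zero[OF that])
qed

definition ct :: "'m \<Rightarrow> ('m, 'n) form \<Rightarrow> ('m, 'n) form" where
  "ct l = contract (total_deriv l)"

lemma ct_single: "ct l \<phi> x Xs = \<phi> x (total_deriv l x # Xs)"
  by (simp add: contract_def ct_def)

lemma form_order_ct:
  assumes \<phi>: "form_order K 2 \<phi>"
  shows "form_order (Suc K) 1 (ct l \<phi>)"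
proof (rule form_orderI)
  show "smooth_order (Suc K) (\<lambda>x. ct l \<phi> x Xs)" if "length Xs = 1" for Xs
  proof -
    from that obtain Y where "Xs = [Y]" by (auto simp: length_Suc_conv)
    then show ?thesis
      using covector_field_total_pairing[OF form2_covector_field(1)[OF \<phi>]] by (simp add: ct_single)
  qed
  show "ct l \<phi> x Xs = 0" if "x \<notin> W \<or> length Xs \<noteq> 1" for x Xs
    unfolding ct_single by (rule form_order_outside[OF \<phi>]) (use that in simp)
  then show "ct l \<phi> x [X, Y] = - ct l \<phi> x [Y, X]" for x X Y by simp
  fix x and Xs :: "('m, 'n) jet list" and a :: nat assume x: "x \<in> W" and "length Xs = 1" "a < 1"
  then have upd: "Xs[a := X] = [X]" for X by (auto simp: length_Suc_conv)
  show "linear (\<lambda>X. ct l \<phi> x (Xs[a := X]))"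
    unfolding upd ct_single by (rule covector_field_linear[OF form2_covector_field(2)[OF \<phi>] x])
  show "ct l \<phi> x (Xs[a := X]) = 0" if "agree (Suc K) X 0" for X
    unfolding upd ct_single
    by (rule covector_field_agree[OF form2_covector_field(2)[OF \<phi>] x agree_mono[OF that]]) simp
qed simp

lemma forms_ed: "\<phi> \<in> forms 1 \<Longrightarrow> ed \<phi> \<in> forms 2"
  unfolding forms_def using form_order_ed by blast

lemma forms_ct: "\<phi> \<in> forms 2 \<Longrightarrow> ct l \<phi> \<in> forms 1"
  unfolding forms_def using form_order_ct by blast

lemma ed_add:
  assumes "\<phi> \<in> forms 1" "\<psi> \<in> forms 1"
  shows "ed (\<phi> + \<psi>) = ed \<phi> + ed \<psi>"
proof (rule forms2_eqI)
  obtain K K' where \<phi>: "form_order K 1 \<phi>" and \<psi>: "form_order K' 1 \<psi>"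
    using assms unfolding forms_def by blast
  show "ed (\<phi> + \<psi>) \<in> forms 2" "ed \<phi> + ed \<psi> \<in> forms 2"
    by (intro forms_ed subspace_add[OF subspace_forms] assms)+
  fix x X Y assume x: "x \<in> W"
  show "ed (\<phi> + \<psi>) x [X, Y] = (ed \<phi> + ed \<psi>) x [X, Y]"
    using dir_deriv_add[OF covector_field_smooth[OF form1_covector_field[OF \<phi>]]
        covector_field_smooth[OF form1_covector_field[OF \<psi>]] x]
    by (simp add: ed_pair[OF x])
qed

lemma ed_scaleR:
  assumes "\<phi> \<in> forms 1"
  shows "ed (c *\<^sub>R \<phi>) = c *\<^sub>R ed \<phi>"
proof (rule forms2_eqI)
  obtain K where \<phi>: "form_order K 1 \<phi>" using assms unfolding forms_def by blast
  show "ed (c *\<^sub>R \<phi>) \<in> forms 2" "c *\<^sub>R ed \<phi> \<in> forms 2"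
    by (intro forms_ed subspace_scale[OF subspace_forms] assms)+
  fix x X Y assume x: "x \<in> W"
  show "ed (c *\<^sub>R \<phi>) x [X, Y] = (c *\<^sub>R ed \<phi>) x [X, Y]"
    using dir_deriv_cmult[OF covector_field_smooth[OF form1_covector_field[OF \<phi>]] x]
    by (simp add: ed_pair[OF x] algebra_simps)
qed

lemma ct_add: "ct l (\<phi> + \<psi>) = ct l \<phi> + ct l \<psi>"
  by (simp add: fun_eq_iff ct_single)

lemma ct_scaleR: "ct l (c *\<^sub>R \<phi>) = c *\<^sub>R ct l \<phi>"
  by (simp add: fun_eq_iff ct_single)

text \<open>Writing out both sides, the terms without a second derivative coincide and the others match by the
symmetry of second derivatives.\<close>

lemma ed_tot:
  assumes "\<phi> \<in> forms 1"
  shows "ed (tot i \<phi>) = tot i (ed \<phi>)"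
proof (rule forms2_eqI)
  show "ed (tot i \<phi>) \<in> forms 2" "tot i (ed \<phi>) \<in> forms 2"
    by (intro forms_ed forms_tot assms)+
  obtain K where \<phi>: "form_order K 1 \<phi>" using assms unfolding forms_def by blast
  have sm: "smooth_order K (\<lambda>y. \<phi> y [Y])" for Y
    by (rule covector_field_smooth[OF form1_covector_field[OF \<phi>]])
  fix x X Y assume x: "x \<in> W"
  have lin: "linear (\<lambda>Z. \<phi> y [Z])" if "y \<in> W" for y
    by (rule covector_field_linear[OF form1_covector_field[OF \<phi>] that])
  let ?T = "total_deriv i"
  have A: "dir_deriv X (\<lambda>y. tot i \<phi> y [Y]) x =
      dir_deriv X (dir_deriv (?T x) (\<lambda>y. \<phi> y [Y])) x + dir_deriv (?T X) (\<lambda>y. \<phi> y [Y]) x +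
      dir_deriv X (\<lambda>y. \<phi> y [?T Y]) x" for X Y
  proof -
    have "dir_deriv X (\<lambda>y. tot i \<phi> y [Y]) x =
        dir_deriv X (\<lambda>y. dir_deriv (?T y) (\<lambda>z. \<phi> z [Y]) y + \<phi> y [?T Y]) x"
      by (rule dir_deriv_cong_W[OF x]) (simp add: tot_single)
    also have "\<dots> = dir_deriv X (\<lambda>y. dir_deriv (?T y) (\<lambda>z. \<phi> z [Y]) y) x + dir_deriv X (\<lambda>y. \<phi> y [?T Y]) x"
      by (rule dir_deriv_add[OF covector_field_total_pairing[OF covector_field_differential[OF sm]] sm x])
    also have "dir_deriv X (\<lambda>y. dir_deriv (?T y) (\<lambda>z. \<phi> z [Y]) y) x =
        dir_deriv X (dir_deriv (?T x) (\<lambda>y. \<phi> y [Y])) x + dir_deriv (?T X) (\<lambda>y. \<phi> y [Y]) x"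
      by (rule covector_field_deriv_pairing[OF covector_field_differential[OF sm] linear_total_deriv x])
    finally show ?thesis .
  qed
  have B: "dir_deriv (?T x) (\<lambda>y. ed \<phi> y [X, Y]) x =
      dir_deriv (?T x) (dir_deriv X (\<lambda>y. \<phi> y [Y])) x - dir_deriv (?T x) (dir_deriv Y (\<lambda>y. \<phi> y [X])) x"
  proof -
    have "dir_deriv (?T x) (\<lambda>y. ed \<phi> y [X, Y]) x =
       dir_deriv (?T x) (\<lambda>y. dir_deriv X (\<lambda>y. \<phi> y [Y]) y + (- 1) * dir_deriv Y (\<lambda>y. \<phi> y [X]) y) x"
      by (rule dir_deriv_cong_W[OF x]) (simp add: ed_pair)
    also have "\<dots> = dir_deriv (?T x) (dir_deriv X (\<lambda>y. \<phi> y [Y])) x +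
        dir_deriv (?T x) (\<lambda>y. (- 1) * dir_deriv Y (\<lambda>y. \<phi> y [X]) y) x"
      by (rule dir_deriv_add[OF smooth_order_dir_deriv[OF sm]
            smooth_order_mult[OF smooth_order_const[OF form_order_pos[OF \<phi>]] smooth_order_dir_deriv[OF sm]] x])
    also have "dir_deriv (?T x) (\<lambda>y. (- 1) * dir_deriv Y (\<lambda>y. \<phi> y [X]) y) x =
        (- 1) * dir_deriv (?T x) (dir_deriv Y (\<lambda>y. \<phi> y [X])) x"
      by (rule dir_deriv_cmult[OF smooth_order_dir_deriv[OF sm] x])
    finally show ?thesis by simp
  qed
  show "ed (tot i \<phi>) x [X, Y] = tot i (ed \<phi>) x [X, Y]"
    unfolding ed_pair[OF x] tot_pair[OF x] A B
    using dir_deriv_commute[OF sm x, of X "?T x" Y] dir_deriv_commute[OF sm x, of Y "?T x" X] by simp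
qed

lemma ct_tot:
  assumes "\<phi> \<in> forms 2"
  shows "ct l (tot i \<phi>) = tot i (ct l \<phi>)"
proof (rule forms1_eqI)
  show "ct l (tot i \<phi>) \<in> forms 1" "tot i (ct l \<phi>) \<in> forms 1"
    by (intro forms_ct forms_tot assms)+
  obtain K where \<phi>: "form_order K 2 \<phi>" using assms unfolding forms_def by blast
  fix x Y assume x: "x \<in> W"
  have "dir_deriv (total_deriv i x) (\<lambda>y. \<phi> y [total_deriv l y, Y]) x =
      dir_deriv (total_deriv i x) (\<lambda>y. \<phi> y [total_deriv l x, Y]) x + \<phi> x [total_deriv l (total_deriv i x), Y]"
    by (rule covector_field_deriv_pairing[OF form2_covector_field(1)[OF \<phi>] linear_total_deriv x])
  then show "ct l (tot i \<phi>) x [Y] = tot i (ct l \<phi>) x [Y]"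
    by (simp add: ct_single tot_pair[OF x] tot_single[OF x] total_deriv_commute[of l i])
qed

lemma lie_single:
  assumes "\<phi> \<in> forms 1" and x: "x \<in> W" and eq: "\<And>y Y. y \<in> W \<Longrightarrow> \<psi> y [Y] = \<phi> y [Y]"
  shows "lie (total_deriv i) \<psi> x [X] = tot i \<phi> x [X]"
proof -
  obtain K where \<phi>: "form_order K 1 \<phi>" using assms unfolding forms_def by blast
  let ?T = "total_deriv i"
  have e: "dir_deriv Z (\<lambda>y. \<psi> y [Y y]) x = dir_deriv Z (\<lambda>y. \<phi> y [Y y]) x" for Z Y
    by (rule dir_deriv_cong_W[OF x]) (simp add: eq)
  have "dir_deriv X (\<lambda>y. \<phi> y [?T y]) x = dir_deriv X (\<lambda>y. \<phi> y [?T x]) x + \<phi> x [?T X]"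
    by (rule covector_field_deriv_pairing[OF form1_covector_field[OF \<phi>] linear_total_deriv x])
  then show ?thesis
    by (simp add: lie_def contract_def ext_d_pair ext_d_single e tot_single[OF x])
qed

lemma lie_pair:
  assumes "\<phi> \<in> forms 2" and x: "x \<in> W" and eq: "\<And>y X Y. y \<in> W \<Longrightarrow> \<psi> y [X, Y] = \<phi> y [X, Y]"
  shows "lie (total_deriv i) \<psi> x [X, Y] = tot i \<phi> x [X, Y]"
proof -
  obtain K where \<phi>: "form_order K 2 \<phi>" using assms unfolding forms_def by blast
  let ?T = "total_deriv i"
  have e: "dir_deriv Z (\<lambda>y. \<psi> y [X y, Y y]) x = dir_deriv Z (\<lambda>y. \<phi> y [X y, Y y]) x" for Z X Y
    by (rule dir_deriv_cong_W[OF x]) (simp add: eq)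
  have "dir_deriv Z (\<lambda>y. \<phi> y [?T y, Y]) x = dir_deriv Z (\<lambda>y. \<phi> y [?T x, Y]) x + \<phi> x [?T Z, Y]" for Z Y
    by (rule covector_field_deriv_pairing[OF form2_covector_field(1)[OF \<phi>] linear_total_deriv x])
  moreover have "\<phi> x [?T Y, X] = - \<phi> x [X, ?T Y]"
    by (rule form_order_skew[OF \<phi>])
  ultimately show ?thesis
    by (simp add: lie_def contract_def ext_d_pair ext_d_triple e tot_pair[OF x])
qed

end

section \<open>Words and the Weyl algebra\<close>

text \<open>Linearity is relative to a subspace, because total derivatives are additive on smooth forms only.\<close>

definition lin_on :: "'a::real_vector set \<Rightarrow> 'b::real_vector set \<Rightarrow> ('a \<Rightarrow> 'b) \<Rightarrow> bool" where
  "lin_on A B f \<longleftrightarrow> (\<forall>\<phi>\<in>A. f \<phi> \<in> B) \<and> (\<forall>\<phi>\<in>A. \<forall>\<psi>\<in>A. f (\<phi> + \<psi>) = f \<phi> + f \<psi>) \<and>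
     (\<forall>c. \<forall>\<phi>\<in>A. f (c *\<^sub>R \<phi>) = c *\<^sub>R f \<phi>)"

lemma lin_onD:
  assumes "lin_on A B f"
  shows lin_on_closed: "\<phi> \<in> A \<Longrightarrow> f \<phi> \<in> B"
    and lin_on_add: "\<phi> \<in> A \<Longrightarrow> \<psi> \<in> A \<Longrightarrow> f (\<phi> + \<psi>) = f \<phi> + f \<psi>"
    and lin_on_scaleR: "\<phi> \<in> A \<Longrightarrow> f (c *\<^sub>R \<phi>) = c *\<^sub>R f \<phi>"
  using assms unfolding lin_on_def by blast+

lemma lin_on_zero:
  assumes "subspace A" "lin_on A B f"
  shows "f 0 = 0"
  using lin_on_scaleR[OF assms(2) subspace_0[OF assms(1)], of 0] by simp

lemma lin_on_diff:
  assumes "subspace A" "lin_on A B f" "\<phi> \<in> A" "\<psi> \<in> A"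
  shows "f (\<phi> - \<psi>) = f \<phi> - f \<psi>"
  using lin_on_add[OF assms(2,3) subspace_scale[OF assms(1,4)], of "-1"] lin_on_scaleR[OF assms(2,4), of "-1"]
  by simp

lemma lin_on_sum:
  assumes "subspace A" "lin_on A B f" "\<And>a. a \<in> F \<Longrightarrow> g a \<in> A"
  shows "f (\<Sum>a\<in>F. g a) = (\<Sum>a\<in>F. f (g a))"
  using assms(3)
  by (induction F rule: infinite_finite_induct)
     (simp_all add: lin_on_zero[OF assms(1,2)] lin_on_add[OF assms(2)] subspace_sum[OF assms(1)])

text \<open>Sums over multi-indices weighted by multinomial coefficients are sums over words, which need no
factorials and are built letter by letter.\<close>

definition words :: "nat \<Rightarrow> 'm list set" where
  "words n = {w. length w = n}"

lemma finite_words [simp]: "finite (words n :: 'm::finite list set)"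
  unfolding words_def using finite_lists_length_eq[OF finite[of "UNIV :: 'm set"], of n] by simp

lemma words_0 [simp]: "words 0 = {[]}"
  by (auto simp: words_def)

lemma words_length: "w \<in> words n \<Longrightarrow> length w = n"
  by (simp add: words_def)

lemma sum_words_Suc:
  fixes f :: "'m::finite list \<Rightarrow> 'a::comm_monoid_add"
  shows "(\<Sum>w\<in>words (Suc n). f w) = (\<Sum>i\<in>UNIV. \<Sum>w\<in>words n. f (i # w))"
proof -
  have "(\<Sum>w\<in>words (Suc n). f w) = (\<Sum>p\<in>UNIV \<times> words n. f (fst p # snd p))"
    by (rule sum.reindex_bij_witness[where i = "\<lambda>p. fst p # snd p" and j = "\<lambda>w. (hd w, tl w)"])
       (auto simp: words_def length_Suc_conv)
  then show ?thesis by (simp add: sum.cartesian_product case_prod_beta)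
qed

lemma sum_words_add:
  fixes f :: "'m::finite list \<Rightarrow> 'a::comm_monoid_add"
  shows "(\<Sum>w\<in>words (n + q). f w) = (\<Sum>u\<in>words n. \<Sum>w\<in>words q. f (u @ w))"
  by (induction n arbitrary: f) (simp_all add: sum_words_Suc)

lemma foldr_closed_on:
  assumes "\<And>i \<phi>. \<phi> \<in> A \<Longrightarrow> f i \<phi> \<in> A" "\<phi> \<in> A"
  shows "foldr f w \<phi> \<in> A"
  using assms by (induction w) simp_all

lemma foldr_commute_on:
  assumes "\<And>i \<phi>. \<phi> \<in> A \<Longrightarrow> f i \<phi> \<in> A" "\<And>i j \<phi>. \<phi> \<in> A \<Longrightarrow> f i (f j \<phi>) = f j (f i \<phi>)" "\<phi> \<in> A"
  shows "foldr f w (f i \<phi>) = f i (foldr f w \<phi>)"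
proof (induction w)
  case (Cons j w)
  show ?case
    using assms(2)[OF foldr_closed_on[of A f, OF assms(1,3)], of j i w] by (simp add: Cons.IH)
qed simp

lemma foldr_permute_on:
  assumes "\<And>i \<phi>. \<phi> \<in> A \<Longrightarrow> f i \<phi> \<in> A" "\<And>i j \<phi>. \<phi> \<in> A \<Longrightarrow> f i (f j \<phi>) = f j (f i \<phi>)" "\<phi> \<in> A"
    and "mset u = mset w"
  shows "foldr f u \<phi> = foldr f w \<phi>"
  using assms(4)
proof (induction u arbitrary: w)
  case (Cons i u)
  have "i \<in> set w" using Cons.prems by (metis list.set_intros(1) mset_eq_setD)
  then obtain a b where w: "w = a @ i # b" by (meson split_list)
  have "foldr f u \<phi> = foldr f (a @ b) \<phi>"
    by (rule Cons.IH) (use Cons.prems w in simp)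
  moreover have "foldr f w \<phi> = f i (foldr f (a @ b) \<phi>)"
    using foldr_commute_on[of A f, OF assms(1,2) foldr_closed_on[of A f, OF assms(1,3)]]
    by (simp add: w)
  ultimately show ?case by simp
qed simp

text \<open>The commutation relations of \<open>t\<^sub>i = d\<^sub>i\<close> and \<open>s\<^sub>i = S\<^sup>i\<close> on forms of degree \<open>r\<close>.\<close>

locale weyl_action =
  fixes A :: "'f::real_vector set" and t s :: "'m::finite \<Rightarrow> 'f \<Rightarrow> 'f" and r :: real
  assumes A: "subspace A"
    and t: "lin_on A A (t i)" and s: "lin_on A A (s i)"
    and tt: "\<phi> \<in> A \<Longrightarrow> t i (t j \<phi>) = t j (t i \<phi>)"
    and ss: "\<phi> \<in> A \<Longrightarrow> s i (s j \<phi>) = s j (s i \<phi>)"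
    and st: "\<phi> \<in> A \<Longrightarrow> s i (t l \<phi>) = t l (s i \<phi>) + (if i = l then r *\<^sub>R \<phi> else 0)"
begin

lemma lin_foldr:
  assumes "\<And>i. lin_on A A (f i)"
  shows "lin_on A A (foldr f w)"
  using assms by (induction w) (simp_all add: lin_on_def)

lemmas tw = lin_foldr[OF t] and sw = lin_foldr[OF s]

lemmas closed = lin_on_closed[OF t] lin_on_closed[OF s] lin_on_closed[OF tw] lin_on_closed[OF sw]
  subspace_add[OF A] subspace_scale[OF A] subspace_sum[OF A] subspace_diff[OF A] subspace_0[OF A]

lemma foldr_commute:
  assumes "\<And>i. lin_on A A (f i)" "\<And>i j \<phi>. \<phi> \<in> A \<Longrightarrow> f i (f j \<phi>) = f j (f i \<phi>)" "\<phi> \<in> A"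
  shows "foldr f w (f i \<phi>) = f i (foldr f w \<phi>)"
  by (rule foldr_commute_on[of A f, OF lin_on_closed[OF assms(1)] assms(2,3)])

definition number :: "'f \<Rightarrow> 'f" where
  "number \<phi> = (\<Sum>i\<in>UNIV. t i (s i \<phi>))"

text \<open>The normally ordered power of the number operator: in the model where \<open>t\<^sub>i\<close> is
multiplication by \<open>y\<^sub>i\<close> and \<open>s\<^sub>i\<close> is \<open>r \<partial>/\<partial>y\<^sub>i\<close>, it is \<open>N (N - r) \<dots> (N - (n - 1) r)\<close>. The recurrence
\<open>U_number\<close> expresses this.\<close>

definition U :: "nat \<Rightarrow> 'f \<Rightarrow> 'f" where
  "U n \<phi> = (\<Sum>w\<in>words n. foldr t w (foldr s w \<phi>))"

lemma lin_number: "lin_on A A number"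
  unfolding lin_on_def number_def
  by (auto simp: closed lin_on_add[OF s] lin_on_add[OF t] lin_on_scaleR[OF s] lin_on_scaleR[OF t]
      sum.distrib scaleR_sum_right)

lemma lin_U: "lin_on A A (U n)"
  unfolding lin_on_def U_def
  by (auto simp: closed lin_on_add[OF sw] lin_on_add[OF tw] lin_on_scaleR[OF sw] lin_on_scaleR[OF tw]
      sum.distrib scaleR_sum_right)

lemma U_0 [simp]: "U 0 \<phi> = \<phi>"
  by (simp add: U_def)

lemma U_Suc:
  assumes "\<phi> \<in> A"
  shows "U (Suc n) \<phi> = (\<Sum>i\<in>UNIV. t i (U n (s i \<phi>)))"
  unfolding U_def sum_words_Suc
  by (simp add: foldr_commute[of s, OF s ss assms] lin_on_sum[OF A t] closed assms)

lemma number_t: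
  assumes "\<phi> \<in> A"
  shows "number (t i \<phi>) = t i (number \<phi>) + r *\<^sub>R t i \<phi>"
proof -
  have "number (t i \<phi>) = (\<Sum>l\<in>UNIV. t l (t i (s l \<phi>)) + (if l = i then r *\<^sub>R t l \<phi> else 0))"
    unfolding number_def using assms
    by (intro sum.cong refl) (simp add: st lin_on_add[OF t] lin_on_scaleR[OF t] lin_on_zero[OF A t] closed)
  also have "\<dots> = t i (number \<phi>) + r *\<^sub>R t i \<phi>"
    unfolding number_def using assms
    by (simp add: sum.distrib lin_on_sum[OF A t] closed tt[of _ i])
  finally show ?thesis .
qed

lemma s_number:
  assumes "\<phi> \<in> A"
  shows "s i (number \<phi>) = number (s i \<phi>) + r *\<^sub>R s i \<phi>"
proof -
  have "s i (number \<phi>) = (\<Sum>l\<in>UNIV. t l (s l (s i \<phi>)) + (if l = i then r *\<^sub>R s l \<phi> else 0))"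
    unfolding number_def lin_on_sum[OF A s closed(1)[OF closed(2)[OF assms]]]
    using assms by (intro sum.cong refl) (simp add: st closed ss[of _ i])
  then show ?thesis by (simp add: number_def sum.distrib)
qed

lemma number_tw:
  assumes "\<phi> \<in> A"
  shows "number (foldr t w \<phi>) = foldr t w (number \<phi>) + (r * real (length w)) *\<^sub>R foldr t w \<phi>"
proof (induction w)
  case (Cons i w)
  have "number \<phi> \<in> A" by (rule lin_on_closed[OF lin_number assms])
  then show ?case
    using assms
    by (simp add: number_t closed Cons.IH lin_on_add[OF t] lin_on_scaleR[OF t] algebra_simps)
qed simp

lemma U_number:
  assumes "\<phi> \<in> A"
  shows "U n (number \<phi>) = U (Suc n) \<phi> + (r * real n) *\<^sub>R U n \<phi>"
  using assms
proof (induction n arbitrary: \<phi>)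
  case 0
  then show ?case by (simp add: U_Suc number_def)
next
  case (Suc n)
  note N = lin_on_closed[OF lin_number] and Un = lin_on_closed[OF lin_U]
  have "U (Suc n) (number \<phi>) = (\<Sum>i\<in>UNIV. t i (U n (number (s i \<phi>) + r *\<^sub>R s i \<phi>)))"
    using Suc.prems by (simp add: U_Suc N s_number)
  also have "\<dots> = (\<Sum>i\<in>UNIV. t i (U (Suc n) (s i \<phi>)) + (r * real (Suc n)) *\<^sub>R t i (U n (s i \<phi>)))"
  proof (intro sum.cong refl)
    fix i
    have "U n (number (s i \<phi>) + r *\<^sub>R s i \<phi>) = U (Suc n) (s i \<phi>) + (r * real (Suc n)) *\<^sub>R U n (s i \<phi>)"
      using Suc.prems
      by (simp add: lin_on_add[OF lin_U] lin_on_scaleR[OF lin_U] closed N Suc.IH algebra_simps)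
    then show "t i (U n (number (s i \<phi>) + r *\<^sub>R s i \<phi>)) =
        t i (U (Suc n) (s i \<phi>)) + (r * real (Suc n)) *\<^sub>R t i (U n (s i \<phi>))"
      using Suc.prems by (simp add: lin_on_add[OF t] lin_on_scaleR[OF t] closed Un)
  qed
  also have "\<dots> = U (Suc (Suc n)) \<phi> + (r * real (Suc n)) *\<^sub>R U (Suc n) \<phi>"
    using Suc.prems by (simp only: U_Suc[of \<phi>] sum.distrib scaleR_sum_right)
  finally show ?case .
qed

text \<open>A substitute for the order of a form that is visible to the algebra: \<open>t\<^sub>i\<close> raises it by at most one and
\<open>s\<^sub>i\<close> lowers it.\<close>

definition vanishes_above :: "nat \<Rightarrow> 'f \<Rightarrow> bool" where
  "vanishes_above p \<phi> \<longleftrightarrow> (\<forall>u. p < length u \<longrightarrow> foldr s u \<phi> = 0)"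

lemma vanishes_aboveD: "vanishes_above p \<phi> \<Longrightarrow> p < length u \<Longrightarrow> foldr s u \<phi> = 0"
  by (simp add: vanishes_above_def)

lemma vanishes_above_mono: "vanishes_above p \<phi> \<Longrightarrow> p \<le> q \<Longrightarrow> vanishes_above q \<phi>"
  by (simp add: vanishes_above_def)

lemma vanishes_above_sw: "vanishes_above p \<phi> \<Longrightarrow> vanishes_above (p - length w) (foldr s w \<phi>)"
  unfolding vanishes_above_def
proof (intro allI impI)
  fix u :: "'m list"
  assume "\<forall>u. p < length u \<longrightarrow> foldr s u \<phi> = 0" "p - length w < length u"
  then have "foldr s (u @ w) \<phi> = 0" by (simp del: foldr_append)
  then show "foldr s u (foldr s w \<phi>) = 0" by simp
qed

lemma vanishes_above_t:
  assumes "\<phi> \<in> A" "vanishes_above p \<phi>"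
  shows "vanishes_above (Suc p) (t i \<phi>)"
  using assms
proof (induction p arbitrary: \<phi>)
  case 0
  show ?case unfolding vanishes_above_def
  proof (intro allI impI)
    fix u :: "'m list" assume u: "Suc 0 < length u"
    then obtain u' j where uj: "u = u' @ [j]" by (metis length_greater_0_conv less_trans zero_less_Suc rev_exhaust)
    have "s j \<phi> = 0" using vanishes_aboveD[OF 0(2), of "[j]"] by simp
    moreover have "foldr s u' \<phi> = 0" using vanishes_aboveD[OF 0(2), of u'] u uj by simp
    ultimately show "foldr s u (t i \<phi>) = 0"
      using 0 by (simp add: uj st lin_on_zero[OF A t] lin_on_scaleR[OF sw] lin_on_zero[OF A sw])
  qed
next
  case (Suc p)
  show ?case unfolding vanishes_above_def
  proof (intro allI impI)
    fix u :: "'m list" assume u: "Suc (Suc p) < length u"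
    then obtain u' j where uj: "u = u' @ [j]" by (metis length_0_conv not_less_zero rev_exhaust)
    have "vanishes_above p (s j \<phi>)" using vanishes_above_sw[OF Suc.prems(2), of "[j]"] by simp
    then have "vanishes_above (Suc p) (t i (s j \<phi>))" by (rule Suc.IH[OF closed(2)[OF Suc.prems(1)]])
    then have "foldr s u' (t i (s j \<phi>)) = 0" using vanishes_aboveD u uj by simp
    moreover have "foldr s u' \<phi> = 0" using vanishes_aboveD[OF Suc.prems(2), of u'] u uj by simp
    ultimately show "foldr s u (t i \<phi>) = 0"
      using Suc.prems by (simp add: uj st lin_on_add[OF sw] lin_on_scaleR[OF sw] lin_on_zero[OF A sw] closed)
  qed
qed

lemma vanishes_above_tw:
  assumes "\<phi> \<in> A" "vanishes_above p \<phi>"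
  shows "vanishes_above (p + length w) (foldr t w \<phi>)"
  by (induction w) (simp_all add: assms vanishes_above_t closed)

lemma vanishes_above_sum:
  assumes "\<And>a. a \<in> F \<Longrightarrow> f a \<in> A" "\<And>a. a \<in> F \<Longrightarrow> vanishes_above p (f a)"
  shows "vanishes_above p (\<Sum>a\<in>F. f a)"
  using assms unfolding vanishes_above_def by (simp add: lin_on_sum[OF A sw])

lemma vanishes_above_scaleR:
  "\<phi> \<in> A \<Longrightarrow> vanishes_above p \<phi> \<Longrightarrow> vanishes_above p (c *\<^sub>R \<phi>)"
  unfolding vanishes_above_def by (simp add: lin_on_scaleR[OF sw])

lemma vanishes_above_diff:
  "\<phi> \<in> A \<Longrightarrow> \<psi> \<in> A \<Longrightarrow> vanishes_above p \<phi> \<Longrightarrow> vanishes_above p \<psi> \<Longrightarrow> vanishes_above p (\<phi> - \<psi>)"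
  unfolding vanishes_above_def by (simp add: lin_on_diff[OF A sw])

lemma U_vanishes: "vanishes_above p \<phi> \<Longrightarrow> p < n \<Longrightarrow> U n \<phi> = 0"
  unfolding U_def by (rule sum.neutral) (simp add: vanishes_aboveD words_length lin_on_zero[OF A tw])

end

section \<open>Inverting P on two-forms\<close>

lemma triangle_sum_eq:
  fixes f :: "nat \<Rightarrow> nat \<Rightarrow> 'a::comm_monoid_add"
  assumes "k \<le> M" "\<And>n q. k \<le> n + q \<Longrightarrow> f n q = 0"
  shows "(\<Sum>n<M. \<Sum>q<k. f n q) = (\<Sum>N<k. \<Sum>n\<le>N. f n (N - n))"
proof -
  have "(\<Sum>n<M. \<Sum>q<k. f n q) = (\<Sum>(n, q)\<in>{..<M} \<times> {..<k}. f n q)"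
    by (simp add: sum.cartesian_product)
  also have "\<dots> = (\<Sum>(n, q)\<in>{(n, q). n + q < k}. f n q)"
  proof (rule sum.mono_neutral_right)
    show "\<forall>p\<in>{..<M} \<times> {..<k} - {(n, q). n + q < k}. (case p of (n, q) \<Rightarrow> f n q) = 0"
    proof
      fix p assume "p \<in> {..<M} \<times> {..<k} - {(n, q). n + q < k}"
      then obtain n q where "p = (n, q)" "k \<le> n + q" by fastforce
      then show "(case p of (n, q) \<Rightarrow> f n q) = 0" using assms(2)[of n q] by simp
    qed
  qed (use assms(1) in auto)
  also have "\<dots> = (\<Sum>N<k. \<Sum>n\<le>N. f n (N - n))"
    by (rule sum.triangle_reindex)
  finally show ?thesis .
qed

text \<open>\<open>\<theta>coeff\<close> and \<open>Pcoeff\<close> are the coefficients of \<open>U\<^sub>n S\<^sup>j\<close> in the operator \<open>P\<^sup>j\<close> on one-forms (with \<open>s = m\<close>)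
and on two-forms (with \<open>s = m - 1\<close>). \<open>Ycoeff n q\<close> is the coefficient of \<open>V\<^bsub>n,q\<^esub>\<close> in \<open>Y\<close>; it is determined
by the recurrence expressed in \<open>Tcoeff_Suc\<close> and \<open>Ycoeff_Tcoeff\<close>, where \<open>Tcoeff\<close> makes the sum over \<open>n\<close>
telescope, and by \<open>Tcoeff_0\<close>.\<close>

definition \<theta>coeff :: "nat \<Rightarrow> real" where
  "\<theta>coeff n = (-1) ^ n / fact (n + 1)"

definition Pcoeff :: "nat \<Rightarrow> real" where
  "Pcoeff n = (-1) ^ n / (2 ^ (n + 1) * fact (n + 2))"

definition Ycoeff :: "nat \<Rightarrow> nat \<Rightarrow> real" where
  "Ycoeff n q = (-1) ^ (n + q) / (2 ^ (n + 1) * fact (n + q + 2))"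

definition Tcoeff :: "nat \<Rightarrow> nat \<Rightarrow> real" where
  "Tcoeff n q = (-1) ^ (n + q) / (2 ^ n * fact (n + q + 1))"

lemma Tcoeff_0: "Tcoeff 0 q = \<theta>coeff q"
  by (simp add: Tcoeff_def \<theta>coeff_def)

lemma Tcoeff_Suc: "Tcoeff (Suc n) q = - Ycoeff n q"
  by (simp add: Tcoeff_def Ycoeff_def)

lemma Ycoeff_Tcoeff: "Ycoeff n q * (2 * real (n + q) + 4) = Tcoeff n q"
proof -
  have cancel: "a / (2 * p * (m * F)) * (2 * m) = a / (p * F)" if "m \<noteq> 0" for a p m F :: real
    using that by simp
  have "2 * real (n + q) + 4 = 2 * real (n + q + 2)" by simp
  moreover have "fact (n + q + 2) = real (n + q + 2) * fact (n + q + 1)"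
    by (simp add: algebra_simps)
  ultimately show ?thesis
    unfolding Ycoeff_def Tcoeff_def using cancel[of "real (n + q + 2)"] by (simp only: power_add power_one_right mult.commute[of "2 ^ n" 2])
qed

text \<open>The final cancellation. The factor \<open>1 + 2\<^bsup>n+1\<^esup> + [q = 0]\<close> is the one which homogeneity produces; for \<open>q = 0\<close>,
that is \<open>n = N\<close>, the extra \<open>1\<close> makes up for the truncation of the geometric series \<open>\<Sum> 2\<^bsup>-n-1\<^esup>\<close>.\<close>

lemma sum_Ycoeff:
  "(\<Sum>n\<le>N. Ycoeff n (N - n) * (1 + 2 ^ (n + 1) + (if N - n = 0 then 1 else 0))) = \<theta>coeff N"
proof -
  have *: "(\<Sum>n\<le>N. (1 + 2 ^ (n + 1)) / 2 ^ (n + 1) :: real) = real N + 2 - 1 / 2 ^ (N + 1)"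
    by (induction N) (simp_all add: field_simps)
  have "(\<Sum>n\<le>N. Ycoeff n (N - n) * (1 + 2 ^ (n + 1) + (if N - n = 0 then 1 else 0))) =
      (\<Sum>n\<le>N. (-1) ^ N / fact (N + 2) * ((1 + 2 ^ (n + 1)) / 2 ^ (n + 1)) +
        (if n = N then (-1) ^ N / fact (N + 2) * (1 / 2 ^ (N + 1)) else 0))"
  proof (intro sum.cong refl)
    fix n assume "n \<in> {..N}"
    then have Y: "Ycoeff n (N - n) = (-1) ^ N / (2 ^ (n + 1) * fact (N + 2))" and 0: "N - n = 0 \<longleftrightarrow> n = N"
      by (auto simp: Ycoeff_def)
    have distrib: "a / (p * F) * (1 + p + e) = a / F * ((1 + p) / p) + a / F * (e / p)" for a p F e :: real
      by (simp add: add_divide_distrib distrib_left mult.commute)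
    show "Ycoeff n (N - n) * (1 + 2 ^ (n + 1) + (if N - n = 0 then 1 else 0)) =
      (-1) ^ N / fact (N + 2) * ((1 + 2 ^ (n + 1)) / 2 ^ (n + 1)) +
        (if n = N then (-1) ^ N / fact (N + 2) * (1 / 2 ^ (N + 1)) else 0)"
      unfolding Y distrib 0 by simp
  qed
  also have "\<dots> = (-1) ^ N / fact (N + 2) * ((\<Sum>n\<le>N. (1 + 2 ^ (n + 1)) / 2 ^ (n + 1)) + 1 / 2 ^ (N + 1))"
    by (simp add: sum.distrib sum_distrib_left distrib_left)
  also have "\<dots> = (-1) ^ N / fact (N + 2) * (real N + 2)"
    unfolding * by simp
  also have "\<dots> = \<theta>coeff N"
  proof -
    have "fact (N + 2) = (real N + 2) * fact (N + 1)" by (simp add: algebra_simps)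
    moreover have "a / (m * F) * m = a / F" if "m \<noteq> 0" for a m F :: real using that by simp
    moreover have "real N + 2 \<noteq> 0" by linarith
    ultimately show ?thesis by (simp only: \<theta>coeff_def)
  qed
  finally show ?thesis .
qed

text \<open>The algebraic core: one-forms \<open>A1\<close>, two-forms \<open>A2\<close>, the exterior derivative \<open>E\<close> between them and the
contractions \<open>\<iota>\<^sub>l\<close> with \<open>T\<^sub>l\<close>. The operators \<open>E\<close> and \<open>\<iota>\<^sub>l\<close> commute with \<open>t\<^sub>i\<close> but not with \<open>s\<^sub>i\<close>; the only
information about the latter failure is the last assumption.\<close>

locale form_calculus =
  one: weyl_action A1 t s 1 + two: weyl_action A2 t s 2
  for A1 A2 :: "'f::real_vector set" and t s :: "'m::finite \<Rightarrow> 'f \<Rightarrow> 'f" +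
  fixes E :: "'f \<Rightarrow> 'f" and \<iota> :: "'m \<Rightarrow> 'f \<Rightarrow> 'f" and dL :: 'f and k :: nat
  assumes E: "lin_on A1 A2 E" and E_t: "\<phi> \<in> A1 \<Longrightarrow> E (t i \<phi>) = t i (E \<phi>)"
    and \<iota>: "lin_on A2 A1 (\<iota> l)" and \<iota>_t: "\<phi> \<in> A2 \<Longrightarrow> \<iota> l (t i \<phi>) = t i (\<iota> l \<phi>)"
    and dL: "dL \<in> A1" and k: "1 \<le> k"
    and dL_vanishes: "one.vanishes_above k dL"
    and E_dL_vanishes: "two.vanishes_above (2 * k) (E (foldr s w dL))"
    and homogeneous: "l \<noteq> j \<Longrightarrow>
      \<iota> l (foldr s u (s l (E (foldr s w (s j dL))))) - \<iota> l (foldr s u (s j (E (foldr s w (s l dL))))) =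
        (1 + 2 ^ (length u + 1) + (if w = [] then 1 else 0)) *\<^sub>R foldr s u (foldr s w (s j dL))"
begin

lemma E_tw: "\<phi> \<in> A1 \<Longrightarrow> E (foldr t w \<phi>) = foldr t w (E \<phi>)"
  by (induction w) (simp_all add: E_t one.closed)

lemma \<iota>_tw: "\<phi> \<in> A2 \<Longrightarrow> \<iota> l (foldr t w \<phi>) = foldr t w (\<iota> l \<phi>)"
  by (induction w) (simp_all add: \<iota>_t two.closed)

definition \<theta> :: "'m \<Rightarrow> 'f" where
  "\<theta> j = (\<Sum>n<k. \<theta>coeff n *\<^sub>R one.U n (s j dL))"

text \<open>The operator \<open>P\<^sup>l\<close> on two-forms of order \<open>2k - 1\<close>, the order of \<open>d\<theta>\<^sup>j\<close>: there \<open>|J|\<close> takes the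
\<open>2(2k - 1)\<close> values below \<open>4k - 2\<close>.\<close>

definition P2 :: "'m \<Rightarrow> 'f \<Rightarrow> 'f" where
  "P2 l \<Phi> = (\<Sum>n<4 * k - 2. Pcoeff n *\<^sub>R two.U n (s l \<Phi>))"

text \<open>\<open>R q (s\<^sub>j dL)\<close> is \<open>E (U\<^sub>q s\<^sub>j dL)\<close>, and \<open>V 0 q l (s\<^sub>j dL)\<close> is what is left of \<open>s\<^sub>l\<close> applied to it after \<open>s\<^sub>l\<close> has been
moved past the total derivatives.\<close>

definition R :: "nat \<Rightarrow> 'f \<Rightarrow> 'f" where
  "R q \<mu> = (\<Sum>w\<in>words q. foldr t w (E (foldr s w \<mu>)))"

definition V :: "nat \<Rightarrow> nat \<Rightarrow> 'm \<Rightarrow> 'f \<Rightarrow> 'f" where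
  "V n q l \<mu> = (\<Sum>u\<in>words n. \<Sum>w\<in>words q. foldr t u (foldr t w (foldr s u (s l (E (foldr s w \<mu>))))))"

lemmas EA = lin_on_closed[OF E]

lemma R_in: "\<mu> \<in> A1 \<Longrightarrow> R q \<mu> \<in> A2"
  unfolding R_def by (intro two.closed EA one.closed)

lemma V_in: "\<mu> \<in> A1 \<Longrightarrow> V n q l \<mu> \<in> A2"
  unfolding V_def by (intro two.closed EA one.closed)

lemma R_Suc:
  assumes "\<mu> \<in> A1"
  shows "R (Suc q) \<mu> = (\<Sum>i\<in>UNIV. t i (R q (s i \<mu>)))"
  unfolding R_def sum_words_Suc
  by (simp add: one.foldr_commute[of s, OF one.s one.ss assms] lin_on_sum[OF two.A two.t] two.closed EA one.closed assms)

lemma V0_Suc: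
  assumes "\<mu> \<in> A1"
  shows "V 0 (Suc q) l \<mu> = (\<Sum>i\<in>UNIV. t i (V 0 q l (s i \<mu>)))"
  unfolding V_def sum_words_Suc
  by (simp add: one.foldr_commute[of s, OF one.s one.ss assms] lin_on_sum[OF two.A two.t] two.closed EA one.closed assms)

text \<open>The commutators contribute one equal term for each letter of the word. For \<open>\<mu> = s\<^sub>j dL\<close> their sum is
symmetric in \<open>l\<close> and \<open>j\<close>.\<close>

lemma s_R:
  assumes "\<mu> \<in> A1"
  shows "s l (R q \<mu>) = V 0 q l \<mu> + (2 * real q) *\<^sub>R R (q - 1) (s l \<mu>)"
  using assms
proof (induction q arbitrary: \<mu>)
  case 0
  then show ?case by (simp add: R_def V_def)
next
  case (Suc q)
  note \<mu> = one.closed(2)[OF Suc.prems]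
  have "s l (R (Suc q) \<mu>) = (\<Sum>i\<in>UNIV. s l (t i (R q (s i \<mu>))))"
    unfolding R_Suc[OF Suc.prems]
    by (rule lin_on_sum[OF two.A two.s]) (intro two.closed R_in \<mu>)
  also have "\<dots> = (\<Sum>i\<in>UNIV. t i (V 0 q l (s i \<mu>)) + (2 * real q) *\<^sub>R t i (R (q - 1) (s i (s l \<mu>))) +
      (if i = l then 2 *\<^sub>R R q (s l \<mu>) else 0))"
    by (intro sum.cong refl)
       (simp add: two.st R_in \<mu> Suc.IH lin_on_add[OF two.t] lin_on_scaleR[OF two.t] V_in two.closed
         one.closed one.ss[OF Suc.prems, of l])
  also have "\<dots> = V 0 (Suc q) l \<mu> + (2 * real q) *\<^sub>R (\<Sum>i\<in>UNIV. t i (R (q - 1) (s i (s l \<mu>)))) + 2 *\<^sub>R R q (s l \<mu>)"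
    by (simp add: sum.distrib V0_Suc[OF Suc.prems] scaleR_sum_right)
  also have "(2 * real q) *\<^sub>R (\<Sum>i\<in>UNIV. t i (R (q - 1) (s i (s l \<mu>)))) = (2 * real q) *\<^sub>R R q (s l \<mu>)"
    by (cases q) (simp_all add: R_Suc \<mu>)
  finally show ?case by (simp add: algebra_simps)
qed

lemma number_V:
  assumes "\<mu> \<in> A1"
  shows "two.number (V n q l \<mu>) = V (Suc n) q l \<mu> + (2 * real (n + q)) *\<^sub>R V n q l \<mu>"
proof -
  let ?\<psi> = "\<lambda>u w. foldr s u (s l (E (foldr s w \<mu>)))"
  have \<psi>: "?\<psi> u w \<in> A2" for u w by (intro two.closed EA one.closed assms)
  have 1: "two.number (foldr t u (foldr t w (?\<psi> u w))) =
      (\<Sum>i\<in>UNIV. t i (foldr t u (foldr t w (s i (?\<psi> u w))))) + (2 * real (n + q)) *\<^sub>R foldr t u (foldr t w (?\<psi> u w))"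
    if "u \<in> words n" "w \<in> words q" for u w
  proof -
    have "two.number (foldr t u (foldr t w (?\<psi> u w))) = two.number (foldr t (u @ w) (?\<psi> u w))" by simp
    also have "\<dots> = foldr t (u @ w) (two.number (?\<psi> u w)) + (2 * real (n + q)) *\<^sub>R foldr t (u @ w) (?\<psi> u w)"
      using that by (simp only: two.number_tw[OF \<psi>] length_append words_length)
    also have "foldr t (u @ w) (two.number (?\<psi> u w)) = (\<Sum>i\<in>UNIV. foldr t (u @ w) (t i (s i (?\<psi> u w))))"
      unfolding two.number_def by (rule lin_on_sum[OF two.A two.tw]) (intro two.closed \<psi>)
    also have "\<dots> = (\<Sum>i\<in>UNIV. t i (foldr t (u @ w) (s i (?\<psi> u w))))"
      by (intro sum.cong refl two.foldr_commute[of t, OF two.t two.tt] two.closed \<psi>)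
    finally show ?thesis by simp
  qed
  have "two.number (V n q l \<mu>) = (\<Sum>u\<in>words n. \<Sum>w\<in>words q. two.number (foldr t u (foldr t w (?\<psi> u w))))"
    unfolding V_def
    by (simp add: lin_on_sum[OF two.A two.lin_number] two.closed \<psi>)
  also have "\<dots> = (\<Sum>u\<in>words n. \<Sum>w\<in>words q. \<Sum>i\<in>UNIV. t i (foldr t u (foldr t w (s i (?\<psi> u w))))) +
      (2 * real (n + q)) *\<^sub>R V n q l \<mu>"
    using 1 by (simp add: sum.distrib V_def scaleR_sum_right)
  also have "(\<Sum>u\<in>words n. \<Sum>w\<in>words q. \<Sum>i\<in>UNIV. t i (foldr t u (foldr t w (s i (?\<psi> u w))))) =
      (\<Sum>u\<in>words n. \<Sum>i\<in>UNIV. \<Sum>w\<in>words q. t i (foldr t u (foldr t w (s i (?\<psi> u w)))))"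
    by (intro sum.cong refl sum.swap)
  also have "\<dots> = (\<Sum>i\<in>UNIV. \<Sum>u\<in>words n. \<Sum>w\<in>words q. t i (foldr t u (foldr t w (s i (?\<psi> u w)))))"
    by (rule sum.swap)
  also have "\<dots> = V (Suc n) q l \<mu>"
    unfolding V_def sum_words_Suc by simp
  finally show ?thesis .
qed

definition Vskew :: "nat \<Rightarrow> nat \<Rightarrow> 'm \<Rightarrow> 'm \<Rightarrow> 'f" where
  "Vskew n q l j = V n q l (s j dL) - V n q j (s l dL)"

definition Y :: "'m \<Rightarrow> 'm \<Rightarrow> 'f" where
  "Y l j = (\<Sum>n<2 * k. \<Sum>q<k. Ycoeff n q *\<^sub>R Vskew n q l j)"

lemma s_dL: "s j dL \<in> A1"
  by (rule one.closed(2)[OF dL])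

lemma Vskew_in: "Vskew n q l j \<in> A2"
  unfolding Vskew_def by (intro two.closed V_in s_dL)

lemma Y_in: "Y l j \<in> A2"
  unfolding Y_def by (intro two.closed Vskew_in)

lemma E_s_dL_vanishes: "two.vanishes_above (2 * k) (E (foldr s w (s j dL)))"
  using E_dL_vanishes[of "w @ [j]"] by simp

lemma Vskew_top: "Vskew (2 * k) q l j = 0"
proof -
  have "V (2 * k) q l (s j dL) = 0" for l j
    unfolding V_def
  proof (intro sum.neutral ballI)
    fix u w :: "'m list" assume "u \<in> words (2 * k)"
    then have "foldr s (u @ [l]) (E (foldr s w (s j dL))) = 0"
      by (intro two.vanishes_aboveD[OF E_s_dL_vanishes]) (simp add: words_length)
    then show "foldr t u (foldr t w (foldr s u (s l (E (foldr s w (s j dL)))))) = 0"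
      by (simp add: lin_on_zero[OF two.A two.tw])
  qed
  then show ?thesis by (simp add: Vskew_def)
qed

text \<open>The \<open>n + 1\<close> vertical contractions lower the order \<open>2k\<close> of the two-form before the \<open>n + q\<close> total derivatives
raise it again, so \<open>n\<close> drops out and \<open>q < k\<close> remains. The bound is less than the number \<open>4k - 2\<close> of terms
in \<open>P2\<close>.\<close>

lemma vanishes_Vskew:
  assumes "n < 2 * k" "q < k"
  shows "two.vanishes_above (3 * k - 2) (Vskew n q l j)"
proof -
  have "two.vanishes_above (3 * k - 2) (V n q l (s j dL))" for l j
    unfolding V_def
  proof (intro two.vanishes_above_sum two.closed EA one.closed dL)
    fix u w :: "'m list" assume uw: "u \<in> words n" "w \<in> words q"
    let ?\<psi> = "foldr s (u @ [l]) (E (foldr s w (s j dL)))"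
    have "two.vanishes_above (2 * k - length (u @ [l])) ?\<psi>"
      by (rule two.vanishes_above_sw[OF E_s_dL_vanishes])
    then have "two.vanishes_above (2 * k - length (u @ [l]) + length (u @ w)) (foldr t (u @ w) ?\<psi>)"
      by (rule two.vanishes_above_tw[rotated]) (intro two.closed EA one.closed dL)
    then have "two.vanishes_above (3 * k - 2) (foldr t (u @ w) ?\<psi>)"
      by (rule two.vanishes_above_mono) (use uw assms in \<open>simp add: words_length\<close>)
    then show "two.vanishes_above (3 * k - 2) (foldr t u (foldr t w (foldr s u (s l (E (foldr s w (s j dL)))))))"
      by simp
  qed
  then show ?thesis
    unfolding Vskew_def by (intro two.vanishes_above_diff V_in s_dL)
qed

lemma vanishes_Y: "two.vanishes_above (3 * k - 2) (Y l j)"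
  unfolding Y_def
  by (intro two.vanishes_above_sum two.vanishes_above_scaleR two.closed Vskew_in vanishes_Vskew) auto

lemma E_\<theta>: "E (\<theta> j) = (\<Sum>q<k. \<theta>coeff q *\<^sub>R R q (s j dL))"
proof -
  have "E (one.U q (s j dL)) = R q (s j dL)" for q
    unfolding one.U_def R_def
    by (simp add: lin_on_sum[OF one.A E] one.closed s_dL E_tw)
  then show ?thesis
    unfolding \<theta>_def
    by (simp add: lin_on_sum[OF one.A E] one.closed lin_on_closed[OF one.lin_U] s_dL lin_on_scaleR[OF E])
qed

lemma skew_s_E_\<theta>: "s l (E (\<theta> j)) - s j (E (\<theta> l)) = (\<Sum>q<k. \<theta>coeff q *\<^sub>R Vskew 0 q l j)"
proof -
  have "s l (E (\<theta> j)) = (\<Sum>q<k. \<theta>coeff q *\<^sub>R (V 0 q l (s j dL) + (2 * real q) *\<^sub>R R (q - 1) (s l (s j dL))))" for l j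
    unfolding E_\<theta>
    by (simp add: lin_on_sum[OF two.A two.s] two.closed R_in s_dL lin_on_scaleR[OF two.s] s_R)
  then show ?thesis
    unfolding Vskew_def one.ss[OF dL, of j l]
    by (simp add: one.ss[OF dL, of j l] sum_subtractf[symmetric] algebra_simps)
qed

lemma number_Y: "two.number (Y l j) + 4 *\<^sub>R Y l j = s l (E (\<theta> j)) - s j (E (\<theta> l))"
proof -
  have step: "Ycoeff n q *\<^sub>R two.number (Vskew n q l j) + 4 *\<^sub>R (Ycoeff n q *\<^sub>R Vskew n q l j) =
      Tcoeff n q *\<^sub>R Vskew n q l j - Tcoeff (Suc n) q *\<^sub>R Vskew (Suc n) q l j" for n q
  proof -
    have "two.number (Vskew n q l j) = Vskew (Suc n) q l j + (2 * real (n + q)) *\<^sub>R Vskew n q l j"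
      unfolding Vskew_def
      by (simp add: lin_on_diff[OF two.A two.lin_number] V_in s_dL number_V algebra_simps)
    then show ?thesis
      unfolding Tcoeff_Suc Ycoeff_Tcoeff[of n q, symmetric] by (simp add: algebra_simps)
  qed
  have "two.number (Y l j) + 4 *\<^sub>R Y l j =
      (\<Sum>n<2 * k. \<Sum>q<k. Ycoeff n q *\<^sub>R two.number (Vskew n q l j) + 4 *\<^sub>R (Ycoeff n q *\<^sub>R Vskew n q l j))"
    unfolding Y_def
    by (simp add: lin_on_sum[OF two.A two.lin_number] lin_on_scaleR[OF two.lin_number] two.closed Vskew_in
        sum.distrib scaleR_sum_right)
  also have "\<dots> = (\<Sum>q<k. \<Sum>n<2 * k. Tcoeff n q *\<^sub>R Vskew n q l j - Tcoeff (Suc n) q *\<^sub>R Vskew (Suc n) q l j)"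
    unfolding step by (rule sum.swap)
  also have "\<dots> = (\<Sum>q<k. \<theta>coeff q *\<^sub>R Vskew 0 q l j)"
  proof (intro sum.cong refl)
    fix q
    show "(\<Sum>n<2 * k. Tcoeff n q *\<^sub>R Vskew n q l j - Tcoeff (Suc n) q *\<^sub>R Vskew (Suc n) q l j) =
        \<theta>coeff q *\<^sub>R Vskew 0 q l j"
      using sum_lessThan_telescope'[of "\<lambda>n. Tcoeff n q *\<^sub>R Vskew n q l j" "2 * k"]
      by (simp add: Vskew_top Tcoeff_0)
  qed
  also have "\<dots> = s l (E (\<theta> j)) - s j (E (\<theta> l))"
    by (rule skew_s_E_\<theta>[symmetric])
  finally show ?thesis .
qed

text \<open>\<open>U\<^sub>n (N + 4) = U\<^bsub>n+1\<^esub> + 2(n + 2) U\<^sub>n\<close>, and the coefficients are such that consecutive terms cancel.\<close>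

lemma Pcoeff_inverse:
  assumes "\<phi> \<in> A2" "two.U M \<phi> = 0"
  shows "(\<Sum>n<M. Pcoeff n *\<^sub>R two.U n (two.number \<phi> + 4 *\<^sub>R \<phi>)) = \<phi>"
proof -
  have "Pcoeff n *\<^sub>R two.U n (two.number \<phi> + 4 *\<^sub>R \<phi>) =
      Tcoeff n 0 *\<^sub>R two.U n \<phi> - Tcoeff (Suc n) 0 *\<^sub>R two.U (Suc n) \<phi>" for n
  proof -
    have "two.U n (two.number \<phi> + 4 *\<^sub>R \<phi>) = two.U (Suc n) \<phi> + (2 * real (n + 0) + 4) *\<^sub>R two.U n \<phi>"
      using assms(1) by (simp add: lin_on_add[OF two.lin_U] lin_on_scaleR[OF two.lin_U]
          two.closed lin_on_closed[OF two.lin_number] two.U_number algebra_simps)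
    moreover have "Pcoeff n = Ycoeff n 0" by (simp add: Pcoeff_def Ycoeff_def)
    ultimately show ?thesis
      unfolding Tcoeff_Suc Ycoeff_Tcoeff[of n 0, symmetric] by (simp add: algebra_simps)
  qed
  then show ?thesis
    using sum_lessThan_telescope'[of "\<lambda>n. Tcoeff n 0 *\<^sub>R two.U n \<phi>" M]
    by (simp add: assms(2) Tcoeff_0 \<theta>coeff_def)
qed

lemma skew_P2: "P2 l (E (\<theta> j)) - P2 j (E (\<theta> l)) = Y l j"
proof -
  have \<theta>: "\<theta> j \<in> A1" for j
    unfolding \<theta>_def by (intro one.closed lin_on_closed[OF one.lin_U] s_dL)
  have "P2 l (E (\<theta> j)) - P2 j (E (\<theta> l)) = (\<Sum>n<4 * k - 2. Pcoeff n *\<^sub>R two.U n (s l (E (\<theta> j)) - s j (E (\<theta> l))))"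
    unfolding P2_def
    by (simp add: lin_on_diff[OF two.A two.lin_U] two.closed EA \<theta> sum_subtractf algebra_simps)
  also have "\<dots> = Y l j"
    unfolding number_Y[symmetric]
    by (rule Pcoeff_inverse[OF Y_in two.U_vanishes[OF vanishes_Y]]) (use k in simp)
  finally show ?thesis .
qed

text \<open>The contraction passes the total derivatives and turns \<open>V\<^bsub>n,q\<^esub>\<close>, skew-symmetrised, into a multiple of
\<open>U\<^bsub>n+q\<^esub> s\<^sub>j dL\<close>, as the words \<open>u\<close> and \<open>w\<close> concatenate.\<close>

theorem contraction_P2:
  assumes "l \<noteq> j"
  shows "\<iota> l (P2 l (E (\<theta> j)) - P2 j (E (\<theta> l))) = \<theta> j"
proof -
  let ?c = "\<lambda>n q. 1 + 2 ^ (n + 1) + (if q = 0 then 1 else 0) :: real"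
  have V: "\<iota> l (Vskew n q l j) = ?c n q *\<^sub>R one.U (n + q) (s j dL)" for n q
  proof -
    let ?\<psi> = "\<lambda>u w l j. foldr s u (s l (E (foldr s w (s j dL))))"
    have \<psi>: "?\<psi> u w l j \<in> A2" for u w l j by (intro two.closed EA one.closed dL)
    have contract_V: "\<iota> l (V n q l' (s j' dL)) =
        (\<Sum>u\<in>words n. \<Sum>w\<in>words q. foldr t u (foldr t w (\<iota> l (?\<psi> u w l' j'))))" for l' j'
      unfolding V_def by (simp add: lin_on_sum[OF two.A \<iota>] two.closed \<psi> \<iota>_tw)
    have "\<iota> l (Vskew n q l j) = (\<Sum>u\<in>words n. \<Sum>w\<in>words q.
        foldr t u (foldr t w (\<iota> l (?\<psi> u w l j))) - foldr t u (foldr t w (\<iota> l (?\<psi> u w j l))))"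
      unfolding Vskew_def lin_on_diff[OF two.A \<iota> V_in[OF s_dL] V_in[OF s_dL]] contract_V sum_subtractf ..
    also have "\<dots> = (\<Sum>u\<in>words n. \<Sum>w\<in>words q. ?c n q *\<^sub>R foldr t (u @ w) (foldr s (u @ w) (s j dL)))"
    proof (intro sum.cong refl)
      fix u w :: "'m list" assume uw: "u \<in> words n" "w \<in> words q"
      have mem: "\<iota> l (?\<psi> u w l' j') \<in> A1" for l' j' by (rule lin_on_closed[OF \<iota> \<psi>])
      have "foldr t u (foldr t w (\<iota> l (?\<psi> u w l j))) - foldr t u (foldr t w (\<iota> l (?\<psi> u w j l))) =
          foldr t (u @ w) (\<iota> l (?\<psi> u w l j) - \<iota> l (?\<psi> u w j l))"
        using lin_on_diff[OF one.A one.tw[where w = "u @ w"] mem[of l j] mem[of j l]]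
        by (simp only: foldr_append o_apply)
      also have "\<iota> l (?\<psi> u w l j) - \<iota> l (?\<psi> u w j l) = ?c n q *\<^sub>R foldr s (u @ w) (s j dL)"
        unfolding homogeneous[OF assms] using uw by (auto simp: words_def)
      finally show "foldr t u (foldr t w (\<iota> l (?\<psi> u w l j))) - foldr t u (foldr t w (\<iota> l (?\<psi> u w j l))) =
          ?c n q *\<^sub>R foldr t (u @ w) (foldr s (u @ w) (s j dL))"
        by (simp only: lin_on_scaleR[OF one.tw one.closed(4)[OF s_dL]])
    qed
    also have "\<dots> = ?c n q *\<^sub>R one.U (n + q) (s j dL)"
      unfolding one.U_def sum_words_add scaleR_sum_right ..
    finally show ?thesis .
  qed
  have U0: "one.U n (s j dL) = 0" if "k \<le> n" for n
    unfolding one.U_def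
  proof (intro sum.neutral ballI)
    fix w :: "'m list" assume "w \<in> words n"
    then have "foldr s (w @ [j]) dL = 0"
      using that by (intro one.vanishes_aboveD[OF dL_vanishes]) (simp add: words_length)
    then show "foldr t w (foldr s w (s j dL)) = 0"
      by (simp add: lin_on_zero[OF one.A one.tw])
  qed
  have "\<iota> l (Y l j) = (\<Sum>n<2 * k. \<Sum>q<k. (Ycoeff n q * ?c n q) *\<^sub>R one.U (n + q) (s j dL))"
    unfolding Y_def
    by (simp only: lin_on_sum[OF two.A \<iota>] two.closed Vskew_in lin_on_scaleR[OF \<iota>] V scaleR_scaleR)
  also have "\<dots> = (\<Sum>N<k. \<Sum>n\<le>N. (Ycoeff n (N - n) * ?c n (N - n)) *\<^sub>R one.U (n + (N - n)) (s j dL))"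
    by (rule triangle_sum_eq) (simp_all add: U0)
  also have "\<dots> = (\<Sum>N<k. (\<Sum>n\<le>N. Ycoeff n (N - n) * ?c n (N - n)) *\<^sub>R one.U N (s j dL))"
    unfolding scaleR_sum_left by (intro sum.cong refl) simp
  also have "\<dots> = \<theta> j"
    unfolding sum_Ycoeff \<theta>_def ..
  finally show ?thesis by (simp only: skew_P2)
qed

end

section \<open>Homogeneous Lagrangians\<close>

abbreviation vert_word :: "'m list \<Rightarrow> ('m::finite, 'n::finite) jet \<Rightarrow> ('m, 'n) jet" where
  "vert_word w \<equiv> foldr vert_endo w"

lemma vert_word_permute: "mset u = mset w \<Longrightarrow> vert_word u X = vert_word w X"
  by (rule foldr_permute_on[of UNIV vert_endo]) (simp_all add: vert_endo_commute)

lemma vert_word_commute: "vert_word w (vert_endo i X) = vert_endo i (vert_word w X)"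
  by (rule foldr_commute_on[of UNIV vert_endo]) (simp_all add: vert_endo_commute)

lemma linear_vert_word: "linear (vert_word w)"
proof (induction w)
  case Nil
  show ?case by (simp add: linear_iff)
next
  case (Cons i w)
  show ?case using linear_compose[OF Cons.IH linear_vert_endo[of i]] by (simp add: o_def)
qed

text \<open>Multiplication by a monomial of degree \<open>n\<close> kills the Taylor coefficients of order less than \<open>n\<close>.\<close>

lemma vert_word_low_order:
  "mi_size J < length w \<Longrightarrow> vert_word w X J = 0"
proof (induction w arbitrary: J)
  case (Cons i w)
  show ?case
  proof (cases "J $ i = 0")
    case False
    then have "J = (J - axis i (Suc 0)) + axis i (Suc 0)" by (auto simp: vec_eq_iff axis_def)
    then have "mi_size J = mi_size (J - axis i (Suc 0)) + 1" using mi_size_add by (metis One_nat_def mi_size_axis)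
    then have "vert_word w X (J - axis i (Suc 0)) = 0" using Cons.prems by (intro Cons.IH) simp
    then show ?thesis by (simp add: vert_endo_def[of i "vert_word w X"])
  qed (simp add: vert_endo_def[of i "vert_word w X"])
qed simp

text \<open>In terms of Taylor series: \<open>\<partial>\<^sub>l(t\<^sup>w \<xi>) = t\<^sup>w \<partial>\<^sub>l\<xi> + (\<partial>\<^sub>l t\<^sup>w) \<xi>\<close>.\<close>

lemma total_vert_word:
  "total_deriv l (vert_word w X) =
     vert_word w (total_deriv l X) + real (count_list w l) *\<^sub>R vert_word (remove1 l w) X"
proof (induction w)
  case (Cons i w)
  have split: "total_deriv l (vert_endo i Y) = vert_endo i (total_deriv l Y) + (if i = l then Y else 0)"
    for Y :: "('a, 'b) jet"
    using total_vert_commutator[of l i Y] by (simp add: algebra_simps)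
  have "total_deriv l (vert_word (i # w) X) =
      vert_word (i # w) (total_deriv l X) + real (count_list w l) *\<^sub>R vert_endo i (vert_word (remove1 l w) X) +
      (if i = l then vert_word w X else 0)"
    by (simp only: foldr.simps o_apply split Cons.IH linear_add[OF linear_vert_endo] linear_cmul[OF linear_vert_endo])
  also have "\<dots> = vert_word (i # w) (total_deriv l X) +
      real (count_list (i # w) l) *\<^sub>R vert_word (remove1 l (i # w)) X"
  proof (cases "i = l")
    case True
    have "real (count_list w l) *\<^sub>R vert_endo l (vert_word (remove1 l w) X) = real (count_list w l) *\<^sub>R vert_word w X"
    proof (cases "l \<in> set w")
      case True
      then have "vert_word (l # remove1 l w) X = vert_word w X" by (intro vert_word_permute) simp
      then show ?thesis by simp
    qed (simp add: count_list_0_iff)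
    with True show ?thesis by (simp add: algebra_simps)
  qed simp
  finally show ?case .
qed simp

lemma foldr_vert_form_single: "foldr vert_form w \<phi> x [X] = \<phi> x [vert_word w X]"
proof (induction w arbitrary: X)
  case (Cons i w)
  show ?case by (simp add: vert_form_eq_slot slot_single) (simp add: vert_form_eq_slot[symmetric] Cons.IH vert_word_commute)
qed simp

context jet_region
begin

lemma forms_foldr_vert: "\<phi> \<in> forms r \<Longrightarrow> foldr vert_form w \<phi> \<in> forms r"
  by (rule foldr_closed_on[OF forms_vert])

lemma vert_word_vanishes_form1:
  assumes \<phi>: "form_order K 1 \<phi>" and "K < length w"
  shows "foldr vert_form w \<phi> = 0"
proof (rule forms1_eqI)
  show "foldr vert_form w \<phi> \<in> forms 1" by (rule forms_foldr_vert[OF formsI[OF \<phi>]])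
  show "0 \<in> forms 1" by (rule subspace_0[OF subspace_forms])
  fix x and Y :: "('m, 'n) jet" assume x: "x \<in> W"
  have "agree K (vert_word w Y) 0"
    using vert_word_low_order[of _ w Y] \<open>K < length w\<close> by (simp add: agree_def)
  then have "\<phi> x [vert_word w Y] = 0"
    by (rule covector_field_agree[OF form1_covector_field[OF \<phi>] x])
  then show "foldr vert_form w \<phi> x [Y] = 0 x [Y]"
    by (simp add: foldr_vert_form_single)
qed

text \<open>Each letter of \<open>w\<close> acts on one of the two arguments, so one of them receives more than \<open>K\<close> letters.\<close>

lemma vert_word_vanishes_form2:
  assumes \<phi>: "form_order K 2 \<phi>" and "2 * K < length w"
  shows "foldr vert_form w \<phi> = 0"
proof (rule forms2_eqI)
  show "foldr vert_form w \<phi> \<in> forms 2" by (rule forms_foldr_vert[OF formsI[OF \<phi>]])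
  show "0 \<in> forms 2" by (rule subspace_0[OF subspace_forms])
  fix x X Y assume x: "x \<in> W"
  have "foldr vert_form w \<phi> x [vert_word u X, vert_word v Y] = 0"
    if "2 * K < length w + length u + length v" for u v
    using that
  proof (induction w arbitrary: u v)
    case Nil
    then have "K < length u \<or> K < length v" by auto
    then have "agree K (vert_word u X) 0 \<or> agree K (vert_word v Y) 0"
      using vert_word_low_order[of _ u X] vert_word_low_order[of _ v Y] by (auto simp: agree_def)
    then show ?case
      using covector_field_agree[OF form2_covector_field(1)[OF \<phi>] x]
        covector_field_agree[OF form2_covector_field(2)[OF \<phi>] x] by auto
  next
    case (Cons i w)
    have "foldr vert_form w \<phi> x [vert_word (i # u) X, vert_word v Y] = 0"
      "foldr vert_form w \<phi> x [vert_word u X, vert_word (i # v) Y] = 0"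
      using Cons.prems by (intro Cons.IH; simp)+
    then show ?case
      by (simp add: vert_form_eq_slot[of i] slot_pair)
  qed
  from this[of "[]" "[]"] show "foldr vert_form w \<phi> x [X, Y] = 0 x [X, Y]"
    using assms(2) by simp
qed

lemma weyl_forms: "weyl_action (forms r) tot vert_form (real r)"
proof
  show "lin_on (forms r) (forms r) (tot i)" for i
    unfolding lin_on_def by (simp add: forms_tot tot_add tot_scaleR)
  show "lin_on (forms r) (forms r) (vert_form i)" for i
    unfolding lin_on_def by (simp add: forms_vert vert_form_eq_slot[of i] slot_add slot_scaleR)
       (simp add: forms_vert vert_form_eq_slot[of i, symmetric])
qed (simp_all add: subspace_forms tot_commute vert_commute vert_tot)

end

text \<open>The fundamental vector \<open>\<Delta>\<^sup>K\<^sub>j\<close> is \<open>S\<^sup>w T\<^sub>j\<close> for any word \<open>w\<close> in which each \<open>i\<close> occurs \<open>K(i)\<close> times, so the two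
homogeneity conditions become one.\<close>

locale homogeneous_lagrangian = jet_region W
  for W :: "('m::{finite,linorder}, 'n::finite) jet set" +
  fixes L :: "('m, 'n) jet \<Rightarrow> real" and k :: nat
  assumes smooth_L: "smooth_order k L"
    and homogeneous_L: "x \<in> W \<Longrightarrow> w \<noteq> [] \<Longrightarrow>
      dir_deriv (vert_word w (total_deriv j x)) L x = (if w = [j] then L x else 0)"
begin

definition dL :: "('m, 'n) form" where
  "dL = ed (fun_form L)"

lemma form_order_dL: "form_order k 1 dL"
  unfolding dL_def by (rule form_order_differential[OF smooth_L])

lemma dL_single: "x \<in> W \<Longrightarrow> dL x [X] = dir_deriv X L x"
  by (simp add: dL_def ed_def ext_d_single fun_form_def)

lemma linear_dL: "x \<in> W \<Longrightarrow> linear (\<lambda>X. dL x [X])"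
  by (rule covector_field_linear[OF form1_covector_field[OF form_order_dL]])

abbreviation hess :: "('m, 'n) jet \<Rightarrow> ('m, 'n) jet \<Rightarrow> ('m, 'n) jet \<Rightarrow> real" where
  "hess x X Y \<equiv> dir_deriv X (\<lambda>y. dL y [Y]) x"

lemma hess_commute:
  assumes x: "x \<in> W"
  shows "hess x X Y = hess x Y X"
proof -
  have "hess x X Y = dir_deriv X (dir_deriv Y L) x" for X Y
    by (rule dir_deriv_cong_W[OF x]) (simp add: dL_single)
  then show ?thesis using dir_deriv_commute[OF smooth_L x] by simp
qed

text \<open>The derivative in the direction \<open>Z\<close> of the homogeneity condition \<open>dL(S\<^sup>w T\<^sub>l x) = \<delta> L(x)\<close>.\<close>

lemma hess_fundamental:
  assumes x: "x \<in> W" and "w \<noteq> []"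
  shows "hess x Z (vert_word w (total_deriv l x)) =
     (if w = [l] then dL x [Z] else 0) - dL x [vert_word w (total_deriv l Z)]"
proof -
  have lin: "linear (\<lambda>y :: ('m, 'n) jet. vert_word w (total_deriv l y))"
    using linear_compose[OF linear_total_deriv linear_vert_word] by (simp add: o_def)
  have "dir_deriv Z (\<lambda>y. dL y [vert_word w (total_deriv l y)]) x =
      hess x Z (vert_word w (total_deriv l x)) + dL x [vert_word w (total_deriv l Z)]"
    by (rule covector_field_deriv_pairing[OF form1_covector_field[OF form_order_dL] lin x])
  moreover have "dir_deriv Z (\<lambda>y. dL y [vert_word w (total_deriv l y)]) x =
      dir_deriv Z (\<lambda>y. if w = [l] then L y else 0) x"
    by (rule dir_deriv_cong_W[OF x]) (use homogeneous_L[OF _ \<open>w \<noteq> []\<close>] in \<open>simp add: dL_single\<close>)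
  moreover have "dir_deriv Z (\<lambda>y. if w = [l] then L y else 0) x = (if w = [l] then dL x [Z] else 0)"
    by (simp add: dL_single[OF x])
  ultimately show ?thesis by simp
qed

lemma ed_vert_dL:
  assumes "x \<in> W"
  shows "ed (foldr vert_form w dL) x [X, Y] = hess x X (vert_word w Y) - hess x Y (vert_word w X)"
  using assms by (simp add: ed_pair foldr_vert_form_single)

text \<open>For empty \<open>u\<close>, both Hessian terms of \<open>d(S\<^sup>w dL)\<close> are given by \<open>hess_fundamental\<close>, and the
difference of the resulting first-order terms is a commutator of \<open>T\<^sub>l\<close> with \<open>S\<^sup>w\<close>. A further letter of \<open>u\<close>
acts on either argument: on the fundamental vector it lengthens \<open>v\<close>, on \<open>Y\<close> it lengthens the word there.
Both contribute the same multiple of the second term, hence the power of \<open>2\<close>.\<close>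

lemma fundamental_contraction:
  assumes x: "x \<in> W" and "w \<noteq> []" "v \<noteq> []"
  shows "foldr vert_form u (ed (foldr vert_form w dL)) x [vert_word v (total_deriv l x), Y] =
     (if v = [l] then dL x [vert_word (u @ w) Y] else 0) -
     2 ^ length u * real (count_list w l) * dL x [vert_word (u @ v @ remove1 l w) Y]"
  using \<open>v \<noteq> []\<close>
proof (induction u arbitrary: v Y)
  case Nil
  note lin = linear_add[OF linear_dL[OF x]] linear_cmul[OF linear_dL[OF x]]
  have "hess x (vert_word v (total_deriv l x)) (vert_word w Y) =
      (if v = [l] then dL x [vert_word w Y] else 0) - dL x [vert_word v (total_deriv l (vert_word w Y))]"
    unfolding hess_commute[OF x, of "vert_word v (total_deriv l x)"] by (rule hess_fundamental[OF x Nil])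
  also have "dL x [vert_word v (total_deriv l (vert_word w Y))] =
      dL x [vert_word (w @ v) (total_deriv l Y)] +
      real (count_list w l) * dL x [vert_word (v @ remove1 l w) Y]"
    using vert_word_permute[of "v @ w" "w @ v" "total_deriv l Y"]
    by (simp add: total_vert_word linear_add[OF linear_vert_word] linear_cmul[OF linear_vert_word] lin)
  finally have 1: "hess x (vert_word v (total_deriv l x)) (vert_word w Y) =
      (if v = [l] then dL x [vert_word w Y] else 0) - (dL x [vert_word (w @ v) (total_deriv l Y)] +
      real (count_list w l) * dL x [vert_word (v @ remove1 l w) Y])" .
  have 2: "hess x Y (vert_word (w @ v) (total_deriv l x)) = - dL x [vert_word (w @ v) (total_deriv l Y)]"
    using hess_fundamental[OF x, of "w @ v" Y l] Nil \<open>w \<noteq> []\<close>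
    by (cases w; cases v) auto
  show ?case
    using 1 2 by (simp add: ed_vert_dL[OF x])
next
  case (Cons i u)
  let ?\<Phi> = "foldr vert_form u (ed (foldr vert_form w dL))"
  have "foldr vert_form (i # u) (ed (foldr vert_form w dL)) x [vert_word v (total_deriv l x), Y] =
      ?\<Phi> x [vert_word (i # v) (total_deriv l x), Y] + ?\<Phi> x [vert_word v (total_deriv l x), vert_endo i Y]"
    by (simp add: vert_form_eq_slot[of i] slot_pair)
  also have "?\<Phi> x [vert_word (i # v) (total_deriv l x), Y] =
      - (2 ^ length u * real (count_list w l) * dL x [vert_word (i # u @ v @ remove1 l w) Y])"
    using Cons.IH[of "i # v" Y] Cons.prems
      vert_word_permute[of "u @ (i # v) @ remove1 l w" "i # u @ v @ remove1 l w" Y] by simp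
  also have "?\<Phi> x [vert_word v (total_deriv l x), vert_endo i Y] =
      (if v = [l] then dL x [vert_word (i # u @ w) Y] else 0) -
     2 ^ length u * real (count_list w l) * dL x [vert_word (i # u @ v @ remove1 l w) Y]"
    using Cons.IH[OF Cons.prems, of "vert_endo i Y"] vert_word_commute[of "u @ w" i Y]
      vert_word_commute[of "u @ v @ remove1 l w" i Y] by (simp del: foldr_append)
  finally show ?case by simp
qed

text \<open>The same induction for \<open>T\<^sub>l\<close> itself, where homogeneity says nothing about the Hessian term; that term
depends only on the letters of \<open>u\<close> and \<open>w\<close> taken together.\<close>

lemma total_contraction:
  assumes x: "x \<in> W" and w: "w \<noteq> []"
  shows "foldr vert_form u (ed (foldr vert_form w dL)) x [total_deriv l x, Y] =
     hess x (total_deriv l x) (vert_word (u @ w) Y) + dL x [vert_word (u @ w) (total_deriv l Y)] +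
     2 * real (count_list u l) * dL x [vert_word (remove1 l u @ w) Y] +
     (1 - 2 ^ length u) * real (count_list w l) * dL x [vert_word (u @ remove1 l w) Y] -
     (if w = [l] then dL x [vert_word u Y] else 0)"
proof (induction u arbitrary: Y)
  case Nil
  then show ?case
    by (simp add: ed_vert_dL[OF x] hess_fundamental[OF x w])
next
  case (Cons i u)
  let ?\<Phi> = "foldr vert_form u (ed (foldr vert_form w dL))"
  note lin = linear_add[OF linear_dL[OF x]] linear_add[OF linear_vert_word]
  have comm: "vert_word v (vert_endo i Y) = vert_word (i # v) Y" for v and Y :: "('m, 'n) jet"
    by (simp add: vert_word_commute)
  have 1: "?\<Phi> x [vert_word [i] (total_deriv l x), Y] = (if i = l then dL x [vert_word (u @ w) Y] else 0) -
      2 ^ length u * real (count_list w l) * dL x [vert_word (i # u @ remove1 l w) Y]"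
    using fundamental_contraction[OF x w, of "[i]" u l Y]
      vert_word_permute[of "u @ [i] @ remove1 l w" "i # u @ remove1 l w" Y] by (simp del: foldr_append)
  have zero: "dL x [vert_word v (if i = l then Y else 0)] = (if i = l then dL x [vert_word v Y] else 0)" for v
    by (simp add: linear_0[OF linear_dL[OF x]] linear_0[OF linear_vert_word])
  have "total_deriv l (vert_endo i Y) = vert_endo i (total_deriv l Y) + (if i = l then Y else 0)"
    using total_vert_commutator[of l i Y] by (simp add: algebra_simps)
  then have T: "dL x [vert_word (u @ w) (total_deriv l (vert_endo i Y))] =
      dL x [vert_word (i # u @ w) (total_deriv l Y)] + (if i = l then dL x [vert_word (u @ w) Y] else 0)"
    by (simp only: lin comm zero)
  have R: "real (count_list (i # u) l) * dL x [vert_word (remove1 l (i # u) @ w) Y] =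
      real (count_list u l) * dL x [vert_word (i # remove1 l u @ w) Y] +
      (if i = l then dL x [vert_word (u @ w) Y] else 0)"
  proof (cases "i = l")
    case True
    have "real (count_list u l) * dL x [vert_word (l # remove1 l u @ w) Y] =
        real (count_list u l) * dL x [vert_word (u @ w) Y]"
    proof (cases "l \<in> set u")
      case True
      then have "mset (l # remove1 l u @ w) = mset (u @ w)" by simp
      then show ?thesis by (metis vert_word_permute)
    qed (simp add: count_list_0_iff)
    with True show ?thesis by (auto simp: algebra_simps simp del: foldr_append foldr.simps)
  qed (simp del: foldr_append foldr.simps)
  have "foldr vert_form (i # u) (ed (foldr vert_form w dL)) x [total_deriv l x, Y] =
      ?\<Phi> x [vert_word [i] (total_deriv l x), Y] + ?\<Phi> x [total_deriv l x, vert_endo i Y]"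
    by (simp add: vert_form_eq_slot[of i] slot_pair)
  also have "\<dots> = hess x (total_deriv l x) (vert_word (i # u @ w) Y) +
      dL x [vert_word (i # u @ w) (total_deriv l Y)] +
      2 * (real (count_list (i # u) l) * dL x [vert_word (remove1 l (i # u) @ w) Y]) +
      (1 - 2 ^ length (i # u)) * real (count_list w l) * dL x [vert_word (i # u @ remove1 l w) Y] -
      (if w = [l] then dL x [vert_word (i # u) Y] else 0)"
    unfolding 1 Cons.IH T comm R by (simp add: algebra_simps del: foldr_append foldr.simps)
  finally show ?case by (simp only: append_Cons mult.assoc)
qed

lemma dL_vert_word_permute: "mset u = mset w \<Longrightarrow> dL x [vert_word u Y] = dL x [vert_word w Y]"
  using vert_word_permute by metis

text \<open>In the difference, the Hessian terms of \<open>total_contraction\<close> cancel since the words \<open>u l w j\<close> and \<open>u j w l\<close>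
have the same letters. Every remaining term is a multiple of \<open>S\<^sup>u S\<^sup>w S\<^sup>j dL\<close>: one occurrence of \<open>l\<close> is
removed from those letters. Only the number of occurrences of \<open>l\<close> in the two factors differs.\<close>

lemma homogeneity_relation:
  assumes "l \<noteq> j"
  shows "ct l (foldr vert_form u (vert_form l (ed (foldr vert_form w (vert_form j dL))))) -
      ct l (foldr vert_form u (vert_form j (ed (foldr vert_form w (vert_form l dL))))) =
    (1 + 2 ^ (length u + 1) + (if w = [] then 1 else 0)) *\<^sub>R foldr vert_form u (foldr vert_form w (vert_form j dL))"
proof (rule forms1_eqI)
  note dL = formsI[OF form_order_dL]
  show "ct l (foldr vert_form u (vert_form l (ed (foldr vert_form w (vert_form j dL))))) -
      ct l (foldr vert_form u (vert_form j (ed (foldr vert_form w (vert_form l dL))))) \<in> forms 1"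
    "(1 + 2 ^ (length u + 1) + (if w = [] then 1 else 0)) *\<^sub>R foldr vert_form u (foldr vert_form w (vert_form j dL)) \<in> forms 1"
    by (intro subspace_diff[OF subspace_forms] subspace_scale[OF subspace_forms] forms_ct forms_foldr_vert forms_vert
        forms_ed dL)+
  fix x Y assume x: "x \<in> W"
  define Z where "Z = dL x [vert_word (u @ w @ [j]) Y]"
  define H where "H = (\<lambda>v. hess x (total_deriv l x) (vert_word v Y) + dL x [vert_word v (total_deriv l Y)])"
  have eval: "ct l (foldr vert_form u (vert_form a (ed (foldr vert_form w (vert_form b dL))))) x [Y] =
      H (u @ a # w @ [b]) +
      2 * real (count_list (u @ [a]) l) * dL x [vert_word (remove1 l (u @ [a]) @ w @ [b]) Y] +
      (1 - 2 ^ (length u + 1)) * real (count_list (w @ [b]) l) * dL x [vert_word (u @ a # remove1 l (w @ [b])) Y] -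
      (if w @ [b] = [l] then dL x [vert_word (u @ [a]) Y] else 0)" for a b
    using total_contraction[OF x, of "w @ [b]" "u @ [a]" l Y] unfolding ct_single H_def by simp
  have word: "real (count_list v l) * dL x [vert_word v' Y] = real (count_list v l) * Z"
    if "l \<in> set v \<Longrightarrow> mset v' = mset (u @ w @ [j])" for v v'
  proof (cases "l \<in> set v")
    case True
    then show ?thesis unfolding Z_def using dL_vert_word_permute[OF that] by simp
  qed (simp add: count_list_0_iff)
  have 1: "ct l (foldr vert_form u (vert_form l (ed (foldr vert_form w (vert_form j dL))))) x [Y] =
      H (u @ l # w @ [j]) + 2 * ((real (count_list u l) + 1) * Z) +
      (1 - 2 ^ (length u + 1)) * (real (count_list w l) * Z)"
    unfolding eval mult.assoc
    using word[of "u @ [l]" "remove1 l (u @ [l]) @ w @ [j]"]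
      word[of "w @ [j]" "u @ l # remove1 l (w @ [j])"] \<open>l \<noteq> j\<close>
    by (cases w) (auto simp: add.commute)
  have "ct l (foldr vert_form u (vert_form j (ed (foldr vert_form w (vert_form l dL))))) x [Y] =
      H (u @ j # w @ [l]) + 2 * (real (count_list u l) * Z) +
      (1 - 2 ^ (length u + 1)) * ((real (count_list w l) + 1) * Z) - (if w = [] then 1 else 0) * Z"
    unfolding eval mult.assoc
    using word[of "u @ [j]" "remove1 l (u @ [j]) @ w @ [l]"]
      word[of "w @ [l]" "u @ j # remove1 l (w @ [l])"] \<open>l \<noteq> j\<close>
    by (cases w) (auto simp: Z_def add.commute)
  moreover have "H (u @ j # w @ [l]) = H (u @ l # w @ [j])"
  proof -
    have perm: "mset (u @ l # w @ [j]) = mset (u @ j # w @ [l])" by simp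
    show ?thesis unfolding H_def vert_word_permute[OF perm[symmetric]] ..
  qed
  ultimately have 2: "ct l (foldr vert_form u (vert_form j (ed (foldr vert_form w (vert_form l dL))))) x [Y] =
      H (u @ l # w @ [j]) + 2 * (real (count_list u l) * Z) +
      (1 - 2 ^ (length u + 1)) * ((real (count_list w l) + 1) * Z) - (if w = [] then 1 else 0) * Z"
    by (simp only:)
  have 3: "foldr vert_form u (foldr vert_form w (vert_form j dL)) x [Y] = Z"
    using foldr_vert_form_single[of "u @ w @ [j]" dL x Y] by (simp add: Z_def)
  have arith: "A - B = (1 + p + e) * z"
    if "A = h + 2 * ((a + 1) * z) + (1 - p) * (b * z)" "B = h + 2 * (a * z) + (1 - p) * ((b + 1) * z) - e * z"
    for A B h a b p e z :: real
    unfolding that by (simp add: algebra_simps)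
  show "(ct l (foldr vert_form u (vert_form l (ed (foldr vert_form w (vert_form j dL))))) -
      ct l (foldr vert_form u (vert_form j (ed (foldr vert_form w (vert_form l dL)))))) x [Y] =
    ((1 + 2 ^ (length u + 1) + (if w = [] then 1 else 0)) *\<^sub>R foldr vert_form u (foldr vert_form w (vert_form j dL))) x [Y]"
    unfolding scaleR_apply minus_apply 3 real_scaleR_def by (rule arith[OF 1 2])
qed

end

sublocale homogeneous_lagrangian \<subseteq> form_calculus "forms 1" "forms 2" tot vert_form ed ct dL k
proof -
  interpret one: weyl_action "forms 1" tot vert_form 1 using weyl_forms[of 1] by simp
  interpret two: weyl_action "forms 2" tot vert_form 2 using weyl_forms[of 2] by simp
  show "form_calculus (forms 1) (forms 2) tot vert_form ed ct dL k"
  proof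
    show "lin_on (forms 1) (forms 2) ed"
      unfolding lin_on_def by (intro conjI ballI allI forms_ed ed_add ed_scaleR)
    show "lin_on (forms 2) (forms 1) (ct l)" for l
      unfolding lin_on_def by (intro conjI ballI allI forms_ct ct_add ct_scaleR)
    show "ed (tot i \<phi>) = tot i (ed \<phi>)" if "\<phi> \<in> forms 1" for i \<phi> by (rule ed_tot[OF that])
    show "ct l (tot i \<phi>) = tot i (ct l \<phi>)" if "\<phi> \<in> forms 2" for l i \<phi> by (rule ct_tot[OF that])
    show "dL \<in> forms 1" by (rule formsI[OF form_order_dL])
    show "1 \<le> k" by (rule form_order_pos[OF form_order_dL])
    show "one.vanishes_above k dL"
      unfolding one.vanishes_above_def using vert_word_vanishes_form1[OF form_order_dL] by blast
    have order: "form_order k 1 (foldr vert_form w dL)" for w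
      by (induction w) (simp_all add: form_order_dL form_order_vert del: One_nat_def)
    show "two.vanishes_above (2 * k) (ed (foldr vert_form w dL))" for w
      unfolding two.vanishes_above_def using vert_word_vanishes_form2[OF form_order_ed[OF order]] by blast
    show "ct l (foldr vert_form u (vert_form l (ed (foldr vert_form w (vert_form j dL))))) -
      ct l (foldr vert_form u (vert_form j (ed (foldr vert_form w (vert_form l dL))))) =
    (1 + 2 ^ (length u + 1) + (if w = [] then 1 else 0)) *\<^sub>R foldr vert_form u (foldr vert_form w (vert_form j dL))"
      if "l \<noteq> j" for l j u w
      by (rule homogeneity_relation[OF that])
  qed
qed

section \<open>Multi-indices and words\<close>

definition count_mi :: "'m list \<Rightarrow> ('m::finite) mindex" where
  "count_mi w = (\<chi> i. count_list w i)"

lemma count_mi_Nil: "count_mi [] = 0"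
  by (simp add: count_mi_def vec_eq_iff)

lemma count_mi_Cons: "count_mi (i # w) = count_mi w + axis i (Suc 0)"
  by (simp add: count_mi_def vec_eq_iff axis_def)

lemma mi_size_count_mi: "mi_size (count_mi w) = length w"
  by (induction w) (simp_all add: count_mi_Nil count_mi_Cons mi_size_add, simp add: mi_size_def)

definition mi_word :: "('m::{finite,linorder}) mindex \<Rightarrow> 'm list" where
  "mi_word J = concat (map (\<lambda>i. replicate (J $ i) i) (sorted_list_of_set UNIV))"

lemma mi_iter_foldr: "mi_iter f J = foldr f (mi_word J)"
proof -
  have rep: "foldr f (replicate n i) = f i ^^ n" for n i
    by (induction n) simp_all
  have "foldr (\<lambda>i. f i ^^ (J $ i)) L = foldr f (concat (map (\<lambda>i. replicate (J $ i) i) L))" for L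
    by (induction L) (simp_all add: rep fun_eq_iff)
  then show ?thesis by (simp add: mi_iter_def mi_word_def)
qed

lemma mset_mi_word: "mset (mi_word (count_mi w)) = mset w"
proof (rule multiset_eqI)
  fix a
  have "count (mset (concat (map (\<lambda>i. replicate (g i) i) L))) a = (if a \<in> set L then g a else 0)"
    if "distinct L" for L and g :: "'a \<Rightarrow> nat"
    using that by (induction L) auto
  then show "count (mset (mi_word (count_mi w))) a = count (mset w) a"
    by (simp add: mi_word_def count_mi_def count_mset)
qed

lemma mi_iter_count_mi:
  assumes "\<And>i \<phi>. \<phi> \<in> A \<Longrightarrow> f i \<phi> \<in> A" "\<And>i j \<phi>. \<phi> \<in> A \<Longrightarrow> f i (f j \<phi>) = f j (f i \<phi>)" "\<phi> \<in> A"
  shows "mi_iter f (count_mi w) \<phi> = foldr f w \<phi>"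
  unfolding mi_iter_foldr by (rule foldr_permute_on[of A f, OF assms mset_mi_word])

lemma mi_fact_add_axis: "mi_fact (J + axis i (Suc 0)) = (J $ i + 1) * mi_fact J"
proof -
  have split: "mi_fact K = fact (K $ i) * (\<Prod>a\<in>UNIV - {i}. fact (K $ a))" for K :: "'a mindex"
    unfolding mi_fact_def by (rule prod.remove) simp_all
  have "(\<Prod>a\<in>UNIV - {i}. fact ((J + axis i (Suc 0)) $ a) :: nat) = (\<Prod>a\<in>UNIV - {i}. fact (J $ a))"
    by (intro prod.cong refl) (simp add: axis_def)
  then show ?thesis
    unfolding split[of "J + axis i (Suc 0)"] split[of J] by (simp add: axis_def algebra_simps)
qed

text \<open>Splitting off the first letter of a word corresponds to \<open>(n+1)!/K! = \<Sum>\<^sub>i K(i) n!/K!\<close>, where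
\<open>K(i)/K! = 1/(K - 1\<^sub>i)!\<close>.\<close>

lemma sum_multinomial_words:
  fixes F :: "('m::{finite,linorder}) mindex \<Rightarrow> real"
  shows "(\<Sum>J | mi_size J = n. fact n / real (mi_fact J) * F J) = (\<Sum>w\<in>words n. F (count_mi w))"
proof (induction n arbitrary: F)
  case 0
  have "{J :: 'm mindex. mi_size J = 0} = {0}"
    by (auto simp: mi_size_def vec_eq_iff)
  then show ?case by (simp add: count_mi_Nil mi_fact_def)
next
  case (Suc n)
  have fin: "finite {J :: 'm mindex. mi_size J = n}" for n
    by (rule finite_subset[OF _ finite_mi_size_le[of n]]) auto
  have pos: "real (mi_fact J) > 0" for J :: "'m mindex"
    by (simp add: mi_fact_def prod_pos)
  have reindex: "(\<Sum>K | mi_size K = Suc n. real (K $ i) * (fact n / real (mi_fact K) * F K)) =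
      (\<Sum>J | mi_size J = n. fact n / real (mi_fact J) * F (J + axis i (Suc 0)))" for i
  proof -
    have "(\<Sum>K | mi_size K = Suc n. real (K $ i) * (fact n / real (mi_fact K) * F K)) =
        (\<Sum>K | mi_size K = Suc n \<and> K $ i \<noteq> 0. real (K $ i) * (fact n / real (mi_fact K) * F K))"
      using fin[of "Suc n"] by (intro sum.mono_neutral_right) auto
    also have "\<dots> = (\<Sum>J | mi_size J = n. fact n / real (mi_fact J) * F (J + axis i (Suc 0)))"
    proof (rule sum.reindex_bij_witness[where i = "\<lambda>J. J + axis i (Suc 0)" and j = "\<lambda>K. K - axis i (Suc 0)"])
      fix K :: "'m mindex" assume "K \<in> {K. mi_size K = Suc n \<and> K $ i \<noteq> 0}"
      then have K: "mi_size K = Suc n" "K $ i \<noteq> 0" by auto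
      then show eq: "K - axis i (Suc 0) + axis i (Suc 0) = K" by (auto simp: vec_eq_iff axis_def)
      then have "mi_size (K - axis i (Suc 0)) + 1 = mi_size K" using mi_size_add by (metis One_nat_def mi_size_axis)
      then show "K - axis i (Suc 0) \<in> {J. mi_size J = n}" using K by simp
      have "mi_fact K = K $ i * mi_fact (K - axis i (Suc 0))"
        using mi_fact_add_axis[of "K - axis i (Suc 0)" i] K unfolding eq by (simp add: axis_def)
      then show "fact n / real (mi_fact (K - axis i (Suc 0))) * F (K - axis i (Suc 0) + axis i (Suc 0)) =
          real (K $ i) * (fact n / real (mi_fact K) * F K)"
        unfolding eq using K by simp
    qed (auto simp: mi_size_add vec_eq_iff axis_nth)
    finally show ?thesis .
  qed
  have "(\<Sum>w\<in>words (Suc n). F (count_mi w)) = (\<Sum>i\<in>UNIV. \<Sum>w\<in>words n. F (count_mi w + axis i (Suc 0)))"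
    by (simp add: sum_words_Suc count_mi_Cons)
  also have "\<dots> = (\<Sum>i\<in>UNIV. \<Sum>J | mi_size J = n. fact n / real (mi_fact J) * F (J + axis i (Suc 0)))"
    using Suc.IH[of "\<lambda>J. F (J + axis i (Suc 0))" for i] by simp
  also have "\<dots> = (\<Sum>K | mi_size K = Suc n. \<Sum>i\<in>UNIV. real (K $ i) * (fact n / real (mi_fact K) * F K))"
    unfolding reindex[symmetric] by (rule sum.swap)
  also have "\<dots> = (\<Sum>K | mi_size K = Suc n. fact (Suc n) / real (mi_fact K) * F K)"
  proof (intro sum.cong refl)
    fix K :: "'m mindex" assume "K \<in> {K. mi_size K = Suc n}"
    then have "(\<Sum>i\<in>UNIV. real (K $ i)) = real (Suc n)"
      unfolding mi_size_def by (simp flip: of_nat_sum)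
    moreover have "(\<Sum>i\<in>UNIV. real (K $ i) * (fact n / real (mi_fact K) * F K)) =
        (\<Sum>i\<in>UNIV. real (K $ i)) * (fact n / real (mi_fact K) * F K)"
      by (rule sum_distrib_right[symmetric])
    ultimately show "(\<Sum>i\<in>UNIV. real (K $ i) * (fact n / real (mi_fact K) * F K)) = fact (Suc n) / real (mi_fact K) * F K"
      by (simp only: fact_Suc) simp
  qed
  finally show ?case by simp
qed

context jet_region
begin

text \<open>Equality on \<open>W\<close>. The operators of the statement yield forms which are not normalised outside \<open>W\<close>.\<close>

definition same_on :: "nat \<Rightarrow> ('m, 'n) form \<Rightarrow> ('m, 'n) form \<Rightarrow> bool" where
  "same_on r \<phi> \<psi> \<longleftrightarrow> (\<forall>x\<in>W. \<forall>Xs. length Xs = r \<longrightarrow> \<phi> x Xs = \<psi> x Xs)"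

lemma same_onD: "same_on r \<phi> \<psi> \<Longrightarrow> x \<in> W \<Longrightarrow> length Xs = r \<Longrightarrow> \<phi> x Xs = \<psi> x Xs"
  by (simp add: same_on_def)

lemma same_on_vert: "same_on r \<phi> \<psi> \<Longrightarrow> same_on r (vert_form i \<phi>) (vert_form i \<psi>)"
  by (simp add: same_on_def vert_form_def)

lemma same_on_lie:
  assumes "r = 1 \<or> r = 2" "\<psi> \<in> forms r" "same_on r \<phi> \<psi>"
  shows "same_on r (lie (total_deriv i) \<phi>) (tot i \<psi>)"
  unfolding same_on_def
proof (intro ballI allI impI)
  fix x and Xs :: "('m, 'n) jet list" assume x: "x \<in> W" and len: "length Xs = r"
  from assms(1) show "lie (total_deriv i) \<phi> x Xs = tot i \<psi> x Xs"
  proof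
    assume r: "r = 1"
    then obtain X where "Xs = [X]" using len by (auto simp: length_Suc_conv)
    moreover have "\<psi> \<in> forms 1" using assms(2) r by simp
    ultimately show ?thesis
      using lie_single[of \<psi> x \<phi>] same_onD[OF assms(3)] x r by simp
  next
    assume r: "r = 2"
    then obtain X Y where "Xs = [X, Y]" using len by (auto simp: length_Suc_conv numeral_2_eq_2)
    then show ?thesis
      using lie_pair[of \<psi> x \<phi>] same_onD[OF assms(3)] x r assms(2) by simp
  qed
qed

lemma same_on_ext_d:
  assumes "same_on 1 \<phi> \<psi>"
  shows "same_on 2 (ext_d \<phi>) (ed \<psi>)"
  unfolding same_on_def
proof (intro ballI allI impI)
  fix x and Xs :: "('m, 'n) jet list" assume x: "x \<in> W" and "length Xs = 2"
  then obtain X Y where Xs: "Xs = [X, Y]" by (auto simp: length_Suc_conv numeral_2_eq_2)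
  have "dir_deriv Z (\<lambda>y. \<phi> y [Y]) x = dir_deriv Z (\<lambda>y. \<psi> y [Y]) x" for Z Y
    by (rule dir_deriv_cong_W[OF x]) (simp add: same_onD[OF assms])
  then show "ext_d \<phi> x Xs = ed \<psi> x Xs"
    by (simp add: Xs ext_d_pair ed_pair[OF x])
qed

lemma P_scalar_words:
  assumes r: "r = 1 \<or> r = 2" and K: "1 \<le> K" and \<psi>: "\<psi> \<in> forms r" and same: "same_on r \<phi> \<psi>"
    and x: "x \<in> W" and Xs: "length Xs = r"
  shows "P_scalar K r s j \<phi> x Xs =
    (\<Sum>n<r * K. (-1) ^ n * fact (CARD('m) - s) / (real r ^ (n + 1) * fact (CARD('m) - s + n + 1)) *
       (\<Sum>w\<in>words n. foldr tot w (foldr vert_form w (vert_form j \<psi>)) x Xs))"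
proof -
  define F where "F = (\<lambda>J. mi_iter (\<lambda>i. lie (total_deriv i)) J (mi_iter vert_form (J + axis j 1) \<phi>) x Xs)"
  define C where "C = (\<lambda>n. (-1) ^ n * fact (CARD('m) - s) / (real r ^ (n + 1) * fact (CARD('m) - s + n + 1)) :: real)"
  have vert: "same_on r (foldr vert_form w \<phi>) (foldr vert_form w \<psi>)" for w
    by (induction w) (simp_all add: same same_on_vert)
  have lie: "same_on r (foldr (\<lambda>i. lie (total_deriv i)) w \<phi>') (foldr tot w \<psi>')"
    if "same_on r \<phi>' \<psi>'" "\<psi>' \<in> forms r" for w \<phi>' \<psi>'
    by (induction w) (simp_all add: that same_on_lie[OF r] foldr_closed_on[OF forms_tot])
  have F: "F (count_mi w) = foldr tot w (foldr vert_form w (vert_form j \<psi>)) x Xs" for w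
  proof -
    have "F (count_mi w) = mi_iter tot (count_mi w) (mi_iter vert_form (count_mi (j # w)) \<psi>) x Xs"
      unfolding F_def mi_iter_foldr
      by (rule same_onD[OF lie x Xs]) (simp_all add: count_mi_Cons vert forms_foldr_vert \<psi>)
    also have "mi_iter vert_form (count_mi (j # w)) \<psi> = foldr vert_form (j # w) \<psi>"
      by (rule mi_iter_count_mi[of "forms r" vert_form, OF forms_vert vert_commute \<psi>])
    also have "foldr vert_form (j # w) \<psi> = foldr vert_form w (vert_form j \<psi>)"
      using foldr_commute_on[of "forms r" vert_form, OF forms_vert vert_commute \<psi>] by simp
    also have "mi_iter tot (count_mi w) (foldr vert_form w (vert_form j \<psi>)) =
        foldr tot w (foldr vert_form w (vert_form j \<psi>))"
      by (rule mi_iter_count_mi[of "forms r" tot, OF forms_tot tot_commute forms_foldr_vert[OF forms_vert[OF \<psi>]]])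
    finally show ?thesis .
  qed
  have "P_scalar K r s j \<phi> x Xs = (\<Sum>J | mi_size J \<le> r * K - 1. C (mi_size J) * (fact (mi_size J) / real (mi_fact J) * F J))"
    unfolding P_scalar_def C_def F_def by (intro sum.cong refl) simp
  also have "\<dots> = (\<Sum>n<r * K. \<Sum>J\<in>{J \<in> {J. mi_size J \<le> r * K - 1}. mi_size J = n}.
      C (mi_size J) * (fact (mi_size J) / real (mi_fact J) * F J))"
  proof (rule sum.group[symmetric])
    have "0 < r * K" using r K by auto
    then have "n < r * K" if "n \<le> r * K - 1" for n using that by linarith
    then show "mi_size ` {J :: 'm mindex. mi_size J \<le> r * K - 1} \<subseteq> {..<r * K}" by blast
  qed (simp_all add: finite_mi_size_le)
  also have "\<dots> = (\<Sum>n<r * K. C n * (\<Sum>J | mi_size J = n. fact n / real (mi_fact J) * F J))"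
  proof (intro sum.cong refl)
    fix n assume "n \<in> {..<r * K}"
    then have "{J :: 'm mindex. J \<in> {J. mi_size J \<le> r * K - 1} \<and> mi_size J = n} = {J. mi_size J = n}" by auto
    then show "(\<Sum>J\<in>{J \<in> {J. mi_size J \<le> r * K - 1}. mi_size J = n}.
      C (mi_size J) * (fact (mi_size J) / real (mi_fact J) * F J)) =
      C n * (\<Sum>J | mi_size J = n. fact n / real (mi_fact J) * F J)"
      by (simp add: sum_distrib_left)
  qed
  also have "\<dots> = (\<Sum>n<r * K. C n * (\<Sum>w\<in>words n. foldr tot w (foldr vert_form w (vert_form j \<psi>)) x Xs))"
    unfolding sum_multinomial_words F ..
  finally show ?thesis unfolding C_def .
qed

end

section \<open>Vector-valued forms\<close>

lemma hook_coeff_UNIV: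
  "hook_coeff j UNIV B = (if B = UNIV - {j} then (-1) ^ card {a. a < j} else 0)"
  by (simp add: hook_coeff_def)

text \<open>The coefficient of \<open>dt\<^sup>B\<close> in
\<open>dt\<^sup>i \<and> (\<partial>\<^sub>l \<lrcorner> \<partial>\<^sub>j \<lrcorner> d\<^sup>mt) = \<delta>\<^sup>i\<^sub>l \<partial>\<^sub>j \<lrcorner> d\<^sup>mt - \<delta>\<^sup>i\<^sub>j \<partial>\<^sub>l \<lrcorner> d\<^sup>mt\<close> for \<open>l \<noteq> j\<close>. The sign in the last term comes from
the smaller of \<open>l\<close> and \<open>j\<close> being counted, or not, among the indices below the larger one.\<close>

lemma sum_wedge_hook_hook:
  fixes i j l :: "'m::{finite,linorder}"
  shows "(\<Sum>C\<in>UNIV. \<Sum>A\<in>UNIV. wedge_coeff i C B * (hook_coeff l A C * hook_coeff j UNIV A)) =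
    (if l = j then 0 else (if i = l then hook_coeff j UNIV B else 0) - (if i = j then hook_coeff l UNIV B else 0))"
    (is "?S = _")
proof -
  have "?S = (\<Sum>C\<in>UNIV. \<Sum>A\<in>UNIV. if A = UNIV - {j} then
      wedge_coeff i C B * (hook_coeff l (UNIV - {j}) C * (-1) ^ card {a. a < j}) else 0)"
    by (intro sum.cong refl) (simp add: hook_coeff_UNIV)
  also have "\<dots> = (\<Sum>C\<in>UNIV. wedge_coeff i C B * (hook_coeff l (UNIV - {j}) C * (-1) ^ card {a. a < j}))"
    by simp
  also have "\<dots> = (\<Sum>C\<in>UNIV. if C = UNIV - {j} - {l} then (if l = j then 0 else
      wedge_coeff i (UNIV - {j} - {l}) B * ((-1) ^ card {a \<in> UNIV - {j}. a < l} * (-1) ^ card {a. a < j})) else 0)"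
    by (intro sum.cong refl) (simp add: hook_coeff_def)
  also have "\<dots> = (if l = j then 0 else
      wedge_coeff i (UNIV - {j} - {l}) B * ((-1) ^ card {a \<in> UNIV - {j}. a < l} * (-1) ^ card {a. a < j}))"
    by simp
  finally have S: "?S = (if l = j then 0 else
      wedge_coeff i (UNIV - {j} - {l}) B * ((-1) ^ card {a \<in> UNIV - {j}. a < l} * (-1) ^ card {a. a < j}))" .
  show ?thesis
  proof (cases "l = j")
    case False
    have square: "(-1) ^ c * ((-1) ^ c * z) = (z :: real)" for c z
      by (simp flip: mult.assoc power_mult_distrib)
    consider "i = l" | "i = j" "i \<noteq> l" | "i \<noteq> l" "i \<noteq> j" by blast
    then show ?thesis
    proof cases
      case 1
      have "{a \<in> UNIV - {j} - {l}. a < l} = {a \<in> UNIV - {j}. a < l}" "insert l (UNIV - {j} - {l}) = UNIV - {j}"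
        using False by auto
      then show ?thesis
        unfolding S using 1 False by (simp add: wedge_coeff_def hook_coeff_UNIV square)
    next
      case 2
      have ins: "insert j (UNIV - {j} - {l}) = UNIV - {l}" using False by auto
      have sets: "{a \<in> UNIV - {j} - {l}. a < j} = {a. a < j} - {l}" "{a \<in> UNIV - {j}. a < l} = {a. a < l} - {j}"
        by auto
      have sign: "(-1) ^ card ({a. a < j} - {l}) * ((-1) ^ card ({a. a < l} - {j}) * (-1) ^ card {a. a < j}) =
          - ((-1) ^ card {a. a < l} :: real)"
      proof (cases "l < j")
        case True
        have "card {a. a < j} = Suc (card ({a. a < j} - {l}))"
          by (rule card.remove) (use True in auto)
        moreover have "{a. a < l} - {j} = {a. a < l}" using True by auto
        moreover have "(-1) ^ c * (z * (-1) ^ Suc c) = - (z :: real)" for c z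
          by (cases "even c") simp_all
        ultimately show ?thesis by (simp only:)
      next
        case F: False
        have "card {a. a < l} = Suc (card ({a. a < l} - {j}))"
          by (rule card.remove) (use F False in auto)
        moreover have "{a. a < j} - {l} = {a. a < j}" using F by auto
        moreover have "(-1) ^ c * ((-1) ^ d * (-1) ^ c) = - ((-1) ^ Suc d :: real)" for c d
          by (cases "even c") simp_all
        ultimately show ?thesis by (simp only:)
      qed
      have w: "wedge_coeff i (UNIV - {j} - {l}) B = (if B = UNIV - {l} then (-1) ^ card ({a. a < j} - {l}) else 0)"
        unfolding wedge_coeff_def \<open>i = j\<close> ins sets by simp
      show ?thesis
        unfolding S unfolding w sets hook_coeff_UNIV using 2 False sign by simp
    next
      case 3
      then show ?thesis unfolding S by (simp add: wedge_coeff_def)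
    qed
  next
    case True
    then show ?thesis unfolding S by simp
  qed
qed

context homogeneous_lagrangian
begin

lemma forms_\<theta>: "\<theta> j \<in> forms 1"
  unfolding \<theta>_def by (intro one.closed lin_on_closed[OF one.lin_U] s_dL)

lemma lin_P2: "lin_on (forms 2) (forms 2) (P2 l)"
proof -
  note U = two.lin_U and vert = two.s
  show ?thesis
    unfolding lin_on_def P2_def
    by (auto simp: lin_on_add[OF vert] lin_on_scaleR[OF vert] lin_on_add[OF U] lin_on_scaleR[OF U]
        lin_on_closed[OF U] two.closed scaleR_add_right sum.distrib scaleR_sum_right) (simp add: mult.commute)
qed

lemma P_scalar_dL:
  assumes "same_on 1 \<phi> dL"
  shows "same_on 1 (P_scalar k 1 CARD('m) j \<phi>) (\<theta> j)"
  unfolding same_on_def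
  by (intro ballI allI impI)
     (simp add: P_scalar_words[OF _ k dL assms] \<theta>_def one.U_def sum_apply \<theta>coeff_def del: One_nat_def)

lemma P_scalar_zero:
  assumes "same_on 1 \<phi> 0"
  shows "same_on 1 (P_scalar k 1 s j \<phi>) 0"
  unfolding same_on_def
  by (intro ballI allI impI)
     (simp add: P_scalar_words[OF _ k subspace_0[OF subspace_forms] assms] lin_on_zero[OF one.A one.s]
       lin_on_zero[OF one.A one.sw] lin_on_zero[OF one.A one.tw] del: One_nat_def)

lemma P_scalar_2:
  assumes "\<psi> \<in> forms 2" "same_on 2 \<phi> \<psi>" "CARD('m) \<ge> 2"
  shows "same_on 2 (P_scalar (2 * k - 1) 2 (CARD('m) - 1) l \<phi>) (P2 l \<psi>)"
proof -
  have "CARD('m) - (CARD('m) - 1) = 1" "2 * (2 * k - 1) = 4 * k - 2" "1 \<le> 2 * k - 1"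
    using assms(3) k by auto
  note eq = this
  show ?thesis
    unfolding same_on_def
  proof (intro ballI allI impI)
    fix x and Xs :: "('m, 'n) jet list" assume "x \<in> W" "length Xs = 2"
    note words = P_scalar_words[OF disjI2[OF refl] eq(3) assms(1,2) this, of "CARD('m) - 1" l]
    show "P_scalar (2 * k - 1) 2 (CARD('m) - 1) l \<phi> x Xs = P2 l \<psi> x Xs"
      unfolding words eq(1,2) P2_def two.U_def by (simp add: sum_apply Pcoeff_def)
  qed
qed

text \<open>Collecting the coefficient of \<open>\<partial>\<^sub>j \<lrcorner> d\<^sup>mt\<close> in \<open>i\<^sub>T \<Theta>\<^sub>2\<close> gives the sum over \<open>l \<noteq> j\<close> of
\<open>i\<^sub>l (P\<^sup>l d\<theta>\<^sup>j - P\<^sup>j d\<theta>\<^sup>l)\<close>, and each summand is \<open>\<theta>\<^sup>j\<close>.\<close>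

theorem Theta1_eq_contraction_Theta2:
  fixes \<Phi> :: "('m, 'n) vform"
  assumes m: "CARD('m) \<ge> 2"
    and \<Phi>: "\<And>A. same_on 1 (\<Phi> A) (if A = UNIV then dL else 0)"
    and x: "x \<in> W" and Xs: "length Xs = 1"
  defines "\<Theta>1 \<equiv> P_op k 1 CARD('m) \<Phi>"
  defines "\<Theta>2 \<equiv> P_op (2 * k - 1) 2 (CARD('m) - 1) (v_ext_d \<Theta>1)"
  shows "\<Theta>1 B x Xs = 1 / (real CARD('m) - 1) * v_total \<Theta>2 B x Xs"
proof -
  let ?h = "\<lambda>j. hook_coeff j (UNIV :: 'm set)"
  define T1 where "T1 = (\<lambda>B. \<Sum>j\<in>UNIV. ?h j B *\<^sub>R \<theta> j)"
  have T1: "T1 B \<in> forms 1" for B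
    unfolding T1_def by (intro one.closed forms_\<theta>)
  have \<Theta>1: "same_on 1 (\<Theta>1 B) (T1 B)" for B
    unfolding same_on_def
  proof (intro ballI allI impI)
    fix x and Xs :: "('m, 'n) jet list" assume x: "x \<in> W" and Xs: "length Xs = 1"
    have "\<Theta>1 B x Xs = (\<Sum>A\<in>(UNIV :: 'm set set). if A = UNIV then \<Sum>j\<in>UNIV. ?h j B * \<theta> j x Xs else 0)"
      unfolding \<Theta>1_def P_op_def
    proof (intro sum.cong refl)
      fix A :: "'m set"
      have "P_scalar k 1 CARD('m) j (\<Phi> A) x Xs = (if A = UNIV then \<theta> j x Xs else 0)" for j
      proof (cases "A = UNIV")
        case True
        then show ?thesis using same_onD[OF P_scalar_dL x Xs, of "\<Phi> A" j] \<Phi>[of A] by simp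
      next
        case False
        then show ?thesis using same_onD[OF P_scalar_zero x Xs, of "\<Phi> A" "CARD('m)" j] \<Phi>[of A] by simp
      qed
      then show "(\<Sum>j\<in>UNIV. hook_coeff j A B * P_scalar k 1 CARD('m) j (\<Phi> A) x Xs) =
          (if A = UNIV then \<Sum>j\<in>UNIV. ?h j B * \<theta> j x Xs else 0)"
        by simp
    qed
    then show "\<Theta>1 B x Xs = T1 B x Xs" by (simp add: T1_def sum_apply)
  qed
  define q where "q = (\<lambda>i l j. P2 l (ed (\<theta> j)) x (total_deriv i x # Xs))"
  have \<Theta>2: "\<Theta>2 C x (total_deriv i x # Xs) =
      (\<Sum>A\<in>UNIV. \<Sum>l\<in>UNIV. \<Sum>j\<in>UNIV. hook_coeff l A C * ?h j A * q i l j)" for C i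
  proof -
    have len: "length (total_deriv i x # Xs) = 2" using Xs by simp
    have "P_scalar (2 * k - 1) 2 (CARD('m) - 1) l (v_ext_d \<Theta>1 A) x (total_deriv i x # Xs) =
        (\<Sum>j\<in>UNIV. ?h j A * q i l j)" for l A
    proof -
      have "same_on 2 (v_ext_d \<Theta>1 A) (ed (T1 A))"
        unfolding v_ext_d_def by (rule same_on_ext_d[OF \<Theta>1])
      then have "P_scalar (2 * k - 1) 2 (CARD('m) - 1) l (v_ext_d \<Theta>1 A) x (total_deriv i x # Xs) =
          P2 l (ed (T1 A)) x (total_deriv i x # Xs)"
        by (rule same_onD[OF P_scalar_2[OF forms_ed[OF T1] _ m] x len])
      also have "ed (T1 A) = (\<Sum>j\<in>UNIV. ?h j A *\<^sub>R ed (\<theta> j))"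
        unfolding T1_def
        by (simp add: lin_on_sum[OF one.A E] one.closed(6) forms_\<theta> lin_on_scaleR[OF E] del: One_nat_def)
      also have "P2 l \<dots> = (\<Sum>j\<in>UNIV. ?h j A *\<^sub>R P2 l (ed (\<theta> j)))"
        by (simp add: lin_on_sum[OF two.A lin_P2] two.closed(6) forms_ed forms_\<theta> lin_on_scaleR[OF lin_P2] del: One_nat_def)
      finally show ?thesis by (simp add: q_def sum_apply)
    qed
    then show ?thesis
      unfolding \<Theta>2_def P_op_def by (simp add: sum_distrib_left mult.assoc)
  qed
  have "v_total \<Theta>2 B x Xs =
      (\<Sum>C\<in>UNIV. \<Sum>i\<in>UNIV. \<Sum>A\<in>UNIV. \<Sum>l\<in>UNIV. \<Sum>j\<in>UNIV. wedge_coeff i C B * (hook_coeff l A C * ?h j A) * q i l j)"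
    unfolding v_total_def contract_def \<Theta>2 by (simp add: sum_distrib_left mult.assoc)
  also have "\<dots> = (\<Sum>i\<in>UNIV. \<Sum>l\<in>UNIV. \<Sum>j\<in>UNIV. \<Sum>C\<in>UNIV. \<Sum>A\<in>UNIV. wedge_coeff i C B * (hook_coeff l A C * ?h j A) * q i l j)"
  proof -
    have "(\<Sum>C\<in>UNIV. \<Sum>i\<in>UNIV. \<Sum>A\<in>UNIV. \<Sum>l\<in>UNIV. \<Sum>j\<in>UNIV. f C i A l j) =
        (\<Sum>i\<in>UNIV. \<Sum>l\<in>UNIV. \<Sum>j\<in>UNIV. \<Sum>C\<in>UNIV. \<Sum>A\<in>UNIV. f C i A l j)"
      for f :: "'m set \<Rightarrow> 'm \<Rightarrow> 'm set \<Rightarrow> 'm \<Rightarrow> 'm \<Rightarrow> real"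
    proof -
      have 1: "(\<Sum>A\<in>UNIV. \<Sum>l\<in>UNIV. \<Sum>j\<in>UNIV. g A l j) = (\<Sum>l\<in>UNIV. \<Sum>j\<in>UNIV. \<Sum>A\<in>UNIV. g A l j)"
        for g :: "'m set \<Rightarrow> 'm \<Rightarrow> 'm \<Rightarrow> real"
        by (subst sum.swap) (intro sum.cong refl sum.swap)
      have "(\<Sum>C\<in>UNIV. \<Sum>i\<in>UNIV. \<Sum>A\<in>UNIV. \<Sum>l\<in>UNIV. \<Sum>j\<in>UNIV. f C i A l j) =
          (\<Sum>i\<in>UNIV. \<Sum>C\<in>UNIV. \<Sum>A\<in>UNIV. \<Sum>l\<in>UNIV. \<Sum>j\<in>UNIV. f C i A l j)"
        by (rule sum.swap)
      also have "\<dots> = (\<Sum>i\<in>UNIV. \<Sum>C\<in>UNIV. \<Sum>l\<in>UNIV. \<Sum>j\<in>UNIV. \<Sum>A\<in>UNIV. f C i A l j)"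
        by (rule sum.cong[OF refl], rule sum.cong[OF refl], rule 1)
      also have "\<dots> = (\<Sum>i\<in>UNIV. \<Sum>l\<in>UNIV. \<Sum>j\<in>UNIV. \<Sum>C\<in>UNIV. \<Sum>A\<in>UNIV. f C i A l j)"
        by (rule sum.cong[OF refl], rule 1)
      finally show ?thesis .
    qed
    then show ?thesis .
  qed
  also have "\<dots> = (\<Sum>i\<in>UNIV. \<Sum>l\<in>UNIV. \<Sum>j\<in>UNIV. (if l = j then 0 else
      (if i = l then ?h j B else 0) - (if i = j then ?h l B else 0)) * q i l j)"
    unfolding sum_distrib_right[symmetric] sum_wedge_hook_hook ..
  also have "\<dots> = (\<Sum>l\<in>UNIV. \<Sum>j\<in>UNIV. \<Sum>i\<in>UNIV. (if l = j then 0 else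
      (if i = l then ?h j B else 0) - (if i = j then ?h l B else 0)) * q i l j)"
    by (subst sum.swap) (intro sum.cong refl sum.swap)
  also have "\<dots> = (\<Sum>l\<in>UNIV. \<Sum>j\<in>UNIV. if l = j then 0 else ?h j B * q l l j - ?h l B * q j l j)"
  proof (intro sum.cong refl)
    fix l j
    have "(\<Sum>i\<in>UNIV. ((if i = l then ?h j B else 0) - (if i = j then ?h l B else 0)) * q i l j) =
        (\<Sum>i\<in>UNIV. (if i = l then ?h j B * q i l j else 0) - (if i = j then ?h l B * q i l j else 0))"
      by (intro sum.cong refl) (simp add: left_diff_distrib)
    then show "(\<Sum>i\<in>UNIV. (if l = j then 0 else (if i = l then ?h j B else 0) - (if i = j then ?h l B else 0)) * q i l j) =
        (if l = j then 0 else ?h j B * q l l j - ?h l B * q j l j)"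
      by (simp add: sum_subtractf)
  qed
  also have "\<dots> = (\<Sum>j\<in>UNIV. \<Sum>l\<in>UNIV. if l = j then 0 else ?h j B * q l l j) -
      (\<Sum>l\<in>UNIV. \<Sum>j\<in>UNIV. if l = j then 0 else ?h l B * q j l j)"
  proof -
    have "(\<Sum>l\<in>UNIV. \<Sum>j\<in>UNIV. if l = j then 0 else ?h j B * q l l j - ?h l B * q j l j) =
        (\<Sum>l\<in>UNIV. \<Sum>j\<in>UNIV. (if l = j then 0 else ?h j B * q l l j) - (if l = j then 0 else ?h l B * q j l j))"
      by (intro sum.cong refl) simp
    also have "\<dots> = (\<Sum>l\<in>UNIV. \<Sum>j\<in>UNIV. if l = j then 0 else ?h j B * q l l j) -
        (\<Sum>l\<in>UNIV. \<Sum>j\<in>UNIV. if l = j then 0 else ?h l B * q j l j)"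
      by (simp only: sum_subtractf)
    finally show ?thesis by (subst (asm) (2) sum.swap)
  qed
  \<comment> \<open>with the indices of the second sum renamed, the summands pair up to the contraction computed by \<open>contraction_P2\<close>\<close>
  also have "\<dots> = (\<Sum>j\<in>UNIV. \<Sum>l\<in>UNIV. if l = j then 0 else ?h j B * \<theta> j x Xs)"
  proof -
    have "q l l j - q l j l = \<theta> j x Xs" if "l \<noteq> j" for l j
      using fun_cong[OF fun_cong[OF contraction_P2[OF that]], of x Xs]
      by (simp add: q_def ct_single)
    then have "(if l = j then 0 else ?h j B * q l l j) - (if j = l then 0 else ?h j B * q l j l) =
        (if l = j then 0 else ?h j B * \<theta> j x Xs)" for l j
      by (simp flip: right_diff_distrib)
    then show ?thesis by (simp flip: sum_subtractf)
  qed
  also have "\<dots> = (real CARD('m) - 1) * (\<Sum>j\<in>UNIV. ?h j B * \<theta> j x Xs)"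
  proof -
    have "(\<Sum>l\<in>UNIV. if l = j then 0 else z) = (real CARD('m) - 1) * z" for j :: 'm and z :: real
    proof -
      have "(\<Sum>l\<in>UNIV. if l = j then 0 else z) = (\<Sum>l\<in>UNIV - {j}. z)"
        by (rule sum.mono_neutral_cong_right) auto
      then show ?thesis using m by (simp add: card_Diff_singleton of_nat_diff)
    qed
    then show ?thesis by (simp add: sum_distrib_left)
  qed
  also have "(\<Sum>j\<in>UNIV. ?h j B * \<theta> j x Xs) = \<Theta>1 B x Xs"
    using same_onD[OF \<Theta>1 x Xs, of B] by (simp add: T1_def sum_apply)
  finally show ?thesis using m by simp
qed

end

section \<open>Coordinate expressions on the frame bundle\<close>

lemma open_jet_ball:
  fixes x :: "('m::finite, 'n::finite) jet"
  assumes "finite F"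
  shows "open {y :: ('m, 'n) jet. \<forall>I\<in>F. dist (y I) (x I) < \<epsilon>}"
proof -
  have "open {y :: ('m, 'n) jet. dist (y I) (x I) < \<epsilon>}" for I
    by (intro open_Collect_less continuous_intros continuous_on_product_coordinates[THEN continuous_on_subset]) simp_all
  moreover have "{y :: ('m, 'n) jet. \<forall>I\<in>F. dist (y I) (x I) < \<epsilon>} = (\<Inter>I\<in>F. {y. dist (y I) (x I) < \<epsilon>})"
    by auto
  ultimately show ?thesis using assms by (simp add: open_INT)
qed

text \<open>An injective linear map is bounded below by a positive multiple of the norm; a perturbation smaller
than this bound stays injective.\<close>

lemma open_immersive: "open {x :: ('m::finite, 'n::finite) jet. immersive x}"
proof (subst open_subopen, rule ballI)
  fix x :: "('m, 'n) jet" assume "x \<in> {x. immersive x}"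
  define f where "f = (\<lambda>(x :: ('m, 'n) jet) (v :: real ^ 'm). \<Sum>j\<in>UNIV. v $ j *\<^sub>R x (axis j 1))"
  have lin: "linear (f x)" for x
    unfolding f_def by (intro linearI) (simp_all add: scaleR_add_left sum.distrib scaleR_sum_right)
  have "inj (f x)" using \<open>x \<in> {x. immersive x}\<close> by (simp add: immersive_def f_def)
  then obtain B where B: "B > 0" "\<And>v. B * norm v \<le> norm (f x v)"
    using linear_inj_bounded_below_pos[OF lin] by metis
  \<comment> \<open>so small that \<open>CARD('m)\<close> perturbed columns change \<open>f x v\<close> by less than \<open>B * norm v\<close>\<close>
  define \<epsilon> where "\<epsilon> = B / real CARD('m)"
  let ?F = "(\<lambda>j :: 'm. axis j 1 :: 'm mindex) ` UNIV"
  let ?T = "{y. \<forall>I\<in>?F. dist (y I) (x I) < \<epsilon>}"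
  have "\<epsilon> > 0" using B(1) by (simp add: \<epsilon>_def)
  show "\<exists>T. open T \<and> x \<in> T \<and> T \<subseteq> {x. immersive x}"
  proof (intro exI conjI)
    show "open ?T" by (rule open_jet_ball) simp
    show "x \<in> ?T" using \<open>\<epsilon> > 0\<close> by simp
    show "?T \<subseteq> {x. immersive x}"
    proof
      fix y assume y: "y \<in> ?T"
      have "v = 0" if "f y v = 0" for v
      proof (rule ccontr)
        assume "v \<noteq> 0"
        have "f x v = (\<Sum>j\<in>UNIV. v $ j *\<^sub>R (x (axis j 1) - y (axis j 1)))"
          using that by (simp add: f_def scaleR_diff_right sum_subtractf)
        also have "norm \<dots> \<le> (\<Sum>j\<in>UNIV. \<bar>v $ j\<bar> * dist (y (axis j 1)) (x (axis j 1)))"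
          by (rule order_trans[OF norm_sum]) (simp add: dist_norm norm_minus_commute)
        also have "\<dots> < (\<Sum>j\<in>(UNIV :: 'm set). norm v * \<epsilon>)"
        proof (rule sum_strict_mono)
          fix j :: 'm
          have d: "dist (y (axis j 1)) (x (axis j 1)) < \<epsilon>" using y by blast
          have "\<bar>v $ j\<bar> * dist (y (axis j 1)) (x (axis j 1)) \<le> norm v * dist (y (axis j 1)) (x (axis j 1))"
            by (intro mult_right_mono component_le_norm_cart) simp
          also have "\<dots> < norm v * \<epsilon>" using d \<open>v \<noteq> 0\<close> by simp
          finally show "\<bar>v $ j\<bar> * dist (y (axis j 1)) (x (axis j 1)) < norm v * \<epsilon>" .
        qed simp_all
        also have "\<dots> = B * norm v" by (simp add: \<epsilon>_def)
        finally show False using B(2)[of v] by simp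
      qed
      then have "inj (f y)" using linear_injective_0[OF lin] by blast
      then show "y \<in> {x. immersive x}" by (simp add: immersive_def f_def)
    qed
  qed
qed

lemma open_jet_domain:
  fixes c :: "('e, 'n::finite) chart"
  assumes "open (snd c ` fst c)"
  shows "open (jet_domain c :: ('m::finite, 'n) jet set)"
proof -
  have "open ((\<lambda>x :: ('m, 'n) jet. x 0) -` (snd c ` fst c))"
    by (rule open_vimage[OF assms continuous_on_product_coordinates])
  moreover have "jet_domain c = (\<lambda>x :: ('m, 'n) jet. x 0) -` (snd c ` fst c) \<inter> {x. immersive x}"
    by (auto simp: jet_domain_def)
  ultimately show ?thesis by (simp only: open_Int[OF _ open_immersive])
qed

lemma jet_region_jet_domain:
  fixes c :: "('e, 'n::finite) chart"
  assumes "open (snd c ` fst c)"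
  shows "jet_region (jet_domain c :: ('m::{finite,linorder}, 'n) jet set)"
proof
  show "open (jet_domain c :: ('m, 'n) jet set)" by (rule open_jet_domain[OF assms])
  fix x y :: "('m, 'n) jet" assume x: "x \<in> jet_domain c" and xy: "agree 1 x y"
  have "x 0 = y 0" "x (axis j 1) = y (axis j 1)" for j
    using xy by (simp_all add: agree_def mi_size_def) (simp_all add: agree_def flip: mi_size_def)
  then show "y \<in> jet_domain c" using x by (simp add: jet_domain_def immersive_def)
qed

lemma coord_rep_agree: "agree k x y \<Longrightarrow> coord_rep \<A> k c f x = coord_rep \<A> k c f y"
proof -
  assume "agree k x y"
  then have "(\<forall>I. mi_size I \<le> k \<longrightarrow> jet_of c \<gamma> I = x I) \<longleftrightarrow> (\<forall>I. mi_size I \<le> k \<longrightarrow> jet_of c \<gamma> I = y I)" for \<gamma>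
    by (auto simp: agree_def)
  then show ?thesis unfolding coord_rep_def by simp
qed

lemma lie_fun_form: "lie V (fun_form f) x [] = dir_deriv (V x) f x"
  by (simp add: lie_def contract_def ext_d_single ext_d_def fun_form_def)

lemma fund_field_word: "fund_field (count_mi w) j x = vert_word w (total_deriv j x)"
  unfolding fund_field_def
  by (rule mi_iter_count_mi[of UNIV vert_endo]) (simp_all add: vert_endo_commute)

lemma homogeneous_lagrangian_coord_rep:
  fixes \<A> :: "('e, 'n::finite) chart set"
    and L :: "('e, 'm::{finite,linorder}) param set \<Rightarrow> real"
  assumes "smooth_manifold E \<A>" "k \<ge> 1" "smooth_on_frames \<A> k L" "homogeneous \<A> k L" and c: "c \<in> \<A>"
  shows "homogeneous_lagrangian (jet_domain c) (coord_rep \<A> k c L) k"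
proof -
  have "open (snd c ` fst c)"
    using assms(1) c unfolding smooth_manifold_def by (auto simp: case_prod_beta)
  then interpret jet_region "jet_domain c :: ('m, 'n) jet set" by (rule jet_region_jet_domain)
  show ?thesis
  proof
    show "smooth_order k (coord_rep \<A> k c L)"
      using assms(2,3) c coord_rep_agree unfolding smooth_order_def smooth_on_frames_def by blast
    fix x :: "('m, 'n) jet" and w :: "'m list" and j
    assume x: "x \<in> jet_domain c" and "w \<noteq> []"
    have hom: "lie (fund_field (axis i 1) j) (fun_form (coord_rep \<A> k c L)) x [] = (if i = j then coord_rep \<A> k c L x else 0)"
      "2 \<le> mi_size I \<Longrightarrow> lie (fund_field I j) (fun_form (coord_rep \<A> k c L)) x [] = 0" for i I
      using assms(4) c x unfolding homogeneous_def by blast+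
    show "dir_deriv (vert_word w (total_deriv j x)) (coord_rep \<A> k c L) x = (if w = [j] then coord_rep \<A> k c L x else 0)"
    proof (cases "length w \<ge> 2")
      case True
      then show ?thesis
        using hom(2)[of "count_mi w"] by (auto simp: mi_size_count_mi lie_fun_form fund_field_word)
    next
      case False
      with \<open>w \<noteq> []\<close> obtain i where w: "w = [i]" by (cases w; cases "tl w") auto
      have "count_mi [i] = axis i 1" by (simp add: count_mi_Cons count_mi_Nil)
      then show ?thesis
        using hom(1)[of i] fund_field_word[of w j x] unfolding w by (simp add: lie_fun_form)
    qed
  qed
qed

text \<open>Whichever representative of the class \<open>\<Theta>\<^sub>0\<close> is selected, it differs from \<open>L d\<^sup>mt\<close> by a constant, which
the exterior derivative removes.\<close>

lemma (in homogeneous_lagrangian) coset_d_Theta0: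
  assumes "L = coord_rep \<A> k c F"
  shows "same_on 1 (coset_d \<A> k c (Theta0 F) A) (if A = UNIV then dL else 0)"
proof -
  define G where "G = (SOME G. G \<in> Theta0 F)"
  have "(\<lambda>A p. if A = UNIV then F p else 0) \<in> Theta0 F"
    unfolding Theta0_def const_coset_def by (intro CollectI exI[of _ "\<lambda>_. 0"]) simp
  then have "G \<in> Theta0 F" unfolding G_def by (rule someI[of "\<lambda>G. G \<in> Theta0 F"])
  then obtain b where b: "\<And>A. card A \<noteq> CARD('m) \<Longrightarrow> b A = 0"
    and G: "G = (\<lambda>A p. (if A = UNIV then F p else 0) + b A)"
    unfolding Theta0_def const_coset_def by blast
  have coset: "coset_d \<A> k c (Theta0 F) A = ext_d (fun_form (coord_rep \<A> k c (G A)))"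
    by (simp add: coset_d_def v_ext_d_def G_def)
  show ?thesis
  proof (cases "A = UNIV")
    case True
    have rep: "coord_rep \<A> k c (G A) = (\<lambda>x. L x + b A)"
      by (rule ext) (simp add: assms G True coord_rep_def)
    show ?thesis
      unfolding same_on_def
    proof (intro ballI allI impI)
      fix x and Xs :: "('m, 'n) jet list" assume x: "x \<in> W" and "length Xs = 1"
      then obtain X where "Xs = [X]" by (auto simp: length_Suc_conv)
      moreover have "dir_deriv X (\<lambda>x. L x + b A) x = dir_deriv X L x"
        using dir_deriv_add[OF smooth_L smooth_order_const[of 1] x] by simp
      ultimately show "coset_d \<A> k c (Theta0 F) A x Xs = (if A = UNIV then dL else 0) x Xs"
        unfolding coset rep by (simp add: True ext_d_single fun_form_def dL_single[OF x])
    qed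
  next
    case False
    then have "card A < CARD('m)" by (intro psubset_card_mono) auto
    then have "coord_rep \<A> k c (G A) = (\<lambda>x. 0)"
      using b[of A] False by (intro ext) (simp add: G coord_rep_def)
    then show ?thesis
      using False by (simp add: same_on_def coset ext_d_def fun_form_def)
  qed
qed

theorem theorem5p3:
  fixes E :: "'e topology"
    and \<A> :: "('e, 'n::finite) chart set"
    and L :: "('e, 'm::{finite,linorder}) param set \<Rightarrow> real"
    and k :: nat
  assumes "smooth_manifold E \<A>"
    and "CARD('m) \<ge> 2"
    and "k \<ge> 1"
    and "smooth_on_frames \<A> k L"
    and "homogeneous \<A> k L"
  shows "\<forall>c\<in>\<A>. \<forall>B. \<forall>x\<in>jet_domain c. \<forall>Xs. length Xs = 1 \<longrightarrow>
           Theta1 \<A> k L c B x Xs = 1 / (real CARD('m) - 1) * v_total (Theta2 \<A> k L c) B x Xs"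
proof (intro ballI allI impI)
  fix c B and x :: "('m, 'n) jet" and Xs :: "('m, 'n) jet list"
  assume "c \<in> \<A>" "x \<in> jet_domain c" "length Xs = 1"
  interpret homogeneous_lagrangian "jet_domain c :: ('m, 'n) jet set" "coord_rep \<A> k c L" k
    by (rule homogeneous_lagrangian_coord_rep[OF assms(1,3,4,5) \<open>c \<in> \<A>\<close>])
  show "Theta1 \<A> k L c B x Xs = 1 / (real CARD('m) - 1) * v_total (Theta2 \<A> k L c) B x Xs"
    unfolding Theta2_def Theta1_def
    by (rule Theta1_eq_contraction_Theta2[OF assms(2) coset_d_Theta0[OF refl] \<open>x \<in> jet_domain c\<close> \<open>length Xs = 1\<close>])
qed

end
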